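(* Let $G$ be the infinite line graph (vertex set $\mathbb Z$, with $i,j$ adjacent iff $|i-j|=1$). If $R_n\ll n$, then the MSPRT $(D_n,T_n)$ is asymptotically optimal up to a constant factor depending on $Q_0$ and $Q_1$, i.e. there is a finite constant $K=K(Q_0,Q_1)$ with $\max_{v\in V_n}\mathbb E_v[T_n]\lesssim_{n,\alpha}K\,T^*(V_n,R_n,\alpha)$. Moreover, with $C(Q_0,Q_1)$ the constant described in the context: (i) if $R_n\ll\sqrt{\log n}$, then $$\frac{\log n}{2R_n\widetilde D(Q_0,Q_1)}\ \lesssim_{n,\alpha}\ T^*(V_n,R_n,\alpha)\ \lesssim_{n,\alpha}\ \frac{\log n}{R_n\,C(Q_0,Q_1)};$$ (ii) if $R_n\gg\sqrt{\log n}$ and $\log R_n\ll\log n$, then $$\sqrt{\frac{\log n}{\widetilde D(Q_0,Q_1)}}\ \lesssim_{n,\alpha}\ T^*(V_n,R_n,\alpha)\ \lesssim_{n,\alpha}\ \sqrt{\frac{\log n}{C(Q_0,Q_1)}}.$$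
   Context: Graph. The following is set up for a connected, locally finite graph $G$ with infinite vertex set $V$ and shortest-path distance $d(\cdot,\cdot)$, and is applied to the infinite line graph. For $v\in V$ and an integer $t\ge 0$, $\mathcal N_v(t)=\{w\in V: d(v,w)\le t\}$. Standing assumption (satisfied by the line graph): for all distinct $u,v\in V$ and all $t\ge0$, $\mathcal N_v(t)\setminus\mathcal N_u(t)$ is nonempty and $|\mathcal N_v(t)\setminus\mathcal N_u(t)|=|\mathcal N_u(t)\setminus\mathcal N_v(t)|$. A vertex $v_0$ is fixed, and for each $n$, $V_n\subset V$ is a set of $n$ vertices that is a neighborhood of $v_0$, i.e. $V_n$ consists of $n$ vertices closest to $v_0$ (ties broken arbitrarily). Observations. $Q_0,Q_1$ are two distinct mutually absolutely continuous probability measures on $\mathbb R$. Under $\mathbb P_v$ (the law when $v$ is the cascade source, with expectation $\mathbb E_v$), the public states $\{y_u(t)\}_{u\in V,\,t\ge 0}$ (with $t$ integer) are independent, with $y_u(t)\sim Q_1$ if $u\in\mathcal N_v(t)$ and $y_u(t)\sim Q_0$ if $u\notin\mathcal N_v(t)$. Write $y(t)=\{y_u(t)\}_{u\in V}$. Sequential estimators. A sequential estimator is a pair $(D,T)$ where $T$ is a stopping time with respect to the filtration generated by $y(0),y(1),\dots$ and $D=\{D(t)\}_{t\ge0}$ is a sequence of estimators with $D(t)\in V_n$ depending only on $y(0),\dots,y(t)$. Its output is $D(T)$. For a positive integer $R$ (confidence radius) and $\alpha\in(0,1)$, $$\Delta_G(V_n,R,\alpha)=\Big\{(D,T):\ \max_{u,v\in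 V_n:\ d(u,v)>R}\mathbb P_v(D(T)=u)\le \alpha/n\Big\}.$$ $(R_n)$ is a sequence of positive integers, and $$T^*(V_n,R_n,\alpha)=\min_{(D,T)\in\Delta_G(V_n,R_n,\alpha)}\ \max_{v\in V_n}\mathbb E_v[T]$$ (read as an infimum if not attained). Log-likelihood ratios. For $u,v\in V$ and integer $t\ge0$, $$Z_{vu}(t)=\sum_{s=0}^t\Big(\sum_{w\in\mathcal N_v(s)\setminus\mathcal N_u(s)}\log\frac{dQ_1}{dQ_0}(y_w(s))+\sum_{w\in\mathcal N_u(s)\setminus\mathcal N_v(s)}\log\frac{dQ_0}{dQ_1}(y_w(s))\Big).$$ MSPRT (matrix sequential probability ratio test). For $v\in V_n$ let $T_v=\min\{t\ge0:\ \min_{u\in V_n\setminus\mathcal N_v(R_n)}Z_{vu}(t)\ge\log(n/\alpha)\}$. The MSPRT is the pair $(D_n,T_n)$ with $T_n=\min_{v\in V_n}T_v$ and $D_n(t)=\arg\max_{v\in V_n}\min_{u\in V_n\setminus\mathcal N_v(R_n)}Z_{vu}(t)$, so that $D_n(T_n)=\arg\min_{v\in V_n}T_v$. Constants. $\widetilde D(Q_0,Q_1)=\int\log\frac{dQ_1}{dQ_0}\,dQ_1+\int\log\frac{dQ_0}{dQ_1}\,dQ_0$ is the symmetrized Kullback–Leibler divergence. For distinct $u,v\in V$, $f_{vu}(t)=\sum_{s=0}^t|\mathcal N_v(s)\setminus\mathcal N_u(s)|$ and $F_{vu}(z)=\min\{t\in\mathbb Z_{\ge0}:f_{vu}(t)\ge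 z\}$ is its inverse. $C(Q_0,Q_1)\in(0,\widetilde D(Q_0,Q_1))$ is a constant, depending only on $Q_0,Q_1$, such that for every fixed $\alpha\in(0,1)$ and every $v\in V_n$, $\mathbb E_v[T_n]\le\max_{u\in V_n:\,d(u,v)>R_n}F_{vu}\big(\log n/C(Q_0,Q_1)\big)(1+o_n(1))$, with $o_n(1)\to0$ as $n\to\infty$ (such a constant exists). Asymptotics. $a_n\ll b_n$ (equivalently $b_n\gg a_n$) means $a_n/b_n\to0$ as $n\to\infty$. $g\gtrsim_{n,\alpha}h$ means $\liminf_{\alpha\to0}\liminf_{n\to\infty}g(n,\alpha)/h(n,\alpha)\ge1$; $g\lesssim_{n,\alpha}h$ means $\limsup_{\alpha\to0}\limsup_{n\to\infty}g(n,\alpha)/h(n,\alpha)\le1$. *)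

theory Defs
  imports "HOL-Probability.Probability"
begin

section \<open>Graphs\<close>

text \<open>
  A graph is given by its (symmetric) adjacency relation; all vertices of the type belong to it.
  The distance is meaningful for connected graphs only.
\<close>

definition gdist :: "('v \<Rightarrow> 'v \<Rightarrow> bool) \<Rightarrow> 'v \<Rightarrow> 'v \<Rightarrow> nat" where
  "gdist G u v = (LEAST k. (G ^^ k) u v)"

definition nbhd :: "('v \<Rightarrow> 'v \<Rightarrow> bool) \<Rightarrow> 'v \<Rightarrow> nat \<Rightarrow> 'v set" where
  "nbhd G v t = {w. gdist G v w \<le> t}"

definition line_graph :: "int \<Rightarrow> int \<Rightarrow> bool" where
  "line_graph i j \<longleftrightarrow> \<bar>i - j\<bar> = 1"

lemma line_graph_relpowp_imp: "(line_graph ^^ k) u v \<Longrightarrow> \<bar>u - v\<bar> \<le> int k"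
proof (induction k arbitrary: v)
  case (Suc k)
  then obtain w where w: "(line_graph ^^ k) u w" "line_graph w v" by auto
  have "\<bar>u - w\<bar> \<le> int k" using w(1) by (rule Suc.IH)
  moreover have "\<bar>w - v\<bar> = 1" using w(2) by (simp add: line_graph_def)
  ultimately show ?case by simp
qed simp

lemma line_graph_relpowp_ex: "(line_graph ^^ nat \<bar>u - v\<bar>) u v"
proof -
  have up: "(line_graph ^^ k) u (u + int k)" for k
  proof (induction k)
    case (Suc k)
    have "line_graph (u + int k) (u + int (Suc k))" by (simp add: line_graph_def)
    with Suc show ?case by auto
  qed simp
  have down: "(line_graph ^^ k) u (u - int k)" for k
  proof (induction k)
    case (Suc k)
    have "line_graph (u - int k) (u - int (Suc k))" by (simp add: line_graph_def)
    with Suc show ?case by auto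
  qed simp
  show ?thesis
    using up[of "nat (v - u)"] down[of "nat (u - v)"] by (cases "u \<le> v") auto
qed

lemma gdist_line_graph: "gdist line_graph u v = nat \<bar>u - v\<bar>"
  unfolding gdist_def
  by (rule Least_equality) (use line_graph_relpowp_ex line_graph_relpowp_imp in fastforce)+

definition closest_vertices :: "('v \<Rightarrow> 'v \<Rightarrow> bool) \<Rightarrow> 'v \<Rightarrow> nat \<Rightarrow> 'v set \<Rightarrow> bool" where
  "closest_vertices G v0 n S \<longleftrightarrow>
     finite S \<and> card S = n \<and> (\<forall>u\<in>S. \<forall>w. w \<notin> S \<longrightarrow> gdist G v0 u \<le> gdist G v0 w)"

definition source_setup ::
    "('v \<Rightarrow> 'v \<Rightarrow> bool) \<Rightarrow> 'v \<Rightarrow> (nat \<Rightarrow> 'v set) \<Rightarrow> (nat \<Rightarrow> nat) \<Rightarrow> bool" where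
  "source_setup G v0 V R \<longleftrightarrow> (\<forall>n. closest_vertices G v0 n (V n)) \<and> (\<forall>n. 0 < R n)"


section \<open>Observations and sequential estimators\<close>

text \<open>
  A sample point \<open>y\<close> assigns to \<open>(t, u)\<close> the public state of vertex \<open>u\<close> at time \<open>t\<close>.
\<close>

type_synonym 'v obs = "nat \<times> 'v \<Rightarrow> real"

definition source_law ::
    "('v \<Rightarrow> 'v \<Rightarrow> bool) \<Rightarrow> real measure \<Rightarrow> real measure \<Rightarrow> 'v \<Rightarrow> 'v obs measure" where
  "source_law G Q0 Q1 v = (\<Pi>\<^sub>M (t, u)\<in>UNIV. if u \<in> nbhd G v t then Q1 else Q0)"

text \<open>
  The filtration is indexed by \<open>enat\<close> because stopping times may take the value \<open>\<infinity>\<close>, and the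
  library's stopping times take values in the index type of the filtration.
\<close>

definition obs_filtration :: "enat \<Rightarrow> 'v obs measure" where
  "obs_filtration t =
     sigma UNIV {(\<lambda>y. y (s, w)) -` B | s w B. enat s \<le> t \<and> B \<in> sets borel}"

type_synonym 'v seq_est = "(nat \<Rightarrow> 'v obs \<Rightarrow> 'v) \<times> ('v obs \<Rightarrow> enat)"

definition seq_estimator :: "'v set \<Rightarrow> 'v seq_est \<Rightarrow> bool" where
  "seq_estimator V = (\<lambda>(D, T). stopping_time obs_filtration T \<and>
     (\<forall>t. D t \<in> measurable (obs_filtration (enat t)) (count_space V)))"

definition output_event :: "'v seq_est \<Rightarrow> 'v \<Rightarrow> 'v obs set" where
  "output_event = (\<lambda>(D, T) u. {y. T y \<noteq> \<infinity> \<and> D (the_enat (T y)) y = u})"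

definition Delta_class ::
    "('v \<Rightarrow> 'v \<Rightarrow> bool) \<Rightarrow> real measure \<Rightarrow> real measure \<Rightarrow> 'v set \<Rightarrow> nat \<Rightarrow> real \<Rightarrow> 'v seq_est set" where
  "Delta_class G Q0 Q1 V R \<alpha> = {p. seq_estimator V p \<and>
     (\<forall>u\<in>V. \<forall>v\<in>V. gdist G u v > R \<longrightarrow>
        measure (source_law G Q0 Q1 v) (output_event p u) \<le> \<alpha> / real (card V))}"

definition worst_delay ::
    "('v \<Rightarrow> 'v \<Rightarrow> bool) \<Rightarrow> real measure \<Rightarrow> real measure \<Rightarrow> 'v set \<Rightarrow> 'v seq_est \<Rightarrow> ennreal" where
  "worst_delay G Q0 Q1 V = (\<lambda>(D, T).
     (SUP v\<in>V. \<integral>\<^sup>+ y. ennreal_of_enat (T y) \<partial>source_law G Q0 Q1 v))"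

definition T_star ::
    "('v \<Rightarrow> 'v \<Rightarrow> bool) \<Rightarrow> real measure \<Rightarrow> real measure \<Rightarrow> 'v set \<Rightarrow> nat \<Rightarrow> real \<Rightarrow> ennreal" where
  "T_star G Q0 Q1 V R \<alpha> = (INF p\<in>Delta_class G Q0 Q1 V R \<alpha>. worst_delay G Q0 Q1 V p)"


section \<open>Log-likelihood ratios and the MSPRT\<close>

text \<open>\<open>log_lr P Q\<close> is \<open>log (dQ/dP)\<close> with the natural logarithm; mind the order of arguments.\<close>

abbreviation log_lr :: "real measure \<Rightarrow> real measure \<Rightarrow> real \<Rightarrow> real" where
  "log_lr P Q \<equiv> entropy_density (exp 1) P Q"

text \<open>
  Under absolute continuity the negative part of \<open>log (dQ/dP)\<close> is always \<open>Q\<close>-integrable, so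
  the only way a Kullback-Leibler divergence can fail to be given by a Bochner integral is by being
  infinite.  \<open>KL_divergence b P Q\<close> integrates \<open>log (dQ/dP)\<close> against \<open>Q\<close>.
\<close>

definition sym_KL :: "real measure \<Rightarrow> real measure \<Rightarrow> ennreal" where
  "sym_KL Q0 Q1 =
     (if integrable Q1 (log_lr Q0 Q1) \<and> integrable Q0 (log_lr Q1 Q0)
      then ennreal (KL_divergence (exp 1) Q0 Q1 + KL_divergence (exp 1) Q1 Q0)
      else \<infinity>)"

definition Z_stat ::
    "('v \<Rightarrow> 'v \<Rightarrow> bool) \<Rightarrow> real measure \<Rightarrow> real measure \<Rightarrow> 'v \<Rightarrow> 'v \<Rightarrow> nat \<Rightarrow> 'v obs \<Rightarrow> real" where
  "Z_stat G Q0 Q1 v u t y =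
     (\<Sum>s\<le>t. (\<Sum>w\<in>nbhd G v s - nbhd G u s. log_lr Q0 Q1 (y (s, w))) +
             (\<Sum>w\<in>nbhd G u s - nbhd G v s. log_lr Q1 Q0 (y (s, w))))"

text \<open>Taken in \<open>ereal\<close> so that the minimum over an empty set of competitors is \<open>\<infinity>\<close>.\<close>

definition msprt_score ::
    "('v \<Rightarrow> 'v \<Rightarrow> bool) \<Rightarrow> real measure \<Rightarrow> real measure \<Rightarrow> 'v set \<Rightarrow> nat \<Rightarrow> 'v \<Rightarrow> nat \<Rightarrow> 'v obs \<Rightarrow> ereal" where
  "msprt_score G Q0 Q1 V R v t y = (INF u\<in>V - nbhd G v R. ereal (Z_stat G Q0 Q1 v u t y))"

definition msprt_vertex_time ::
    "('v \<Rightarrow> 'v \<Rightarrow> bool) \<Rightarrow> real measure \<Rightarrow> real measure \<Rightarrow> 'v set \<Rightarrow> nat \<Rightarrow> real \<Rightarrow> 'v \<Rightarrow> 'v obs \<Rightarrow> enat" where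
  "msprt_vertex_time G Q0 Q1 V R \<alpha> v y =
     (INF t\<in>{t. msprt_score G Q0 Q1 V R v t y \<ge> ereal (ln (real (card V) / \<alpha>))}. enat t)"

definition msprt ::
    "('v \<Rightarrow> 'v \<Rightarrow> bool) \<Rightarrow> real measure \<Rightarrow> real measure \<Rightarrow> 'v set \<Rightarrow> nat \<Rightarrow> real \<Rightarrow> 'v seq_est" where
  "msprt G Q0 Q1 V R \<alpha> =
     ((\<lambda>t y. arg_max (\<lambda>v. msprt_score G Q0 Q1 V R v t y) (\<lambda>v. v \<in> V)),
      (\<lambda>y. INF v\<in>V. msprt_vertex_time G Q0 Q1 V R \<alpha> v y))"


section \<open>Constants and asymptotic comparison\<close>

definition f_nbhd :: "('v \<Rightarrow> 'v \<Rightarrow> bool) \<Rightarrow> 'v \<Rightarrow> 'v \<Rightarrow> nat \<Rightarrow> nat" where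
  "f_nbhd G v u t = (\<Sum>s\<le>t. card (nbhd G v s - nbhd G u s))"

definition F_nbhd :: "('v \<Rightarrow> 'v \<Rightarrow> bool) \<Rightarrow> 'v \<Rightarrow> 'v \<Rightarrow> real \<Rightarrow> nat" where
  "F_nbhd G v u z = (LEAST t. z \<le> real (f_nbhd G v u t))"

text \<open>
  The error term may depend on the vertex sets, the radii and \<open>\<alpha>\<close>, but is uniform in the source.
\<close>

definition msprt_constant ::
    "('v \<Rightarrow> 'v \<Rightarrow> bool) \<Rightarrow> real measure \<Rightarrow> real measure \<Rightarrow> real \<Rightarrow> bool" where
  "msprt_constant G Q0 Q1 C \<longleftrightarrow> 0 < C \<and> ennreal C < sym_KL Q0 Q1 \<and>
     (\<forall>v0 V R \<alpha>. source_setup G v0 V R \<longrightarrow> 0 < \<alpha> \<longrightarrow> \<alpha> < 1 \<longrightarrow>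
        (\<exists>\<epsilon>. \<epsilon> \<longlonglongrightarrow> (0::real) \<and>
          (\<forall>\<^sub>F n in sequentially. \<forall>v\<in>V n.
             (\<integral>\<^sup>+ y. ennreal_of_enat (snd (msprt G Q0 Q1 (V n) (R n) \<alpha>) y) \<partial>source_law G Q0 Q1 v)
             \<le> (SUP u\<in>{u\<in>V n. gdist G u v > R n}. of_nat (F_nbhd G v u (ln (real n) / C)))
                * ennreal (1 + \<epsilon> n))))"

definition lesssim :: "(nat \<Rightarrow> real \<Rightarrow> ennreal) \<Rightarrow> (nat \<Rightarrow> real \<Rightarrow> ennreal) \<Rightarrow> bool" where
  "lesssim g h \<longleftrightarrow> Limsup (at_right 0) (\<lambda>\<alpha>. limsup (\<lambda>n. g n \<alpha> / h n \<alpha>)) \<le> 1"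

end

theory Submission
  imports Defs
begin


text \<open>
  The quantity that decides everything is the log-likelihood ratio \<open>LLR A K\<close> of a finite set \<open>K\<close> of
  space-time coordinates, when the coordinates in \<open>A\<close> carry \<open>Q1\<close> and the others \<open>Q0\<close>. Exchanging the
  two laws on \<open>K\<close> gives a measure with density \<open>exp (- LLR A K)\<close> (\<open>density_law\<close>), and up to time \<open>t\<close>
  the laws of two sources differ by such an exchange on a finite set, so all comparisons
  between sources are exact changes of measure.

  Lower bounds on the optimal delay. An estimator that stops by time \<open>t\<close> with the right answer
  decides an event of the first \<open>t\<close> steps, and there are two reasons why such an event has small
  probability. First, a decision \<open>w\<close> close to the source \<open>v\<close> is an error for one of the sources
  \<open>v - R - 1\<close> and \<open>v + R + 1\<close>, whichever lies on the other side of \<open>v\<close>; so the log-likelihood ratio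
  of \<open>v\<close> against a vertex at distance exactly \<open>R + 1\<close> must get as large as about \<open>ln (n / R)\<close>
  (\<open>T_star_ge_near\<close>). Second, with no source at all one half of the line is decided with
  probability at most \<open>1 / 2\<close>, while a source that is placed at random among about \<open>sqrt n\<close>
  well separated vertices of that half is invisible as long as the log-likelihood ratio of its
  light cone stays below \<open>ln n / 4\<close>: the likelihood ratio of the mixture is an average of many
  independent terms, and is close to a constant (\<open>T_star_ge_far\<close>). If the symmetrised
  divergence is finite, the weak law of large numbers turns the first bound into the explicit
  lower bounds of (i) and (ii). The upper bounds there follow from the hypothesis on \<open>C\<close>
  because the MSPRT satisfies the error constraints (\<open>msprt_in_Delta_class\<close>), and because \<open>F\<close> is
  largest at the smallest admissible distance \<open>R + 1\<close>.

  Optimality of the MSPRT up to a constant. The divergence may be infinite here, and then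
  delays may be of smaller order than \<open>ln n / R\<close> or \<open>sqrt (ln n)\<close>, and no formula in terms of
  moments is available. Instead the time scale is defined by the walks themselves: \<open>t0\<close> is the first time
  at which the log-likelihood ratio of the light cone exceeds \<open>ln n / 4\<close> with probability at
  least \<open>1 / 3\<close> and the one against distance \<open>R + 1\<close> exceeds \<open>ln n / 8\<close> with probability at least
  \<open>1 / 4\<close>. At time \<open>t0 - 1\<close> one of the two requirements fails, so the optimal delay is at least
  \<open>t0 / 10\<close>. Conversely the observations contain, in every window of \<open>120 (t0 + 1)\<close> steps,
  \<open>40\<close> independent copies of the first walk and \<open>40\<close> of the second one for each side of the
  source. With a probability that is bounded below all of these copies are large at once; then
  every competitor is beaten by \<open>5 ln n\<close> on coordinates that are chosen in advance, and the
  remaining coordinates cost more than \<open>3 ln n\<close> only with negligible probability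
  (\<open>prob_LLR_less_neg\<close>). Hence the number of windows that the MSPRT needs has a geometric tail
  (\<open>msprt_window_tail\<close>). The far tail of the delay is controlled by the Hellinger affinity of
  \<open>Q0\<close> and \<open>Q1\<close> (\<open>msprt_tail\<close>).
\<close>

section \<open>Product laws and events of a set of coordinates\<close>

definition coord_events :: "'i set \<Rightarrow> ('i \<Rightarrow> real) set set" where
  "coord_events K = sigma_sets UNIV {(\<lambda>y. y i) -` B | i B. i \<in> K \<and> B \<in> sets borel}"

lemma coord_events_mono: "K \<subseteq> L \<Longrightarrow> coord_events K \<subseteq> coord_events L"
  unfolding coord_events_def by (rule sigma_sets_mono') blast

text \<open>The events of a set of coordinates are needed both as a family of sets, for independence and
  stopping times, and as a measurable space, for measurability of functions.\<close>

definition coord_algebra :: "'i set \<Rightarrow> ('i \<Rightarrow> real) measure" where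
  "coord_algebra K = sigma UNIV {(\<lambda>y. y i) -` B | i B. i \<in> K \<and> B \<in> sets borel}"

lemma space_coord_algebra [simp]: "space (coord_algebra K) = UNIV"
  by (simp add: coord_algebra_def space_measure_of_conv)

lemma sets_coord_algebra: "sets (coord_algebra K) = coord_events K"
  by (simp add: coord_algebra_def coord_events_def)

lemma sigma_algebra_coord_events: "sigma_algebra UNIV (coord_events K)"
  unfolding coord_events_def by (rule sigma_algebra_sigma_sets) auto

lemma measurable_coord_algebra:
  "i \<in> K \<Longrightarrow> (\<lambda>y. y i) \<in> borel_measurable (coord_algebra K)"
  by (rule measurableI) (simp_all add: sets_coord_algebra coord_events_def, rule sigma_sets.Basic, blast)

text \<open>An event of the coordinates in \<open>K\<close> does not see the other ones.\<close>

lemma coord_events_restrict: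
  assumes "E \<in> coord_events K" "\<And>i. i \<in> K \<Longrightarrow> y i = z i"
  shows "y \<in> E \<longleftrightarrow> z \<in> E"
  using assms(1) unfolding coord_events_def
proof induction
  case (Basic a)
  then show ?case using assms(2) by auto
next
  case Empty
  show ?case by simp
next
  case (Compl a)
  then show ?case by simp
next
  case (Union a)
  then show ?case by simp
qed

text \<open>Coordinates are indexed by an arbitrary type; only the geometry of the line uses pairs of a
  time and a vertex.\<close>

locale mutual_ac_laws =
  fixes Q0 Q1 :: "real measure"
  assumes prob0: "prob_space Q0" and prob1: "prob_space Q1"
    and sets0 [simp]: "sets Q0 = sets borel"
    and sets1 [simp]: "sets Q1 = sets borel"
    and ac01: "absolutely_continuous Q0 Q1" and ac10: "absolutely_continuous Q1 Q0"
    and distinct: "Q0 \<noteq> Q1"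
begin

definition marginal :: "'i set \<Rightarrow> 'i \<Rightarrow> real measure" where
  "marginal A i = (if i \<in> A then Q1 else Q0)"

definition law :: "'i set \<Rightarrow> ('i \<Rightarrow> real) measure" where
  "law A = Pi\<^sub>M UNIV (marginal A)"

lemma space_Q [simp]: "space Q0 = UNIV" "space Q1 = UNIV"
  using sets_eq_imp_space_eq[OF sets0] sets_eq_imp_space_eq[OF sets1] by auto

lemma sets_marginal [simp]: "sets (marginal A i) = sets borel"
  by (simp add: marginal_def)

lemma space_marginal [simp]: "space (marginal A i) = UNIV"
  by (simp add: marginal_def)

lemma prob_space_marginal: "prob_space (marginal A i)"
  by (simp add: marginal_def prob0 prob1)

lemma product_prob_space_marginal: "product_prob_space (marginal A)"
  by (intro product_prob_space.intro product_prob_space_axioms.intro product_sigma_finite.intro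
      prob_space_imp_sigma_finite prob_space_marginal)

lemma prob_space_law: "prob_space (law A)"
  unfolding law_def by (rule prob_space_PiM) (rule prob_space_marginal)

lemma sets_law: "sets (law A) = sets (Pi\<^sub>M UNIV (\<lambda>_. borel))"
  unfolding law_def by (rule sets_PiM_cong) auto

lemma space_law [simp]: "space (law A) = UNIV"
  by (simp add: law_def space_PiM PiE_def)

lemma measurable_law_coord [simp]: "(\<lambda>y. y i) \<in> borel_measurable (law A)"
proof -
  have "(\<lambda>y. y i) \<in> measurable (law A) (marginal A i)"
    unfolding law_def by (rule measurable_component_singleton) (rule UNIV_I)
  thus ?thesis by (subst (asm) measurable_cong_sets[OF refl sets_marginal])
qed

lemma coord_events_subset_law: "coord_events K \<subseteq> sets (law A)"
proof -
  have "{(\<lambda>y. y i) -` B | i B. i \<in> K \<and> B \<in> sets borel} \<subseteq> sets (law A)"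
  proof safe
    fix i and B :: "real set" assume "B \<in> sets borel"
    from measurable_sets[OF measurable_law_coord[of i A] this]
    show "(\<lambda>y. y i) -` B \<in> sets (law A)" by simp
  qed
  from sets.sigma_sets_subset[OF this] show ?thesis by (simp add: coord_events_def)
qed

lemma measurable_coord_algebra_law:
  "f \<in> measurable (coord_algebra K) N \<Longrightarrow> f \<in> measurable (law A) N"
  by (rule measurable_mono[THEN subsetD, OF order_refl refl _ _])
     (simp_all add: coord_events_subset_law sets_coord_algebra)

lemma distr_law_coord: "distr (law A) borel (\<lambda>y. y i) = marginal A i"
proof -
  interpret product_prob_space "marginal A" UNIV by (rule product_prob_space_marginal)
  have "distr (law A) (marginal A i) (\<lambda>y. y i) = marginal A i"
    unfolding law_def by (rule PiM_component) simp
  moreover have "distr (law A) borel (\<lambda>y. y i) = distr (law A) (marginal A i) (\<lambda>y. y i)"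
    by (rule distr_cong) simp_all
  ultimately show ?thesis by simp
qed

lemma AE_law_coord: "AE x in marginal A i. P x \<Longrightarrow> AE y in law A. P (y i)"
proof -
  interpret product_prob_space "marginal A" UNIV by (rule product_prob_space_marginal)
  show "AE x in marginal A i. P x \<Longrightarrow> AE y in law A. P (y i)"
    unfolding law_def by (rule AE_component) simp_all
qed

lemma indep_coords: "prob_space.indep_vars (law A) (\<lambda>_. borel) (\<lambda>i y. y i) UNIV"
proof -
  interpret prob_space "law A" by (rule prob_space_law)
  have "distr (law A) (Pi\<^sub>M UNIV (\<lambda>_. borel)) (\<lambda>y. \<lambda>i\<in>UNIV. y i) = law A"
    by (subst distr_cong[of "law A" "law A" _ "law A" _ "\<lambda>y. y"])
       (auto simp: sets_law distr_id)
  moreover have "(\<lambda>i. distr (law A) borel (\<lambda>y. y i)) = marginal A"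
    by (rule ext) (rule distr_law_coord)
  ultimately have "distr (law A) (Pi\<^sub>M UNIV (\<lambda>_. borel)) (\<lambda>y. \<lambda>i\<in>UNIV. y i)
      = Pi\<^sub>M UNIV (\<lambda>i. distr (law A) borel (\<lambda>y. y i))"
    by (simp only: law_def)
  thus ?thesis
    by (intro indep_vars_iff_distr_eq_PiM[THEN iffD2] UNIV_not_empty measurable_law_coord)
qed

lemma prob_indep:
  assumes "E \<in> coord_events K" "F \<in> coord_events L" "K \<inter> L = {}"
  shows "measure (law A) (E \<inter> F) = measure (law A) E * measure (law A) F"
proof -
  interpret prob_space "law A" by (rule prob_space_law)
  let ?E = "\<lambda>i. {(\<lambda>y::'a\<Rightarrow>real. y i) -` B \<inter> space (law A) | B. B \<in> sets borel}"
  let ?I = "case_bool K L"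
  have *: "indep_sets ?E (UNIV :: 'a set)"
    using indep_coords[of A] unfolding indep_vars_def2 by (rule conjunct2)
  have "indep_sets (\<lambda>j. sigma_sets (space (law A)) (\<Union>i\<in>?I j. ?E i)) (UNIV::bool set)"
  proof (rule indep_sets_collect_sigma)
    show "indep_sets ?E (\<Union>j\<in>UNIV. ?I j)" by (rule indep_sets_mono_index[OF _ *]) auto
    show "Int_stable (?E i)" for i
    proof (rule Int_stableI)
      fix a b assume "a \<in> ?E i" "b \<in> ?E i"
      then obtain B C where "a = (\<lambda>y. y i) -` B" "b = (\<lambda>y. y i) -` C" "B \<in> sets borel" "C \<in> sets borel"
        by auto
      thus "a \<inter> b \<in> ?E i" by (auto intro!: exI[of _ "B \<inter> C"])
    qed
    show "disjoint_family_on ?I UNIV"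
      using assms(3) by (auto simp: disjoint_family_on_def UNIV_bool)
  qed
  moreover have "(\<lambda>j. sigma_sets (space (law A)) (\<Union>i\<in>?I j. ?E i)) = (\<lambda>j. coord_events (?I j))"
  proof
    fix j
    have "(\<Union>i\<in>?I j. ?E i) = {(\<lambda>y. y i) -` B | i B. i \<in> ?I j \<and> B \<in> sets borel}" by auto
    thus "sigma_sets (space (law A)) (\<Union>i\<in>?I j. ?E i) = coord_events (?I j)"
      by (simp add: coord_events_def)
  qed
  ultimately have "indep_sets (\<lambda>j. coord_events (?I j)) (UNIV::bool set)" by simp
  moreover have "(\<lambda>j. coord_events (?I j)) = case_bool (coord_events K) (coord_events L)"
    by (rule ext) (simp split: bool.split)
  ultimately have "indep_set (coord_events K) (coord_events L)"
    by (simp add: indep_set_def)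
  thus ?thesis using assms by (simp add: indep_sets2_eq)
qed

text \<open>Marginals of the product law may be relabelled by any injection that respects the kind of the
  coordinates. This yields both \<open>prob_agree\<close> and the invariance of the law of log-likelihood
  ratios under relabelling.\<close>

lemma distr_law_restrict:
  assumes "inj_on f K" "\<And>i. i \<in> K \<Longrightarrow> f i \<in> A \<longleftrightarrow> i \<in> B"
  shows "distr (law A) (Pi\<^sub>M K (\<lambda>_. borel)) (\<lambda>y. \<lambda>i\<in>K. y (f i)) = Pi\<^sub>M K (marginal B)"
proof -
  have "distr (Pi\<^sub>M UNIV (marginal A)) (\<Pi>\<^sub>M i\<in>K. marginal A (f i)) (\<lambda>y. \<lambda>i\<in>K. y (f i))
      = (\<Pi>\<^sub>M i\<in>K. marginal A (f i))"
    by (rule distr_PiM_reindex) (use assms in \<open>auto simp: prob_space_marginal\<close>)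
  moreover have "(\<Pi>\<^sub>M i\<in>K. marginal A (f i)) = Pi\<^sub>M K (marginal B)"
    by (rule PiM_cong) (use assms in \<open>auto simp: marginal_def\<close>)
  moreover have "distr (law A) (Pi\<^sub>M K (\<lambda>_. borel)) (\<lambda>y. \<lambda>i\<in>K. y (f i))
      = distr (law A) (Pi\<^sub>M K (marginal B)) (\<lambda>y. \<lambda>i\<in>K. y (f i))"
    by (rule distr_cong) (auto intro!: sets_PiM_cong)
  ultimately show ?thesis by (simp add: law_def)
qed

lemma prob_eq_reindex:
  fixes f :: "'i \<Rightarrow> 'i"
  assumes f: "inj_on f K" "\<And>i. i \<in> K \<Longrightarrow> f i \<in> A \<longleftrightarrow> i \<in> B"
    and P: "Measurable.pred (Pi\<^sub>M K (\<lambda>_. borel)) P"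
  shows "measure (law A) {y. P (\<lambda>i\<in>K. y (f i))} = measure (law B) {y. P (\<lambda>i\<in>K. y i)}"
proof -
  have *: "measure (law C) {y. P (\<lambda>i\<in>K. y (g i))} = measure (Pi\<^sub>M K (marginal B)) {z\<in>space (Pi\<^sub>M K (\<lambda>_. borel)). P z}"
    if "inj_on g K" "\<And>i. i \<in> K \<Longrightarrow> g i \<in> C \<longleftrightarrow> i \<in> B" for C and g :: "'i \<Rightarrow> 'i"
  proof -
    have [measurable]: "(\<lambda>y. \<lambda>i\<in>K. y (g i)) \<in> measurable (law C) (Pi\<^sub>M K (\<lambda>_. borel))"
      by (rule measurable_restrict) (rule measurable_law_coord)
    have "measure (Pi\<^sub>M K (marginal B)) {z\<in>space (Pi\<^sub>M K (\<lambda>_. borel)). P z}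
        = measure (distr (law C) (Pi\<^sub>M K (\<lambda>_. borel)) (\<lambda>y. \<lambda>i\<in>K. y (g i))) {z\<in>space (Pi\<^sub>M K (\<lambda>_. borel)). P z}"
      by (simp only: distr_law_restrict[OF that])
    also have "\<dots> = measure (law C) ((\<lambda>y. \<lambda>i\<in>K. y (g i)) -` {z\<in>space (Pi\<^sub>M K (\<lambda>_. borel)). P z} \<inter> space (law C))"
      by (rule measure_distr) (use P in \<open>auto simp: pred_def\<close>)
    also have "(\<lambda>y. \<lambda>i\<in>K. y (g i)) -` {z\<in>space (Pi\<^sub>M K (\<lambda>_. borel)). P z} \<inter> space (law C)
      = {y. P (\<lambda>i\<in>K. y (g i))}" by (auto simp: space_PiM)
    finally show ?thesis by simp
  qed
  show ?thesis using *[OF f] *[of "\<lambda>i. i" B] by simp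
qed

text \<open>Two assignments of laws that agree on \<open>K\<close> cannot be told apart by the coordinates in \<open>K\<close>. In
  this way infinitely many coordinates at times after \<open>t\<close> are disregarded, which makes a change of
  measure on a finite set possible.\<close>

lemma prob_agree:
  assumes "E \<in> coord_events K" "A \<inter> K = B \<inter> K"
  shows "measure (law A) E = measure (law B) E"
proof -
  define ext where "ext = (\<lambda>z i. if i \<in> K then z i else (0::real))"
  have "ext \<in> measurable (Pi\<^sub>M K (\<lambda>_. borel)) (coord_algebra K)"
    unfolding coord_algebra_def
  proof (rule measurable_measure_of)
    fix X assume "X \<in> {(\<lambda>y::'a \<Rightarrow> real. y i) -` B | i B. i \<in> K \<and> B \<in> sets borel}"
    then obtain i B where iB: "i \<in> K" "B \<in> sets borel" "X = (\<lambda>y. y i) -` B" by blast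
    have "(\<lambda>z. z i) -` B \<inter> space (Pi\<^sub>M K (\<lambda>_. borel)) \<in> sets (Pi\<^sub>M K (\<lambda>_. borel :: real measure))"
      by (rule measurable_sets[OF measurable_component_singleton]) (use iB in auto)
    moreover have "ext -` X = (\<lambda>z. z i) -` B" using iB by (auto simp: ext_def)
    ultimately show "ext -` X \<inter> space (Pi\<^sub>M K (\<lambda>_. borel)) \<in> sets (Pi\<^sub>M K (\<lambda>_. borel))" by simp
  qed auto
  hence pr: "Measurable.pred (Pi\<^sub>M K (\<lambda>_. borel)) (\<lambda>z. ext z \<in> E)"
    using measurable_sets[of ext "Pi\<^sub>M K (\<lambda>_. borel)" "coord_algebra K" E] assms(1)
    by (simp add: sets_coord_algebra pred_def vimage_def Int_def conj_commute)
  have E: "{y. ext (\<lambda>i\<in>K. y i) \<in> E} = E"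
  proof -
    have "ext (\<lambda>i\<in>K. y i) \<in> E \<longleftrightarrow> y \<in> E" for y
      by (rule coord_events_restrict[OF assms(1)]) (simp add: ext_def)
    thus ?thesis by simp
  qed
  have "measure (law A) {y. ext (\<lambda>i\<in>K. y i) \<in> E} = measure (law B) {y. ext (\<lambda>i\<in>K. y i) \<in> E}"
    by (rule prob_eq_reindex[of "\<lambda>i. i" K A B "\<lambda>z. ext z \<in> E", OF _ _ pr]) (use assms(2) in auto)
  thus ?thesis unfolding E .
qed

lemma nn_integral_law_prod:
  fixes g :: "'i \<Rightarrow> real \<Rightarrow> ennreal"
  assumes "finite K" and [measurable]: "\<And>i. i \<in> K \<Longrightarrow> g i \<in> borel_measurable borel"
  shows "(\<integral>\<^sup>+y. (\<Prod>i\<in>K. g i (y i)) \<partial>law A) = (\<Prod>i\<in>K. \<integral>\<^sup>+x. g i x \<partial>marginal A i)"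
proof -
  interpret prob_space "law A" by (rule prob_space_law)
  have "(\<integral>\<^sup>+y. (\<Prod>i\<in>K. g i (y i)) \<partial>law A) = (\<Prod>i\<in>K. \<integral>\<^sup>+y. g i (y i) \<partial>law A)"
    by (rule indep_vars_nn_integral)
       (simp_all add: assms indep_vars_compose2[where X="\<lambda>i y. y i" and M'="\<lambda>_. borel"]
         indep_vars_subset[OF indep_coords])
  also have "\<dots> = (\<Prod>i\<in>K. \<integral>\<^sup>+x. g i x \<partial>marginal A i)"
    by (intro prod.cong refl, subst distr_law_coord[symmetric], subst nn_integral_distr) auto
  finally show ?thesis .
qed

end

section \<open>Log-likelihood ratios of finite sets of coordinates\<close>

context mutual_ac_laws
begin

lemma measurable_log_lr [measurable]:
  "log_lr Q0 Q1 \<in> borel_measurable borel" "log_lr Q1 Q0 \<in> borel_measurable borel"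
  using measurable_entropy_density[of "exp 1" Q0 Q1] measurable_entropy_density[of "exp 1" Q1 Q0]
  by (auto simp: measurable_cong_sets[OF sets0 refl] measurable_cong_sets[OF sets1 refl])

lemma measurable_log_lr_Q [measurable]:
  "log_lr Q0 Q1 \<in> borel_measurable Q0" "log_lr Q1 Q0 \<in> borel_measurable Q0"
  "log_lr Q0 Q1 \<in> borel_measurable Q1" "log_lr Q1 Q0 \<in> borel_measurable Q1"
  using measurable_log_lr
  by (auto simp: measurable_cong_sets[OF sets0 refl] measurable_cong_sets[OF sets1 refl])

text \<open>Mutual absolute continuity makes the derivative finite and positive almost everywhere, so that
  the logarithm loses no information.\<close>

lemma AE_RN_deriv: "AE x in Q0. RN_deriv Q0 Q1 x = ennreal (exp (log_lr Q0 Q1 x))"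
proof -
  interpret Q0: prob_space Q0 by (rule prob0)
  interpret Q1: prob_space Q1 by (rule prob1)
  have d: "density Q0 (RN_deriv Q0 Q1) = Q1"
    by (rule Q0.density_RN_deriv) (simp_all add: ac01)
  have fin: "AE x in Q0. RN_deriv Q0 Q1 x \<noteq> \<infinity>"
    by (rule Q0.RN_deriv_finite) (simp_all add: ac01 Q1.sigma_finite_measure_axioms)
  have "AE x in density Q0 (RN_deriv Q0 Q1). RN_deriv Q0 Q1 x \<noteq> 0"
    by (subst AE_density) auto
  hence "AE x in Q1. RN_deriv Q0 Q1 x \<noteq> 0" by (simp only: d)
  hence pos: "AE x in Q0. RN_deriv Q0 Q1 x \<noteq> 0"
    by (rule absolutely_continuous_AE[rotated 2]) (simp_all add: ac10)
  show ?thesis using fin pos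
  proof eventually_elim
    fix x assume *: "RN_deriv Q0 Q1 x \<noteq> \<infinity>" "RN_deriv Q0 Q1 x \<noteq> 0"
    then obtain r where r: "RN_deriv Q0 Q1 x = ennreal r" "r > 0"
      by (cases "RN_deriv Q0 Q1 x") (auto simp: less_le)
    thus "RN_deriv Q0 Q1 x = ennreal (exp (log_lr Q0 Q1 x))"
      by (simp add: entropy_density_def log_def)
  qed
qed

lemma density_Q0_exp: "density Q0 (\<lambda>x. ennreal (exp (log_lr Q0 Q1 x))) = Q1"
proof -
  interpret Q0: prob_space Q0 by (rule prob0)
  have "density Q0 (\<lambda>x. ennreal (exp (log_lr Q0 Q1 x))) = density Q0 (RN_deriv Q0 Q1)"
    using AE_RN_deriv by (intro density_cong) (measurable, auto elim: eventually_mono)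
  also have "\<dots> = Q1" by (rule Q0.density_RN_deriv) (simp_all add: ac01)
  finally show ?thesis .
qed

lemma density_Q1_exp: "density Q1 (\<lambda>x. ennreal (exp (- log_lr Q0 Q1 x))) = Q0"
proof -
  have "density Q1 (\<lambda>x. ennreal (exp (- log_lr Q0 Q1 x)))
      = density (density Q0 (\<lambda>x. ennreal (exp (log_lr Q0 Q1 x)))) (\<lambda>x. ennreal (exp (- log_lr Q0 Q1 x)))"
    by (simp only: density_Q0_exp)
  also have "\<dots> = density Q0 (\<lambda>x. ennreal (exp (log_lr Q0 Q1 x)) * ennreal (exp (- log_lr Q0 Q1 x)))"
    by (rule density_density_eq) measurable
  also have "\<dots> = density Q0 (\<lambda>x. 1)"
    by (simp add: ennreal_mult[symmetric] exp_minus field_simps)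
  also have "\<dots> = Q0" by (rule density_1)
  finally show ?thesis .
qed

lemma AE_log_lr_swap: "AE x in Q0. log_lr Q1 Q0 x = - log_lr Q0 Q1 x"
    "AE x in Q1. log_lr Q1 Q0 x = - log_lr Q0 Q1 x"
proof -
  interpret Q1: prob_space Q1 by (rule prob1)
  have "AE x in Q1. ennreal (exp (- log_lr Q0 Q1 x)) = RN_deriv Q1 Q0 x"
    by (rule Q1.RN_deriv_unique) (measurable, rule density_Q1_exp)
  thus *: "AE x in Q1. log_lr Q1 Q0 x = - log_lr Q0 Q1 x"
  proof eventually_elim
    fix x assume "ennreal (exp (- log_lr Q0 Q1 x)) = RN_deriv Q1 Q0 x"
    hence "enn2real (RN_deriv Q1 Q0 x) = exp (- log_lr Q0 Q1 x)"
      by (metis enn2real_ennreal exp_ge_zero)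
    thus "log_lr Q1 Q0 x = - log_lr Q0 Q1 x"
      by (simp add: entropy_density_def[of _ Q1] log_def)
  qed
  show "AE x in Q0. log_lr Q1 Q0 x = - log_lr Q0 Q1 x"
    by (rule absolutely_continuous_AE[OF _ ac10 *]) simp
qed

lemma density_Q0_exp': "density Q0 (\<lambda>x. ennreal (exp (- log_lr Q1 Q0 x))) = Q1"
proof -
  have "density Q0 (\<lambda>x. ennreal (exp (- log_lr Q1 Q0 x))) = density Q0 (\<lambda>x. ennreal (exp (log_lr Q0 Q1 x)))"
    using AE_log_lr_swap(1) by (intro density_cong) (measurable, auto)
  thus ?thesis by (simp add: density_Q0_exp)
qed

text \<open>The log-likelihood ratio at one coordinate in favour of the law that \<open>A\<close> prescribes there,
  against the other of the two laws.\<close>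

definition coord_llr :: "'i set \<Rightarrow> 'i \<Rightarrow> real \<Rightarrow> real" where
  "coord_llr A i = (if i \<in> A then log_lr Q0 Q1 else log_lr Q1 Q0)"

definition LLR :: "'i set \<Rightarrow> 'i set \<Rightarrow> ('i \<Rightarrow> real) \<Rightarrow> real" where
  "LLR A K y = (\<Sum>i\<in>K. coord_llr A i (y i))"

lemma measurable_coord_llr [measurable]: "coord_llr A i \<in> borel_measurable borel"
  by (simp add: coord_llr_def)

lemma measurable_coord_llr_marginal [measurable]: "coord_llr A i \<in> borel_measurable (marginal B j)"
  by (simp add: measurable_cong_sets[OF sets_marginal refl])

lemma density_marginal: "density (marginal A i) (\<lambda>x. ennreal (exp (- coord_llr A i x))) = marginal (sym_diff A {i}) i"
  using density_Q1_exp density_Q0_exp' by (simp add: marginal_def coord_llr_def)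

text \<open>The Hellinger affinity \<open>\<integral> sqrt (dQ0 dQ1)\<close>, written as an expectation under \<open>Q1\<close>. It is symmetric
  (\<open>nn_integral_hellinger\<close>).\<close>

definition affinity :: real where "affinity = (\<integral>x. exp (- (log_lr Q0 Q1 x / 2)) \<partial>Q1)"

lemma nn_integral_exp_coord_llr: "(\<integral>\<^sup>+x. ennreal (exp (- coord_llr A i x)) \<partial>marginal A i) = 1"
proof -
  have "(\<integral>\<^sup>+x. ennreal (exp (- coord_llr A i x)) \<partial>marginal A i) = emeasure (density (marginal A i) (\<lambda>x. ennreal (exp (- coord_llr A i x)))) UNIV"
    by (subst emeasure_density) auto
  also have "\<dots> = 1" unfolding density_marginal
    using prob_space.emeasure_space_1[OF prob_space_marginal[of "sym_diff A {i}" i]] by simp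
  finally show ?thesis .
qed

lemma integrable_hellinger: "integrable Q1 (\<lambda>x. exp (- (log_lr Q0 Q1 x / 2)))"
  "integrable Q1 (\<lambda>x. exp (- log_lr Q0 Q1 x))" "(\<integral>x. exp (- log_lr Q0 Q1 x) \<partial>Q1) = 1"
proof -
  interpret Q1: prob_space Q1 by (rule prob1)
  have n: "(\<integral>\<^sup>+x. ennreal (exp (- log_lr Q0 Q1 x)) \<partial>Q1) = ennreal 1"
    using nn_integral_exp_coord_llr[of "{0::nat}" 0] by (simp add: coord_llr_def marginal_def)
  show i: "integrable Q1 (\<lambda>x. exp (- log_lr Q0 Q1 x))" "(\<integral>x. exp (- log_lr Q0 Q1 x) \<partial>Q1) = 1"
    by (rule integrableI_nn_integral_finite[OF _ _ n], auto) (rule integral_eq_nn_integral[OF _ _, THEN trans], auto simp: n)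
  show "integrable Q1 (\<lambda>x. exp (- (log_lr Q0 Q1 x / 2)))"
  proof (rule Bochner_Integration.integrable_bound)
    show "integrable Q1 (\<lambda>x. 1 + exp (- log_lr Q0 Q1 x))" using i by simp
    show "AE x in Q1. norm (exp (- (log_lr Q0 Q1 x / 2))) \<le> norm (1 + exp (- log_lr Q0 Q1 x))"
    proof (rule AE_I2)
      fix x
      have "exp (- (log_lr Q0 Q1 x / 2)) \<le> 1 \<or> exp (- (log_lr Q0 Q1 x / 2)) \<le> exp (- log_lr Q0 Q1 x)"
        by (cases "log_lr Q0 Q1 x \<ge> 0") auto
      thus "norm (exp (- (log_lr Q0 Q1 x / 2))) \<le> norm (1 + exp (- log_lr Q0 Q1 x))"
        by (smt (verit) exp_gt_zero real_norm_def)
    qed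
  qed auto
qed

text \<open>Since \<open>exp (- log_lr Q0 Q1)\<close> has mean \<open>1\<close>, \<open>2 - 2 * affinity\<close> is the mean of
  \<open>(1 - exp (- log_lr Q0 Q1 / 2))\<^sup>2\<close>, which vanishes only if \<open>Q0 = Q1\<close>.\<close>

lemma affinity_less_1: "affinity < 1"
proof (rule ccontr)
  assume "\<not> affinity < 1"
  interpret Q1: prob_space Q1 by (rule prob1)
  let ?e = "\<lambda>x. exp (- (log_lr Q0 Q1 x / 2))"
  have sq: "(1 - ?e x)\<^sup>2 = 1 + exp (- log_lr Q0 Q1 x) - 2 * ?e x" for x
    by (simp add: power2_eq_square algebra_simps exp_add[symmetric])
  have "(\<integral>x. (1 - ?e x)\<^sup>2 \<partial>Q1) = 2 - 2 * affinity"
    unfolding sq affinity_def using integrable_hellinger by (simp add: Q1.prob_space[simplified])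
  moreover have "0 \<le> (\<integral>x. (1 - ?e x)\<^sup>2 \<partial>Q1)" by simp
  ultimately have "(\<integral>x. (1 - ?e x)\<^sup>2 \<partial>Q1) = 0" using \<open>\<not> affinity < 1\<close> by linarith
  moreover have "integrable Q1 (\<lambda>x. (1 - ?e x)\<^sup>2)" unfolding sq using integrable_hellinger by simp
  ultimately have "AE x in Q1. (1 - ?e x)\<^sup>2 = 0"
    by (subst (asm) integral_nonneg_eq_0_iff_AE) auto
  hence "AE x in Q1. ennreal (exp (- log_lr Q0 Q1 x)) = 1"
    by eventually_elim simp
  hence "density Q1 (\<lambda>x. ennreal (exp (- log_lr Q0 Q1 x))) = density Q1 (\<lambda>_. 1)"
    by (intro density_cong) auto
  thus False using distinct by (simp only: density_Q1_exp density_1)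
qed

lemma affinity_pos: "0 < affinity"
proof -
  interpret Q1: prob_space Q1 by (rule prob1)
  have "0 \<le> affinity" unfolding affinity_def by simp
  moreover have "affinity \<noteq> 0"
  proof
    assume "affinity = 0"
    hence "AE x in Q1. exp (- (log_lr Q0 Q1 x / 2)) = 0"
      unfolding affinity_def by (subst (asm) integral_nonneg_eq_0_iff_AE) (auto simp: integrable_hellinger)
    thus False by (simp add: Q1.AE_False)
  qed
  ultimately show ?thesis by simp
qed

lemma nn_integral_hellinger: "(\<integral>\<^sup>+x. ennreal (exp (- (coord_llr A i x / 2))) \<partial>marginal A i) = ennreal affinity"
proof -
  have 1: "(\<integral>\<^sup>+x. ennreal (exp (- (log_lr Q0 Q1 x / 2))) \<partial>Q1) = ennreal affinity"
    unfolding affinity_def by (rule nn_integral_eq_integral) (auto simp: integrable_hellinger)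
  have "(\<integral>\<^sup>+x. ennreal (exp (- (log_lr Q1 Q0 x / 2))) \<partial>Q0)
     = (\<integral>\<^sup>+x. ennreal (exp (- (log_lr Q1 Q0 x / 2))) \<partial>density Q1 (\<lambda>x. ennreal (exp (- log_lr Q0 Q1 x))))"
    by (simp only: density_Q1_exp)
  also have "\<dots> = (\<integral>\<^sup>+x. ennreal (exp (- log_lr Q0 Q1 x)) * ennreal (exp (- (log_lr Q1 Q0 x / 2))) \<partial>Q1)"
    by (rule nn_integral_density) auto
  also have "\<dots> = (\<integral>\<^sup>+x. ennreal (exp (- (log_lr Q0 Q1 x / 2))) \<partial>Q1)"
  proof (rule nn_integral_cong_AE)
    show "AE x in Q1. ennreal (exp (- log_lr Q0 Q1 x)) * ennreal (exp (- (log_lr Q1 Q0 x / 2)))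
       = ennreal (exp (- (log_lr Q0 Q1 x / 2)))"
      using AE_log_lr_swap(2) by eventually_elim (simp add: ennreal_mult[symmetric] exp_add[symmetric])
  qed
  finally show ?thesis using 1 by (simp add: marginal_def coord_llr_def)
qed

lemma measurable_LLR: "K \<subseteq> L \<Longrightarrow> LLR A K \<in> borel_measurable (coord_algebra L)"
  unfolding LLR_def
  by (intro borel_measurable_sum measurable_compose[OF measurable_coord_algebra measurable_coord_llr]) auto

lemma measurable_LLR_law [measurable]: "LLR A K \<in> borel_measurable (law B)"
  by (rule measurable_coord_algebra_law[OF measurable_LLR[OF order_refl]])

lemma LLR_events: "S \<in> sets borel \<Longrightarrow> K \<subseteq> L \<Longrightarrow> {y. LLR A K y \<in> S} \<in> coord_events L"
  using measurable_sets[OF measurable_LLR[of K L A], of S]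
  by (simp add: sets_coord_algebra vimage_def)

lemma LLR_less_event: "K \<subseteq> L \<Longrightarrow> {y. LLR A K y < h} \<in> coord_events L"
  using LLR_events[of "{..<h}" K L A] by simp

lemma LLR_union: "finite K \<Longrightarrow> finite L \<Longrightarrow> K \<inter> L = {} \<Longrightarrow> LLR A (K \<union> L) y = LLR A K y + LLR A L y"
  unfolding LLR_def by (rule sum.union_disjoint)

lemma LLR_diff: "finite L \<Longrightarrow> K \<subseteq> L \<Longrightarrow> LLR A L y = LLR A K y + LLR A (L - K) y"
  using LLR_union[of K "L - K" A y] by (simp add: Un_absorb1 finite_subset)

lemma exp_LLR_prod: "finite K \<Longrightarrow> ennreal (exp (c * LLR A K y)) = (\<Prod>i\<in>K. ennreal (exp (c * coord_llr A i (y i))))"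
  by (simp add: LLR_def sum_distrib_left exp_sum prod_ennreal)

lemma nn_integral_exp_LLR:
  assumes "finite K" shows "(\<integral>\<^sup>+y. ennreal (exp (- LLR A K y)) \<partial>law A) = 1"
proof -
  have "(\<integral>\<^sup>+y. ennreal (exp ((-1) * LLR A K y)) \<partial>law A)
    = (\<Prod>i\<in>K. \<integral>\<^sup>+x. ennreal (exp ((-1) * coord_llr A i x)) \<partial>marginal A i)"
    unfolding exp_LLR_prod[OF assms] by (rule nn_integral_law_prod[OF assms]) measurable
  thus ?thesis by (simp add: nn_integral_exp_coord_llr)
qed

lemma nn_integral_exp_half_LLR:
  assumes "finite K" shows "(\<integral>\<^sup>+y. ennreal (exp (- (LLR A K y / 2))) \<partial>law A) = ennreal (affinity ^ card K)"
proof -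
  have "(\<integral>\<^sup>+y. ennreal (exp ((-1/2) * LLR A K y)) \<partial>law A)
    = (\<Prod>i\<in>K. \<integral>\<^sup>+x. ennreal (exp ((-1/2) * coord_llr A i x)) \<partial>marginal A i)"
    unfolding exp_LLR_prod[OF assms] by (rule nn_integral_law_prod[OF assms]) measurable
  moreover have "0 \<le> affinity" using affinity_pos by simp
  ultimately show ?thesis by (simp add: nn_integral_hellinger ennreal_power)
qed

text \<open>The exact change of measure on which all comparisons rest. It suffices to compare both sides on
  cylinders, where they factorise over the coordinates.\<close>

lemma density_law:
  assumes K: "finite K"
  shows "density (law A) (\<lambda>y. ennreal (exp (- LLR A K y))) = law (sym_diff A K)"
proof -
  let ?D = "density (law A) (\<lambda>y. ennreal (exp (- LLR A K y)))"
  interpret B: prob_space "law (sym_diff A K)" by (rule prob_space_law)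
  have "law (sym_diff A K) = ?D"
  proof (rule measure_eqI_PiM_infinite)
    show "sets (law (sym_diff A K)) = sets (Pi\<^sub>M UNIV (\<lambda>_. borel))" by (rule sets_law)
    show "sets ?D = sets (Pi\<^sub>M UNIV (\<lambda>_. borel))" by (simp add: sets_law)
    show "finite_measure (law (sym_diff A K))" by unfold_locales
  next
    fix B :: "'a \<Rightarrow> real set" and J :: "'a set"
    assume J: "finite J" and Bm: "\<And>i. i \<in> J \<Longrightarrow> B i \<in> sets borel"
    define S where "S = prod_emb UNIV (\<lambda>_::'a. borel :: real measure) J (Pi\<^sub>E J B)"
    have S: "S = {y. \<forall>j\<in>J. y j \<in> B j}"
    proof (rule set_eqI)
      fix y
      have "y \<in> S \<longleftrightarrow> restrict y J \<in> Pi\<^sub>E J B" by (simp add: S_def prod_emb_def)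
      also have "\<dots> \<longleftrightarrow> (\<forall>j\<in>J. restrict y J j \<in> B j)" by (simp only: PiE_iff) simp
      finally show "y \<in> S \<longleftrightarrow> y \<in> {y. \<forall>j\<in>J. y j \<in> B j}" by simp
    qed
    define b where "b i x = (if i \<in> J then indicator (B i) x else 1 :: ennreal)" for i x
    define g where "g i x = (if i \<in> K then ennreal (exp (- coord_llr A i x)) else 1) * b i x" for i x
    have bm [measurable]: "b i \<in> borel_measurable borel" for i
      using Bm by (cases "i \<in> J") (auto simp: b_def[abs_def])
    have gm [measurable]: "g i \<in> borel_measurable borel" for i
      by (cases "i \<in> K") (auto simp: g_def[abs_def])
    have ind: "indicator S y = (\<Prod>i\<in>J\<union>K. b i (y i))" for y
    proof -
      have "(\<Prod>i\<in>J\<union>K. b i (y i)) = (\<Prod>i\<in>J. b i (y i))"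
        by (rule prod.mono_neutral_right) (use J K in \<open>auto simp: b_def\<close>)
      also have "\<dots> = indicator S y"
      proof (cases "\<forall>j\<in>J. y j \<in> B j")
        case True
        thus ?thesis by (simp add: S b_def)
      next
        case False
        then obtain j where "j \<in> J" "y j \<notin> B j" by blast
        hence "(\<Prod>i\<in>J. b i (y i)) = 0" using J by (intro prod_zero bexI[of _ j]) (auto simp: b_def)
        thus ?thesis using False by (simp add: S)
      qed
      finally show ?thesis ..
    qed
    have Sm [measurable]: "S \<in> sets (law A)"
      unfolding sets_law S_def by (rule sets_PiM_I) (use J Bm in auto)
    have "?D S = (\<integral>\<^sup>+y. ennreal (exp (- LLR A K y)) * indicator S y \<partial>law A)"
      by (rule emeasure_density) measurable
    also have "\<dots> = (\<integral>\<^sup>+y. (\<Prod>i\<in>J\<union>K. g i (y i)) \<partial>law A)"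
    proof (rule nn_integral_cong)
      fix y
      have "ennreal (exp (- LLR A K y)) = (\<Prod>i\<in>K. ennreal (exp (- coord_llr A i (y i))))"
        using exp_LLR_prod[OF K, of "-1" A y] by simp
      also have "\<dots> = (\<Prod>i\<in>J\<union>K. if i \<in> K then ennreal (exp (- coord_llr A i (y i))) else 1)"
        by (rule prod.mono_neutral_cong_left) (use J K in auto)
      finally show "ennreal (exp (- LLR A K y)) * indicator S y = (\<Prod>i\<in>J\<union>K. g i (y i))"
        by (simp only: ind g_def prod.distrib)
    qed
    also have "\<dots> = (\<Prod>i\<in>J\<union>K. \<integral>\<^sup>+x. g i x \<partial>marginal A i)"
      by (rule nn_integral_law_prod) (use J K in auto)
    also have "\<dots> = (\<Prod>i\<in>J\<union>K. \<integral>\<^sup>+x. b i x \<partial>marginal (sym_diff A K) i)"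
    proof (rule prod.cong[OF refl])
      fix i assume "i \<in> J \<union> K"
      show "(\<integral>\<^sup>+x. g i x \<partial>marginal A i) = (\<integral>\<^sup>+x. b i x \<partial>marginal (sym_diff A K) i)"
      proof (cases "i \<in> K")
        case True
        hence "marginal (sym_diff A K) i = density (marginal A i) (\<lambda>x. ennreal (exp (- coord_llr A i x)))"
          unfolding density_marginal by (auto simp: marginal_def)
        moreover have "(\<integral>\<^sup>+x. b i x \<partial>density (marginal A i) (\<lambda>x. ennreal (exp (- coord_llr A i x))))
            = (\<integral>\<^sup>+x. ennreal (exp (- coord_llr A i x)) * b i x \<partial>marginal A i)"
          by (rule nn_integral_density) (simp_all add: measurable_cong_sets[OF sets_marginal refl])
        ultimately show ?thesis using True by (simp add: g_def)
      next
        case False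
        hence "marginal (sym_diff A K) i = marginal A i" by (auto simp: marginal_def)
        thus ?thesis using False by (simp add: g_def)
      qed
    qed
    also have "\<dots> = (\<integral>\<^sup>+y. (\<Prod>i\<in>J\<union>K. b i (y i)) \<partial>law (sym_diff A K))"
      by (rule nn_integral_law_prod[symmetric]) (use J K in auto)
    also have "\<dots> = law (sym_diff A K) S"
      unfolding ind[symmetric] by (rule nn_integral_indicator) (use Sm in \<open>simp add: sets_law\<close>)
    finally show "law (sym_diff A K) (prod_emb UNIV (\<lambda>_. borel) J (Pi\<^sub>E J B)) = ?D (prod_emb UNIV (\<lambda>_. borel) J (Pi\<^sub>E J B))"
      unfolding S_def ..
  qed
  thus ?thesis ..
qed

lemma emeasure_law_flip:
  assumes "finite K" "E \<in> sets (law A)"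
  shows "emeasure (law (sym_diff A K)) E = (\<integral>\<^sup>+y. ennreal (exp (- LLR A K y)) * indicator E y \<partial>law A)"
  unfolding density_law[OF assms(1), symmetric] by (rule emeasure_density) (use assms in measurable)

text \<open>The upper half of the change of measure: an event on which \<open>A\<close> looks much better than the flipped
  assignment is rare under the flipped one.\<close>

lemma prob_flip_le:
  assumes K: "finite K" and E: "E \<in> sets (law A)" and x: "\<And>y. y \<in> E \<Longrightarrow> x \<le> LLR A K y"
  shows "measure (law (sym_diff A K)) E \<le> exp (- x) * measure (law A) E"
proof -
  interpret A: prob_space "law A" by (rule prob_space_law)
  interpret B: prob_space "law (sym_diff A K)" by (rule prob_space_law)
  have "emeasure (law (sym_diff A K)) E \<le> (\<integral>\<^sup>+y. ennreal (exp (- x)) * indicator E y \<partial>law A)"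
    unfolding emeasure_law_flip[OF K E]
    by (rule nn_integral_mono) (auto split: split_indicator simp: x)
  also have "\<dots> = ennreal (exp (- x) * measure (law A) E)"
    using E by (simp add: nn_integral_cmult A.emeasure_eq_measure ennreal_mult)
  finally show ?thesis by (simp add: B.emeasure_eq_measure)
qed

text \<open>The lower half of the change of measure, in the form that bounds detection probabilities: what
  is rare after the flip is rare before it, unless the log-likelihood ratio is large.\<close>

lemma prob_flip_ge:
  assumes K: "finite K" and E: "E \<in> sets (law A)"
  shows "measure (law A) E \<le> exp x * measure (law (sym_diff A K)) E + measure (law A) {y. x < LLR A K y}"
proof -
  interpret A: prob_space "law A" by (rule prob_space_law)
  interpret B: prob_space "law (sym_diff A K)" by (rule prob_space_law)
  let ?L = "{y. x < LLR A K y}"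
  have L [measurable]: "?L \<in> sets (law A)"
    using measurable_sets[OF measurable_LLR_law, of "{x<..}" A K A] by (simp add: vimage_def)
  have EL: "E - ?L \<in> sets (law A)" using E L by auto
  have "(\<integral>\<^sup>+y. ennreal (exp (- x)) * indicator (E - ?L) y \<partial>law A) \<le> emeasure (law (sym_diff A K)) E"
    unfolding emeasure_law_flip[OF K E]
    by (rule nn_integral_mono) (auto split: split_indicator)
  also have "(\<integral>\<^sup>+y. ennreal (exp (- x)) * indicator (E - ?L) y \<partial>law A) = ennreal (exp (- x) * measure (law A) (E - ?L))"
    using EL by (simp add: nn_integral_cmult A.emeasure_eq_measure ennreal_mult)
  finally have "exp (- x) * measure (law A) (E - ?L) \<le> measure (law (sym_diff A K)) E"
    by (simp add: B.emeasure_eq_measure)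
  hence "measure (law A) (E - ?L) \<le> exp x * measure (law (sym_diff A K)) E"
    by (simp add: exp_minus field_simps)
  moreover have "measure (law A) E \<le> measure (law A) (E - ?L) + measure (law A) ?L"
    using measure_Un_le[OF EL L] A.finite_measure_mono[of E "(E - ?L) \<union> ?L"] E L by fastforce
  ultimately show ?thesis by linarith
qed

text \<open>Log-likelihood ratios are rarely very negative under the law that they favour: \<open>exp (- LLR A K)\<close>
  has mean \<open>1\<close>. There is no loss that grows with the size of \<open>K\<close>, so arbitrary coordinates may be
  discarded at a price that does not depend on them.\<close>

lemma prob_LLR_less_neg:
  assumes "finite K"
  shows "measure (law A) {y. LLR A K y < - x} \<le> exp (- x)"
proof -
  interpret A: prob_space "law A" by (rule prob_space_law)
  have "{y. LLR A K y < - x} \<in> sets (law A)"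
    using LLR_less_event[OF order_refl] coord_events_subset_law by blast
  hence "emeasure (law A) {y. LLR A K y < - x} = (\<integral>\<^sup>+y. indicator {y. LLR A K y < - x} y \<partial>law A)" by simp
  also have "\<dots> \<le> (\<integral>\<^sup>+y. ennreal (exp (- x)) * ennreal (exp (- LLR A K y)) \<partial>law A)"
  proof (rule nn_integral_mono)
    fix y
    show "indicator {y. LLR A K y < - x} y \<le> ennreal (exp (- x)) * ennreal (exp (- LLR A K y))"
      by (auto split: split_indicator simp: ennreal_mult[symmetric] exp_add[symmetric])
  qed
  also have "\<dots> = ennreal (exp (- x))"
    using assms by (subst nn_integral_cmult) (simp_all add: nn_integral_exp_LLR)
  finally show ?thesis by (simp add: A.emeasure_eq_measure)
qed

text \<open>The Chernoff bound at exponent \<open>1 / 2\<close>, where the moment generating function is a power of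
  the affinity, whatever the kind of the coordinates.\<close>

lemma prob_LLR_less:
  assumes "finite K"
  shows "measure (law A) {y. LLR A K y < x} \<le> exp (x / 2) * affinity ^ card K"
proof -
  interpret A: prob_space "law A" by (rule prob_space_law)
  have r: "0 \<le> affinity" using affinity_pos by simp
  have "{y. LLR A K y < x} \<in> sets (law A)"
    using LLR_less_event[OF order_refl] coord_events_subset_law by blast
  hence "emeasure (law A) {y. LLR A K y < x} = (\<integral>\<^sup>+y. indicator {y. LLR A K y < x} y \<partial>law A)" by simp
  also have "\<dots> \<le> (\<integral>\<^sup>+y. ennreal (exp (x / 2)) * ennreal (exp (- (LLR A K y / 2))) \<partial>law A)"
  proof (rule nn_integral_mono)
    fix y
    show "indicator {y. LLR A K y < x} y \<le> ennreal (exp (x / 2)) * ennreal (exp (- (LLR A K y / 2)))"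
      by (auto split: split_indicator simp: ennreal_mult[symmetric] exp_add[symmetric])
  qed
  also have "\<dots> = ennreal (exp (x / 2) * affinity ^ card K)"
    using assms r by (subst nn_integral_cmult) (simp_all add: nn_integral_exp_half_LLR ennreal_mult)
  finally show ?thesis using r by (simp add: A.emeasure_eq_measure)
qed

text \<open>The law of a log-likelihood ratio depends only on the numbers of coordinates of both kinds. Thus
  it is the same for all sources and for all translated or reshaped sets of coordinates.\<close>

lemma prob_LLR_cong:
  fixes K L :: "'i set"
  assumes fin: "finite K" "finite L"
    and card: "card (K \<inter> A) = card (L \<inter> B)" "card (K - A) = card (L - B)"
    and S: "S \<in> sets borel"
  shows "measure (law A) {y. LLR A K y \<in> S} = measure (law B) {y. LLR B L y \<in> S}"
proof -
  obtain g where g: "bij_betw g (L \<inter> B) (K \<inter> A)"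
    using finite_same_card_bij[of "L \<inter> B" "K \<inter> A"] fin card by auto
  obtain h where h: "bij_betw h (L - B) (K - A)"
    using finite_same_card_bij[of "L - B" "K - A"] fin card by auto
  define f where "f i = (if i \<in> B then g i else h i)" for i
  have "bij_betw f ((L \<inter> B) \<union> (L - B)) ((K \<inter> A) \<union> (K - A))"
  proof (rule bij_betw_combine)
    show "bij_betw f (L \<inter> B) (K \<inter> A)"
      using g by (rule bij_betw_cong[THEN iffD1, rotated]) (auto simp: f_def)
    show "bij_betw f (L - B) (K - A)"
      using h by (rule bij_betw_cong[THEN iffD1, rotated]) (auto simp: f_def)
  qed auto
  hence f: "bij_betw f L K" by (simp add: Int_Diff_Un)
  have fA: "f i \<in> A \<longleftrightarrow> i \<in> B" if "i \<in> L" for i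
  proof (cases "i \<in> B")
    case True
    hence "g i \<in> K \<inter> A" using g that by (auto dest: bij_betwE)
    thus ?thesis using True by (simp add: f_def)
  next
    case False
    hence "h i \<in> K - A" using h that by (auto dest: bij_betwE)
    thus ?thesis using False by (simp add: f_def)
  qed
  define P where "P z \<longleftrightarrow> (\<Sum>i\<in>L. coord_llr B i (z i)) \<in> S" for z
  have m: "(\<lambda>z. \<Sum>i\<in>L. coord_llr B i (z i)) \<in> borel_measurable (Pi\<^sub>M L (\<lambda>_. borel))"
    by measurable
  have P: "Measurable.pred (Pi\<^sub>M L (\<lambda>_. borel)) P"
    using measurable_sets[OF m S] by (simp add: P_def pred_def vimage_def Int_def conj_commute)
  have "measure (law A) {y. P (\<lambda>i\<in>L. y (f i))} = measure (law B) {y. P (\<lambda>i\<in>L. y i)}"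
    by (rule prob_eq_reindex[OF _ _ P]) (use f fA in \<open>auto simp: bij_betw_def\<close>)
  moreover have "P (\<lambda>i\<in>L. y i) \<longleftrightarrow> LLR B L y \<in> S" for y
    by (simp add: P_def LLR_def)
  moreover have "P (\<lambda>i\<in>L. y (f i)) \<longleftrightarrow> LLR A K y \<in> S" for y
  proof -
    have "LLR A K y = (\<Sum>i\<in>L. coord_llr A (f i) (y (f i)))"
      unfolding LLR_def using f by (rule sum.reindex_bij_betw[symmetric])
    also have "\<dots> = (\<Sum>i\<in>L. coord_llr B i (y (f i)))"
      by (rule sum.cong) (auto simp: coord_llr_def fA)
    finally show ?thesis by (simp add: P_def)
  qed
  ultimately show ?thesis by simp
qed

end

section \<open>Deviations of sums over disjoint blocks and a weak law\<close>

context mutual_ac_laws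
begin

lemma measure_law_UNIV [simp]: "measure (law A) UNIV = 1"
  using prob_space.prob_space[OF prob_space_law[of A]] by simp

text \<open>The two derivatives are inverse to each other almost everywhere under each of the laws.\<close>

lemma AE_LLR_flip:
  assumes "finite K"
  shows "AE y in law B. LLR (sym_diff A K) K y = - LLR A K y"
proof -
  have "AE y in law B. \<forall>i\<in>K. coord_llr (sym_diff A K) i (y i) = - coord_llr A i (y i)"
  proof (rule AE_finite_allI[OF assms])
    fix i assume "i \<in> K"
    have "AE x in marginal B i. log_lr Q1 Q0 x = - log_lr Q0 Q1 x"
      using AE_log_lr_swap unfolding marginal_def by (cases "i \<in> B") simp_all
    hence "AE x in marginal B i. coord_llr (sym_diff A K) i x = - coord_llr A i x"
      by eventually_elim (use \<open>i \<in> K\<close> in \<open>auto simp: coord_llr_def\<close>)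
    thus "AE y in law B. coord_llr (sym_diff A K) i (y i) = - coord_llr A i (y i)" by (rule AE_law_coord)
  qed
  thus ?thesis
    by eventually_elim (simp add: LLR_def sum_negf[symmetric])
qed

lemma indep_var_coord_algebra:
  assumes f: "f \<in> borel_measurable (coord_algebra K)" and g: "g \<in> borel_measurable (coord_algebra L)"
    and "K \<inter> L = {}"
  shows "prob_space.indep_var (law A) borel (f :: _ \<Rightarrow> real) borel (g :: _ \<Rightarrow> real)"
proof -
  interpret prob_space "law A" by (rule prob_space_law)
  have sub: "sigma_sets (space (law A)) {h -` B \<inter> space (law A) | B. B \<in> sets borel} \<subseteq> coord_events M"
    if "h \<in> borel_measurable (coord_algebra M)" for h :: "_ \<Rightarrow> real" and M :: "'a set"
  proof -
    interpret M: sigma_algebra UNIV "coord_events M" by (rule sigma_algebra_coord_events)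
    have "{h -` B \<inter> space (law A) | B. B \<in> sets borel} \<subseteq> coord_events M"
      using measurable_sets[OF that] by (auto simp: sets_coord_algebra)
    thus ?thesis using M.sigma_sets_subset by simp
  qed
  have "indep_set (coord_events K) (coord_events L)"
    unfolding indep_sets2_eq using assms(3) prob_indep coord_events_subset_law by blast
  hence "indep_set (sigma_sets (space (law A)) {f -` B \<inter> space (law A) | B. B \<in> sets borel})
     (sigma_sets (space (law A)) {g -` B \<inter> space (law A) | B. B \<in> sets borel})"
    unfolding indep_sets2_eq using sub[OF f] sub[OF g] by blast
  thus ?thesis
    unfolding indep_var_eq using f g by (simp add: measurable_coord_algebra_law)
qed

text \<open>Variables on disjoint blocks are uncorrelated, so the variance of the sum is at most the sum of
  the second moments. This serves both the weak law, with single coordinates as blocks, and the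
  mixture bound, with light cones as blocks.\<close>

lemma abs_deviation_le:
  fixes X :: "'j \<Rightarrow> ('i \<Rightarrow> real) \<Rightarrow> real"
  assumes I: "finite I" and X: "\<And>j. j \<in> I \<Longrightarrow> X j \<in> borel_measurable (coord_algebra (K j))"
    and disj: "disjoint_family_on K I" and bd: "\<And>j y. j \<in> I \<Longrightarrow> \<bar>X j y\<bar> \<le> B"
  shows "(\<integral>y. \<bar>\<Sum>j\<in>I. X j y - (\<integral>z. X j z \<partial>law A)\<bar> \<partial>law A)
     \<le> sqrt (\<Sum>j\<in>I. \<integral>y. (X j y)\<^sup>2 \<partial>law A)"
proof -
  interpret prob_space "law A" by (rule prob_space_law)
  have XM [measurable]: "X j \<in> borel_measurable (law A)" if "j \<in> I" for j
    using X[OF that] by (rule measurable_coord_algebra_law)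
  have Xi: "integrable (law A) (X j)" if "j \<in> I" for j
    by (rule integrable_const_bound[of _ B]) (use that bd in auto)
  have X2i: "integrable (law A) (\<lambda>y. (X j y)\<^sup>2)" if "j \<in> I" for j
  proof (rule integrable_const_bound[of _ "B\<^sup>2"])
    show "AE y in law A. norm ((X j y)\<^sup>2) \<le> B\<^sup>2"
    proof (rule AE_I2)
      fix y
      have "\<bar>X j y\<bar>\<^sup>2 \<le> B\<^sup>2" using bd[OF that, of y] by (intro power_mono) auto
      thus "norm ((X j y)\<^sup>2) \<le> B\<^sup>2" by simp
    qed
  qed (use that in measurable)
  define C where "C j y = X j y - expectation (X j)" for j y
  have CK: "C j \<in> borel_measurable (coord_algebra (K j))" if "j \<in> I" for j
    unfolding C_def[abs_def] using X[OF that] by simp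
  have CM [measurable]: "C j \<in> borel_measurable (law A)" if "j \<in> I" for j
    using CK[OF that] by (rule measurable_coord_algebra_law)
  have Ci: "integrable (law A) (C j)" if "j \<in> I" for j
    unfolding C_def[abs_def] using Xi[OF that] by simp
  have C0: "expectation (C j) = 0" if "j \<in> I" for j
    unfolding C_def[abs_def] using Xi[OF that] by (simp add: prob_space)
  have Cb: "\<bar>C j y\<bar> \<le> 2 * \<bar>B\<bar>" if "j \<in> I" for j y
  proof -
    have "\<bar>expectation (X j)\<bar> \<le> expectation (\<lambda>y. \<bar>X j y\<bar>)" by (rule integral_abs_bound)
    also have "\<dots> \<le> expectation (\<lambda>y. \<bar>B\<bar>)"
      by (rule integral_mono) (use Xi[OF that] order_trans[OF bd[OF that] abs_ge_self] in auto)
    finally have "\<bar>expectation (X j)\<bar> \<le> \<bar>B\<bar>" by (simp add: prob_space)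
    thus ?thesis using bd[OF that, of y] unfolding C_def by linarith
  qed
  have CCi: "integrable (law A) (\<lambda>y. C j y * C k y)" if "j \<in> I" "k \<in> I" for j k
  proof (rule integrable_const_bound[of _ "(2 * \<bar>B\<bar>) * (2 * \<bar>B\<bar>)"])
    show "AE y in law A. norm (C j y * C k y) \<le> (2 * \<bar>B\<bar>) * (2 * \<bar>B\<bar>)"
    proof (rule AE_I2)
      fix y
      have "\<bar>C j y\<bar> * \<bar>C k y\<bar> \<le> (2 * \<bar>B\<bar>) * (2 * \<bar>B\<bar>)"
        by (intro mult_mono Cb that) auto
      thus "norm (C j y * C k y) \<le> (2 * \<bar>B\<bar>) * (2 * \<bar>B\<bar>)" by (simp add: abs_mult)
    qed
  qed (use that in measurable)
  have off: "expectation (\<lambda>y. C j y * C k y) = 0" if "j \<in> I" "k \<in> I" "j \<noteq> k" for j k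
  proof -
    have "K j \<inter> K k = {}" using disj that by (auto simp: disjoint_family_on_def)
    hence "indep_var borel (C j) borel (C k)" using CK that by (intro indep_var_coord_algebra) auto
    thus ?thesis using Ci C0 that by (simp add: indep_var_lebesgue_integral)
  qed
  have diag: "expectation (\<lambda>y. C j y * C j y) \<le> expectation (\<lambda>y. (X j y)\<^sup>2)" if "j \<in> I" for j
  proof -
    have "expectation (\<lambda>y. C j y * C j y) = variance (X j)"
      by (simp add: C_def power2_eq_square)
    also have "\<dots> = expectation (\<lambda>y. (X j y)\<^sup>2) - (expectation (X j))\<^sup>2"
      using Xi X2i that by (intro variance_eq) auto
    finally show ?thesis by simp
  qed
  define S where "S y = (\<Sum>j\<in>I. C j y)" for y
  have SM [measurable]: "S \<in> borel_measurable (law A)" unfolding S_def[abs_def] by measurable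
  have S2: "(S y)\<^sup>2 = (\<Sum>j\<in>I. \<Sum>k\<in>I. C j y * C k y)" for y
    by (simp add: S_def power2_eq_square sum_product)
  have S2i: "integrable (law A) (\<lambda>y. (S y)\<^sup>2)"
    unfolding S2 using CCi by auto
  have Si: "integrable (law A) S" unfolding S_def[abs_def] using Ci by auto
  have "expectation (\<lambda>y. (S y)\<^sup>2) = (\<Sum>j\<in>I. \<Sum>k\<in>I. expectation (\<lambda>y. C j y * C k y))"
    unfolding S2 using CCi by simp
  also have "\<dots> = (\<Sum>j\<in>I. expectation (\<lambda>y. C j y * C j y))"
  proof (rule sum.cong[OF refl])
    fix j assume j: "j \<in> I"
    have "(\<Sum>k\<in>I. expectation (\<lambda>y. C j y * C k y)) = (\<Sum>k\<in>{j}. expectation (\<lambda>y. C j y * C k y))"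
      by (rule sum.mono_neutral_right) (use I j off in auto)
    thus "(\<Sum>k\<in>I. expectation (\<lambda>y. C j y * C k y)) = expectation (\<lambda>y. C j y * C j y)" by simp
  qed
  also have "\<dots> \<le> (\<Sum>j\<in>I. expectation (\<lambda>y. (X j y)\<^sup>2))" by (rule sum_mono) (rule diag)
  finally have *: "expectation (\<lambda>y. (S y)\<^sup>2) \<le> (\<Sum>j\<in>I. expectation (\<lambda>y. (X j y)\<^sup>2))" .
  have "0 \<le> variance (\<lambda>y. \<bar>S y\<bar>)" by simp
  also have "\<dots> = expectation (\<lambda>y. \<bar>S y\<bar>\<^sup>2) - (expectation (\<lambda>y. \<bar>S y\<bar>))\<^sup>2"
    using Si S2i by (intro variance_eq) auto
  finally have "(expectation (\<lambda>y. \<bar>S y\<bar>))\<^sup>2 \<le> (\<Sum>j\<in>I. expectation (\<lambda>y. (X j y)\<^sup>2))"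
    using * by simp
  hence "expectation (\<lambda>y. \<bar>S y\<bar>) \<le> sqrt (\<Sum>j\<in>I. expectation (\<lambda>y. (X j y)\<^sup>2))"
    by (rule real_le_rsqrt)
  thus ?thesis by (simp add: S_def C_def)
qed

end

lemma integrable_truncate:
  fixes f :: "'a \<Rightarrow> real"
  assumes f: "integrable M f" and "e > 0"
  obtains B where "B \<ge> 0" "(\<integral>x. \<bar>f x - (if \<bar>f x\<bar> \<le> B then f x else 0)\<bar> \<partial>M) \<le> e"
proof -
  have [measurable]: "f \<in> borel_measurable M" using f by auto
  have "(\<lambda>n. \<integral>x. \<bar>f x - (if \<bar>f x\<bar> \<le> real n then f x else 0)\<bar> \<partial>M) \<longlonglongrightarrow> (\<integral>x. 0 \<partial>M)"
  proof (rule integral_dominated_convergence[where w="\<lambda>x. \<bar>f x\<bar>"])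
    show "AE x in M. (\<lambda>n. \<bar>f x - (if \<bar>f x\<bar> \<le> real n then f x else 0)\<bar>) \<longlonglongrightarrow> 0"
    proof (rule AE_I2)
      fix x
      have "\<forall>\<^sub>F n in sequentially. \<bar>f x\<bar> \<le> real n"
        using eventually_ge_at_top[of "nat \<lceil>\<bar>f x\<bar>\<rceil>"] by eventually_elim linarith
      hence "\<forall>\<^sub>F n in sequentially. \<bar>f x - (if \<bar>f x\<bar> \<le> real n then f x else 0)\<bar> = 0"
        by eventually_elim simp
      thus "(\<lambda>n. \<bar>f x - (if \<bar>f x\<bar> \<le> real n then f x else 0)\<bar>) \<longlonglongrightarrow> 0"
        by (rule tendsto_eventually)
    qed
    show "\<And>n. AE x in M. norm \<bar>f x - (if \<bar>f x\<bar> \<le> real n then f x else 0)\<bar> \<le> \<bar>f x\<bar>" by auto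
  qed (use f in auto)
  hence "\<forall>\<^sub>F n in sequentially. (\<integral>x. \<bar>f x - (if \<bar>f x\<bar> \<le> real n then f x else 0)\<bar> \<partial>M) < e"
    using \<open>e > 0\<close> by (auto simp: order_tendsto_iff)
  then obtain n where "(\<integral>x. \<bar>f x - (if \<bar>f x\<bar> \<le> real n then f x else 0)\<bar> \<partial>M) < e"
    by (auto simp: eventually_sequentially)
  thus thesis using that[of "real n"] by auto
qed

context mutual_ac_laws
begin

lemma integral_law_coord:
  assumes "g \<in> borel_measurable borel"
  shows "(\<integral>y. (g (y i) :: real) \<partial>law A) = (\<integral>x. g x \<partial>marginal A i)"
  unfolding distr_law_coord[of A i, symmetric] using assms by (subst integral_distr) auto

lemma integrable_law_coord:
  assumes "g \<in> borel_measurable borel"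
  shows "integrable (law A) (\<lambda>y. (g (y i) :: real)) \<longleftrightarrow> integrable (marginal A i) g"
  unfolding distr_law_coord[of A i, symmetric] using assms by (subst integrable_distr_eq) auto

text \<open>Only first moments are finite in general, so the summands are truncated: the truncated part
  has small deviations in \<open>L\<^sup>1\<close> by \<open>abs_deviation_le\<close>, and the rest is small in \<open>L\<^sup>1\<close> by dominated
  convergence. The bound is uniform in the set of coordinates.\<close>

lemma LLR_weak_law:
  assumes int: "integrable Q1 (log_lr Q0 Q1)" "integrable Q0 (log_lr Q1 Q0)"
    and D: "D = (\<integral>x. log_lr Q0 Q1 x \<partial>Q1) + (\<integral>x. log_lr Q1 Q0 x \<partial>Q0)"
    and "d > 0" "e > 0"
  shows "\<exists>N. \<forall>k\<ge>N. \<forall>A (K :: 'i set). finite K \<longrightarrow> card (K \<inter> A) = k \<longrightarrow> card (K - A) = k \<longrightarrow>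
     measure (law A) {y. real k * (D + d) < LLR A K y} \<le> e"
proof -
  (* The errors in L1 add up to at most 4 k \<eta>, and Markov's inequality is applied at one half of
     the slack k d. *)
  define \<eta> where "\<eta> = d * e / 8"
  have \<eta>: "\<eta> > 0" using assms by (simp add: \<eta>_def)
  obtain B0 where B0: "B0 \<ge> 0" "(\<integral>x. \<bar>log_lr Q1 Q0 x - (if \<bar>log_lr Q1 Q0 x\<bar> \<le> B0 then log_lr Q1 Q0 x else 0)\<bar> \<partial>Q0) \<le> \<eta>"
    using integrable_truncate[OF int(2) \<eta>] by blast
  obtain B1 where B1: "B1 \<ge> 0" "(\<integral>x. \<bar>log_lr Q0 Q1 x - (if \<bar>log_lr Q0 Q1 x\<bar> \<le> B1 then log_lr Q0 Q1 x else 0)\<bar> \<partial>Q1) \<le> \<eta>"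
    using integrable_truncate[OF int(1) \<eta>] by blast
  define B where "B = max B0 B1 + 1"
  obtain N :: nat where N: "real N \<ge> (B / \<eta>)\<^sup>2" using real_arch_simple by blast
  show ?thesis
  proof (intro exI[of _ "max 1 N"] allI impI)
    fix k and A K :: "'i set"
    assume k: "max 1 N \<le> k" and K: "finite K" and cA: "card (K \<inter> A) = k" and cB: "card (K - A) = k"
    interpret prob_space "law A" by (rule prob_space_law)
    define tr where "tr i x = (if \<bar>coord_llr A i x\<bar> \<le> (if i \<in> A then B1 else B0) then coord_llr A i x else 0)" for i x
    have trm [measurable]: "tr i \<in> borel_measurable borel" for i
      unfolding tr_def[abs_def] by measurable
    have trl [measurable]: "(\<lambda>y. tr i (y i)) \<in> borel_measurable (law A)" for i
      by (rule measurable_compose[OF measurable_law_coord trm])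
    have trb: "\<bar>tr i x\<bar> \<le> B" for i x
      using B0 B1 by (auto simp: tr_def B_def)
    have coord_llr_int: "integrable (marginal A i) (coord_llr A i)" for i
      using int by (simp add: marginal_def coord_llr_def)
    have tr_int: "integrable (marginal A i) (tr i)" for i
      by (rule Bochner_Integration.integrable_bound[OF coord_llr_int])
         (auto simp: tr_def measurable_cong_sets[OF sets_marginal refl] trm[unfolded tr_def[abs_def]])
    have rest: "(\<integral>x. \<bar>coord_llr A i x - tr i x\<bar> \<partial>marginal A i) \<le> \<eta>" for i
      using B0 B1 by (cases "i \<in> A") (simp_all add: tr_def marginal_def coord_llr_def cong: if_cong)
    define mu where "mu = (\<Sum>i\<in>K. \<integral>x. coord_llr A i x \<partial>marginal A i)"
    have mu: "mu = real k * D"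
    proof -
      have "mu = (\<Sum>i\<in>K\<inter>A. \<integral>x. coord_llr A i x \<partial>marginal A i) + (\<Sum>i\<in>K-A. \<integral>x. coord_llr A i x \<partial>marginal A i)"
        unfolding mu_def using K by (subst sum.union_disjoint[symmetric]) (auto simp: Int_Diff_Un)
      also have "(\<Sum>i\<in>K\<inter>A. \<integral>x. coord_llr A i x \<partial>marginal A i) = (\<Sum>i\<in>K\<inter>A. \<integral>x. log_lr Q0 Q1 x \<partial>Q1)"
        by (rule sum.cong) (auto simp: coord_llr_def marginal_def)
      also have "(\<Sum>i\<in>K-A. \<integral>x. coord_llr A i x \<partial>marginal A i) = (\<Sum>i\<in>K-A. \<integral>x. log_lr Q1 Q0 x \<partial>Q0)"
        by (rule sum.cong) (auto simp: coord_llr_def marginal_def)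
      finally show ?thesis by (simp add: cA cB D algebra_simps)
    qed
    have cK: "card K = 2 * k"
      using cA cB K by (metis Int_Diff_Un Int_Diff_disjoint card_Un_disjoint finite_Diff finite_Int mult_2)
    let ?m = "\<lambda>i. \<integral>x. tr i x \<partial>marginal A i"
    have dev: "(\<integral>y. \<bar>\<Sum>i\<in>K. tr i (y i) - ?m i\<bar> \<partial>law A) \<le> real (2 * k) * \<eta>"
    proof -
      have "(\<integral>y. \<bar>\<Sum>i\<in>K. tr i (y i) - (\<integral>z. tr i (z i) \<partial>law A)\<bar> \<partial>law A)
         \<le> sqrt (\<Sum>i\<in>K. \<integral>y. (tr i (y i))\<^sup>2 \<partial>law A)"
      proof (rule abs_deviation_le[where K="\<lambda>i. {i}"])
        show "(\<lambda>y. tr i (y i)) \<in> borel_measurable (coord_algebra {i})" for i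
          by (rule measurable_compose[OF measurable_coord_algebra trm]) simp
      qed (use K trb in \<open>auto simp: disjoint_family_on_def\<close>)
      also have "\<dots> \<le> sqrt (\<Sum>i\<in>K. B\<^sup>2)"
      proof (intro real_sqrt_le_mono sum_mono)
        fix i
        have sq: "(tr i x)\<^sup>2 \<le> B\<^sup>2" for x
          using power_mono[OF trb[of i x], of 2] by simp
        have "(\<integral>y. (tr i (y i))\<^sup>2 \<partial>law A) \<le> (\<integral>y. B\<^sup>2 \<partial>law A)"
          by (rule integral_mono[OF integrable_const_bound[where B="B\<^sup>2"]]) (use sq in auto)
        thus "(\<integral>y. (tr i (y i))\<^sup>2 \<partial>law A) \<le> B\<^sup>2" by (simp add: prob_space)
      qed
      also have "\<dots> = sqrt (real (2 * k)) * B"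
        using B0(1) by (simp add: cK real_sqrt_mult B_def)
      also have "\<dots> \<le> sqrt (real (2 * k)) * (sqrt (real (2 * k)) * \<eta>)"
      proof (intro mult_left_mono)
        have "(B / \<eta>)\<^sup>2 \<le> real (2 * k)" using N k by linarith
        hence "B / \<eta> \<le> sqrt (real (2 * k))" by (rule real_le_rsqrt)
        thus "B \<le> sqrt (real (2 * k)) * \<eta>" using \<eta> by (simp add: field_simps)
      qed simp
      also have "\<dots> = real (2 * k) * \<eta>" by simp
      finally show ?thesis by (simp add: integral_law_coord)
    qed
    define R where "R y = (\<Sum>i\<in>K. \<bar>coord_llr A i (y i) - tr i (y i)\<bar>)" for y
    have ri: "integrable (marginal A i) (\<lambda>x. \<bar>coord_llr A i x - tr i x\<bar>)" for i
      using coord_llr_int tr_int by auto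
    have Ri: "integrable (law A) R"
      unfolding R_def[abs_def] using ri
      by (intro Bochner_Integration.integrable_sum integrable_law_coord[THEN iffD2, of "\<lambda>x. \<bar>coord_llr A _ x - tr _ x\<bar>"]) auto
    have R: "(\<integral>y. R y \<partial>law A) \<le> real (2 * k) * \<eta>"
    proof -
      have "(\<integral>y. R y \<partial>law A) = (\<Sum>i\<in>K. \<integral>x. \<bar>coord_llr A i x - tr i x\<bar> \<partial>marginal A i)"
        unfolding R_def using ri integrable_law_coord[of "\<lambda>x. \<bar>coord_llr A _ x - tr _ x\<bar>" A]
        by (subst Bochner_Integration.integral_sum) (auto simp: integral_law_coord[of "\<lambda>x. \<bar>coord_llr A _ x - tr _ x\<bar>"])
      also have "\<dots> \<le> (\<Sum>i\<in>K. \<eta>)" by (rule sum_mono) (rule rest)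
      finally show ?thesis by (simp add: cK)
    qed
    have mdiff: "(\<Sum>i\<in>K. ?m i) - mu \<le> real (2 * k) * \<eta>"
    proof -
      have "?m i - (\<integral>x. coord_llr A i x \<partial>marginal A i) \<le> \<eta>" for i
      proof -
        have "?m i - (\<integral>x. coord_llr A i x \<partial>marginal A i) = (\<integral>x. tr i x - coord_llr A i x \<partial>marginal A i)"
          using tr_int coord_llr_int by simp
        also have "\<dots> \<le> (\<integral>x. \<bar>coord_llr A i x - tr i x\<bar> \<partial>marginal A i)"
          by (rule integral_mono) (use tr_int coord_llr_int in auto)
        finally show ?thesis using rest[of i] by linarith
      qed
      hence "(\<Sum>i\<in>K. ?m i - (\<integral>x. coord_llr A i x \<partial>marginal A i)) \<le> (\<Sum>i\<in>K. \<eta>)" by (intro sum_mono)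
      thus ?thesis by (simp add: mu_def sum_subtractf cK)
    qed
    define U where "U y = \<bar>\<Sum>i\<in>K. tr i (y i) - ?m i\<bar> + R y" for y
    have Ui: "integrable (law A) U"
    proof -
      have "integrable (law A) (\<lambda>y. tr i (y i))" for i
        using tr_int by (subst integrable_law_coord) auto
      thus ?thesis unfolding U_def[abs_def] using Ri by auto
    qed
    have U: "(\<integral>y. U y \<partial>law A) \<le> real (4 * k) * \<eta>"
    proof -
      have "integrable (law A) (\<lambda>y. tr i (y i))" for i
        using tr_int by (subst integrable_law_coord) auto
      hence "(\<integral>y. U y \<partial>law A) = (\<integral>y. \<bar>\<Sum>i\<in>K. tr i (y i) - ?m i\<bar> \<partial>law A) + (\<integral>y. R y \<partial>law A)"
        unfolding U_def using Ri by (intro Bochner_Integration.integral_add) auto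
      thus ?thesis using dev R by (simp add: algebra_simps)
    qed
    have U0: "0 \<le> U y" for y
      unfolding U_def R_def by (intro add_nonneg_nonneg sum_nonneg) auto
    have LU: "LLR A K y \<le> U y + real (2 * k) * \<eta> + real k * D" for y
    proof -
      have "LLR A K y = (\<Sum>i\<in>K. tr i (y i) - ?m i) + (\<Sum>i\<in>K. coord_llr A i (y i) - tr i (y i)) + (\<Sum>i\<in>K. ?m i)"
        by (simp add: LLR_def sum_subtractf)
      also have "(\<Sum>i\<in>K. coord_llr A i (y i) - tr i (y i)) \<le> R y"
        unfolding R_def by (rule sum_mono) simp
      finally show ?thesis unfolding U_def using mdiff mu by linarith
    qed
    let ?d = "real k * d / 2"
    have "0 < d" using assms by simp
    show "measure (law A) {y. real k * (D + d) < LLR A K y} \<le> e"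
    proof (cases "e > 1")
      case True
      thus ?thesis using prob_le_1 by (meson order_trans less_imp_le)
    next
      case False
      have k0: "real k > 0" using k by simp
      have sub: "{y. real k * (D + d) < LLR A K y} \<subseteq> {y \<in> space (law A). ?d \<le> U y}"
      proof clarsimp
        fix y assume "real k * (D + d) < LLR A K y"
        with LU[of y] have "real k * d < U y + real (2 * k) * \<eta>" by (simp add: algebra_simps)
        moreover have "real (2 * k) * \<eta> \<le> real k * d / 2"
        proof -
          have "real (2 * k) * \<eta> = (real k * d / 4) * e" by (simp add: \<eta>_def)
          also have "\<dots> \<le> (real k * d / 4) * 1"
            using False \<open>0 < d\<close> by (intro mult_left_mono) auto
          also have "\<dots> \<le> real k * d / 2" using \<open>0 < d\<close> k0 by simp
          finally show ?thesis .
        qed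
        ultimately show "real k * d \<le> U y * 2" by linarith
      qed
      have "measure (law A) {y. real k * (D + d) < LLR A K y} \<le> measure (law A) {y \<in> space (law A). ?d \<le> U y}"
        by (rule finite_measure_mono[OF sub]) (use Ui in measurable)
      also have "\<dots> \<le> (\<integral>y. U y \<partial>law A) / ?d"
        by (rule integral_Markov_inequality_measure[where A="{}"])
           (use Ui \<open>0 < d\<close> k0 U0 in auto)
      also have "\<dots> \<le> (real (4 * k) * \<eta>) / ?d" using U \<open>0 < d\<close> k0 by (intro divide_right_mono) auto
      also have "\<dots> = e" using \<open>0 < d\<close> k0 by (simp add: \<eta>_def field_simps)
      finally show ?thesis .
    qed
  qed
qed

end

section \<open>Space-time geometry of the line and decisions up to a time\<close>

text \<open>The space-time points that are reached when the source is \<open>v\<close>; the law of the observations is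
  \<open>law (cascade v)\<close>.\<close>

definition cascade :: "int \<Rightarrow> (nat \<times> int) set" where
  "cascade v = {(s, w). \<bar>w - v\<bar> \<le> int s}"

definition horizon :: "nat \<Rightarrow> (nat \<times> int) set" where
  "horizon t = {(s, w). s \<le> t}"

abbreviation light_cone :: "int \<Rightarrow> nat \<Rightarrow> (nat \<times> int) set" where
  "light_cone v t \<equiv> cascade v \<inter> horizon t"

text \<open>The points up to time \<open>t\<close> at which the sources \<open>v\<close> and \<open>u\<close> prescribe different laws. The statistic
  \<open>Z_stat\<close> is the log-likelihood ratio of this set (\<open>Z_stat_eq\<close>).\<close>

definition differ :: "int \<Rightarrow> int \<Rightarrow> nat \<Rightarrow> (nat \<times> int) set" where
  "differ v u t = sym_diff (cascade v) (cascade u) \<inter> horizon t"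

lemma nbhd_line: "nbhd line_graph v s = {v - int s..v + int s}"
  by (auto simp: nbhd_def gdist_line_graph)

lemma cascade_nbhd: "cascade v = {(s, w). w \<in> nbhd line_graph v s}"
  by (auto simp: cascade_def nbhd_line)

text \<open>On the line \<open>f_nbhd\<close> depends only on the distance \<open>j\<close> of the two vertices.\<close>

definition f_line :: "nat \<Rightarrow> nat \<Rightarrow> nat" where
  "f_line j t = (\<Sum>s\<le>t. min j (2 * s + 1))"

lemma card_interval_diff:
  "card ({v - int s..v + int s} - {u - int s..u + int s}) = min (nat \<bar>u - v\<bar>) (2 * s + 1)"
proof -
  have *: "{v - int s..v + int s} - {u - int s..u + int s} =
    (if v \<le> u then {v - int s..<min (u - int s) (v + int s + 1)}
     else {max (u + int s) (v - int s - 1)<..v + int s})"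
    by (auto simp: min_def max_def)
  show ?thesis unfolding * by (cases "v \<le> u") (auto simp: min_def max_def nat_add_distrib nat_mult_distrib)
qed

lemma light_cone_Sigma: "light_cone v t = (SIGMA s:{..t}. {v - int s..v + int s})"
  by (auto simp: cascade_def horizon_def)

lemma finite_light_cone [simp]: "finite (light_cone v t)"
  unfolding light_cone_Sigma by auto

lemma card_light_cone: "card (light_cone v t) = (t + 1)\<^sup>2"
proof -
  have "card (light_cone v t) = (\<Sum>s\<le>t. 2 * s + 1)"
    unfolding light_cone_Sigma by (simp add: nat_add_distrib nat_mult_distrib)
  also have "\<dots> = (t + 1)\<^sup>2" by (induction t) (auto simp: power2_eq_square)
  finally show ?thesis .
qed

lemma differ_Int_cascade: "differ v u t \<inter> cascade v = (SIGMA s:{..t}. {v - int s..v + int s} - {u - int s..u + int s})"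
  and differ_minus_cascade: "differ v u t - cascade v = (SIGMA s:{..t}. {u - int s..u + int s} - {v - int s..v + int s})"
  by (auto simp: differ_def cascade_def horizon_def)

lemma finite_differ [simp]: "finite (differ v u t)"
proof -
  have "differ v u t \<subseteq> light_cone v t \<union> light_cone u t" by (auto simp: differ_def)
  thus ?thesis by (rule finite_subset) simp
qed

lemma card_differ_Int: "card (differ v u t \<inter> cascade v) = f_line (nat \<bar>u - v\<bar>) t"
  unfolding differ_Int_cascade f_line_def by (simp add: card_interval_diff)

lemma card_differ_minus: "card (differ v u t - cascade v) = f_line (nat \<bar>u - v\<bar>) t"
  unfolding differ_minus_cascade f_line_def by (simp add: card_interval_diff abs_minus_commute)

lemma f_nbhd_line: "f_nbhd line_graph v u t = f_line (nat \<bar>u - v\<bar>) t"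
  unfolding f_nbhd_def f_line_def nbhd_line card_interval_diff ..

lemma f_line_mono: "i \<le> j \<Longrightarrow> s \<le> t \<Longrightarrow> f_line i s \<le> f_line j t"
  unfolding f_line_def
  by (rule order_trans[OF sum_mono sum_mono2]) (auto simp: min_le_iff_disj)

lemma f_line_ge: "1 \<le> j \<Longrightarrow> t + 1 \<le> f_line j t"
proof -
  assume "1 \<le> j"
  hence "(\<Sum>s\<le>t. 1) \<le> f_line j t" unfolding f_line_def by (intro sum_mono) auto
  thus ?thesis by simp
qed

lemma f_line_le: "f_line j t \<le> j * (t + 1)" "f_line j t \<le> (t + 1)\<^sup>2"
proof -
  have "f_line j t \<le> (\<Sum>s\<le>t. j)" unfolding f_line_def by (rule sum_mono) simp
  thus "f_line j t \<le> j * (t + 1)" by (simp add: mult.commute)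
  have "f_line j t \<le> (\<Sum>s\<le>t. 2 * s + 1)" unfolding f_line_def by (rule sum_mono) simp
  also have "\<dots> = (t + 1)\<^sup>2" by (induction t) (auto simp: power2_eq_square)
  finally show "f_line j t \<le> (t + 1)\<^sup>2" .
qed

text \<open>Up to time \<open>t\<close> the neighbourhoods of vertices at distance more than \<open>2 t\<close> do not meet.\<close>

lemma f_line_big: "2 * t + 1 \<le> j \<Longrightarrow> f_line j t = (t + 1)\<^sup>2"
proof -
  assume "2 * t + 1 \<le> j"
  hence "f_line j t = (\<Sum>s\<le>t. 2 * s + 1)" unfolding f_line_def by (intro sum.cong) auto
  also have "\<dots> = (t + 1)\<^sup>2" by (induction t) (auto simp: power2_eq_square)
  finally show ?thesis .
qed

lemma differ_flip: "sym_diff (cascade v) (differ v u t) \<inter> horizon t = cascade u \<inter> horizon t"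
  by (auto simp: differ_def)

lemma coord_events_horizon_mono: "s \<le> t \<Longrightarrow> coord_events (horizon s) \<subseteq> coord_events (horizon t)"
  by (rule coord_events_mono) (auto simp: horizon_def)

lemma sets_obs_filtration: "sets (obs_filtration (enat t)) = coord_events (horizon t :: (nat \<times> int) set)"
proof -
  have "{(\<lambda>y. y (s, w)) -` B | s w B. enat s \<le> enat t \<and> B \<in> sets borel}
      = {(\<lambda>y. y i) -` B | i B. i \<in> horizon t \<and> B \<in> sets (borel :: real measure)}"
    by (auto simp: horizon_def) 
  thus ?thesis by (simp add: obs_filtration_def coord_events_def)
qed

lemma space_obs_filtration [simp]: "space (obs_filtration t) = UNIV"
  by (simp add: obs_filtration_def space_measure_of_conv)

text \<open>The event that the estimator has stopped by time \<open>t\<close> and its output lies in \<open>W\<close>. In contrast to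
  \<open>output_event\<close> it is determined by the observations up to time \<open>t\<close>, and it can be transported
  from one source to another.\<close>

definition decided :: "int seq_est \<Rightarrow> nat \<Rightarrow> int set \<Rightarrow> int obs set" where
  "decided p t W = {y. snd p y \<le> enat t \<and> fst p (the_enat (snd p y)) y \<in> W}"

lemma stopped_event:
  assumes "seq_estimator V p"
  shows "{y. snd p y \<le> enat t} \<in> coord_events (horizon t)"
proof -
  obtain D T where p: "p = (D, T)" by force
  have "Measurable.pred (obs_filtration (enat t)) (\<lambda>y. T y \<le> enat t)"
    using assms by (simp add: p seq_estimator_def stopping_time_def)
  thus ?thesis by (simp add: p pred_def sets_obs_filtration)
qed

lemma stopped_at_event:
  assumes "seq_estimator V p"
  shows "{y. snd p y = enat t} \<in> coord_events (horizon t)"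
proof -
  interpret sigma_algebra UNIV "coord_events (horizon t)" by (rule sigma_algebra_coord_events)
  show ?thesis
  proof (cases t)
    case 0
    have "{y. snd p y = enat t} = {y. snd p y \<le> enat t}" by (simp add: 0 enat_0)
    thus ?thesis using stopped_event[OF assms] by simp
  next
    case (Suc t')
    have "{y. snd p y = enat t} = {y. snd p y \<le> enat t} - {y. snd p y \<le> enat t'}"
    proof -
      have "x = enat (Suc t') \<longleftrightarrow> x \<le> enat (Suc t') \<and> \<not> x \<le> enat t'" for x
        by (cases x) auto
      thus ?thesis by (auto simp: Suc)
    qed
    moreover have "{y. snd p y \<le> enat t'} \<in> coord_events (horizon t)"
      using stopped_event[OF assms, of t'] coord_events_horizon_mono[of t' t] Suc by auto
    ultimately show ?thesis using stopped_event[OF assms, of t] by auto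
  qed
qed

lemma decided_at_event:
  assumes "seq_estimator V p"
  shows "{y. snd p y = enat t \<and> fst p t y \<in> W} \<in> coord_events (horizon t)"
proof -
  interpret sigma_algebra UNIV "coord_events (horizon t)" by (rule sigma_algebra_coord_events)
  obtain D T where p: "p = (D, T)" by force
  have m: "D t \<in> measurable (obs_filtration (enat t)) (count_space V)"
    using assms by (simp add: p seq_estimator_def)
  have "D t -` (W \<inter> V) \<inter> space (obs_filtration (enat t)) \<in> sets (obs_filtration (enat t))"
    by (rule measurable_sets[OF m]) simp
  moreover have "D t -` (W \<inter> V) \<inter> space (obs_filtration (enat t)) = {y. fst p t y \<in> W}"
    using measurable_space[OF m] by (auto simp: p)
  ultimately have "{y. fst p t y \<in> W} \<in> coord_events (horizon t)" by (simp add: sets_obs_filtration)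
  moreover have "{y. snd p y = enat t \<and> fst p t y \<in> W} = {y. snd p y = enat t} \<inter> {y. fst p t y \<in> W}" by auto
  ultimately show ?thesis using stopped_at_event[OF assms, of t] by auto
qed

lemma decided_Un: "decided p t W = (\<Union>s\<le>t. {y. snd p y = enat s \<and> fst p s y \<in> W})"
proof -
  have "(x \<le> enat t) = (\<exists>s\<le>t. x = enat s)" for x by (cases x) auto
  thus ?thesis unfolding decided_def by auto
qed

lemma decided_event:
  assumes "seq_estimator V p"
  shows "decided p t W \<in> coord_events (horizon t)"
proof -
  interpret sigma_algebra UNIV "coord_events (horizon t)" by (rule sigma_algebra_coord_events)
  have "{y. snd p y = enat s \<and> fst p s y \<in> W} \<in> coord_events (horizon t)" if "s \<le> t" for s
    using decided_at_event[OF assms, of s W] coord_events_horizon_mono[of s t] that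
    by blast
  thus ?thesis unfolding decided_Un by auto
qed

lemma decision_in:
  assumes "seq_estimator V p"
  shows "fst p t y \<in> V"
proof -
  obtain D T where p: "p = (D, T)" by force
  have "D t \<in> measurable (obs_filtration (enat t)) (count_space V)"
    using assms by (simp add: p seq_estimator_def)
  from measurable_space[OF this, of y] show ?thesis by (simp add: p)
qed

lemma decided_space: "seq_estimator V p \<Longrightarrow> decided p t V = {y. snd p y \<le> enat t}"
  by (auto simp: decided_def decision_in)

context mutual_ac_laws
begin

lemma source_law_eq: "source_law line_graph Q0 Q1 v = law (cascade v)"
proof -
  have "(\<lambda>(t, u). if u \<in> nbhd line_graph v t then Q1 else Q0) = marginal (cascade v)"
    by (rule ext) (auto simp: marginal_def cascade_nbhd)
  thus ?thesis unfolding source_law_def law_def by simp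
qed

lemma Z_stat_eq: "Z_stat line_graph Q0 Q1 v u t y = LLR (cascade v) (differ v u t) y"
proof -
  have "LLR (cascade v) (differ v u t) y = LLR (cascade v) (differ v u t \<inter> cascade v) y + LLR (cascade v) (differ v u t - cascade v) y"
    by (subst LLR_union[symmetric]) (auto simp: Int_Diff_Un)
  moreover have "LLR (cascade v) (differ v u t \<inter> cascade v) y = (\<Sum>(s, w)\<in>differ v u t \<inter> cascade v. log_lr Q0 Q1 (y (s, w)))"
    unfolding LLR_def by (rule sum.cong) (auto simp: coord_llr_def)
  moreover have "LLR (cascade v) (differ v u t - cascade v) y = (\<Sum>(s, w)\<in>differ v u t - cascade v. log_lr Q1 Q0 (y (s, w)))"
    unfolding LLR_def by (rule sum.cong) (auto simp: coord_llr_def)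
  ultimately show ?thesis
    unfolding Z_stat_def nbhd_line differ_Int_cascade differ_minus_cascade sum.distrib
    by (simp add: sum.Sigma)
qed

lemma prob_differ_flip:
  assumes "E \<in> coord_events (horizon t)"
  shows "measure (law (cascade u)) E = measure (law (sym_diff (cascade v) (differ v u t))) E"
  by (rule prob_agree[OF assms]) (simp add: differ_flip)

lemma output_event_sets:
  fixes p :: "int seq_est"
  assumes "seq_estimator V p"
  shows "output_event p u \<in> sets (law A)"
proof -
  have "output_event p u = (\<Union>t. {y. snd p y = enat t \<and> fst p t y \<in> {u}})"
  proof -
    have "x \<noteq> \<infinity> \<longleftrightarrow> (\<exists>t. x = enat t)" for x by (cases x) auto
    thus ?thesis by (auto simp: output_event_def split: prod.splits)
  qed
  moreover have "{y. snd p y = enat t \<and> fst p t y \<in> {u}} \<in> sets (law A)" for t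
    using decided_at_event[OF assms] coord_events_subset_law by blast
  ultimately show ?thesis by auto
qed

lemma decided_sets: "seq_estimator V p \<Longrightarrow> decided p t W \<in> sets (law A)"
  using decided_event coord_events_subset_law by blast

text \<open>A set of outputs that are all errors has small probability, in proportion to its size; for
  all of \<open>V\<close> this gives at most \<open>\<alpha>\<close>.\<close>

lemma prob_decided_far:
  assumes p: "p \<in> Delta_class line_graph Q0 Q1 V R \<alpha>" and V: "finite V" and v: "v \<in> V"
    and W: "W \<subseteq> V" "\<And>w. w \<in> W \<Longrightarrow> \<bar>w - v\<bar> > int R"
  shows "measure (law (cascade v)) (decided p t W) \<le> real (card W) * (\<alpha> / real (card V))"
proof -
  interpret prob_space "law (cascade v)" by (rule prob_space_law)
  have p1: "seq_estimator V p" using p by (simp add: Delta_class_def)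
  have fW: "finite W" using W V finite_subset by blast
  have "measure (law (cascade v)) (decided p t W) \<le> measure (law (cascade v)) (\<Union>w\<in>W. output_event p w)"
  proof (rule finite_measure_mono)
    show "decided p t W \<subseteq> (\<Union>w\<in>W. output_event p w)"
    proof
      fix y assume y: "y \<in> decided p t W"
      then obtain k where "snd p y = enat k" by (cases "snd p y") (auto simp: decided_def)
      thus "y \<in> (\<Union>w\<in>W. output_event p w)"
        using y by (auto simp: decided_def output_event_def split: prod.splits)
    qed
    show "(\<Union>w\<in>W. output_event p w) \<in> sets (law (cascade v))"
      using output_event_sets[OF p1] fW by auto
  qed
  also have "\<dots> \<le> (\<Sum>w\<in>W. measure (law (cascade v)) (output_event p w))"
    by (rule finite_measure_subadditive_finite) (use output_event_sets[OF p1] fW in auto)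
  also have "\<dots> \<le> (\<Sum>w\<in>W. \<alpha> / real (card V))"
  proof (rule sum_mono)
    fix w assume "w \<in> W"
    hence "w \<in> V" "gdist line_graph w v > R" using W(1) W(2)[of w] by (auto simp: gdist_line_graph)
    thus "measure (law (cascade v)) (output_event p w) \<le> \<alpha> / real (card V)"
      using p v by (auto simp: Delta_class_def source_law_eq)
  qed
  finally show ?thesis by simp
qed

text \<open>An output \<open>w\<close> within distance \<open>R\<close> of \<open>v\<close> and on its right is an error for the source \<open>v - R - 1\<close>,
  and one on its left is an error for \<open>v + R + 1\<close>. An alternative that is an error for all outputs
  near \<open>v\<close> at once would have to be at distance \<open>2 R + 1\<close>, and the bound would be worse by a factor
  that approaches two.\<close>

lemma prob_stopped_le:
  assumes p: "p \<in> Delta_class line_graph Q0 Q1 V R \<alpha>" and V: "finite V" and \<alpha>: "0 \<le> \<alpha>"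
    and v: "v \<in> V" "v - int R - 1 \<in> V" "v + int R + 1 \<in> V"
  shows "measure (law (cascade v)) {y. snd p y \<le> enat t} \<le>
     \<alpha> + 2 * (exp x * (real (R + 1) * (\<alpha> / real (card V))))
      + measure (law (cascade v)) {y. x < LLR (cascade v) (differ v (v - int R - 1) t) y}
      + measure (law (cascade v)) {y. x < LLR (cascade v) (differ v (v + int R + 1) t) y}"
proof -
  interpret prob_space "law (cascade v)" by (rule prob_space_law)
  have p1: "seq_estimator V p" using p by (simp add: Delta_class_def)
  define c where "c = exp x * (real (R + 1) * (\<alpha> / real (card V)))"
  (* errors; correct outputs on the right of v, including v itself; correct outputs on the left *)
  define W0 where "W0 = {w\<in>V. \<bar>w - v\<bar> > int R}"
  define W1 where "W1 = {w\<in>V. v \<le> w \<and> w \<le> v + int R}"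
  define W2 where "W2 = {w\<in>V. v - int R \<le> w \<and> w < v}"
  have \<alpha>V: "0 \<le> \<alpha> / real (card V)" using \<alpha> by simp
  have near: "measure (law (cascade v)) (decided p t W)
     \<le> c + measure (law (cascade v)) {y. x < LLR (cascade v) (differ v u t) y}"
    if u: "u \<in> V" and W: "W \<subseteq> V" "\<And>w. w \<in> W \<Longrightarrow> \<bar>w - u\<bar> > int R" "W \<subseteq> {a..a + int R}" for W u a
  proof -
    have "measure (law (cascade u)) (decided p t W) \<le> real (card W) * (\<alpha> / real (card V))"
      by (rule prob_decided_far[OF p V u]) (use W in auto)
    also have "\<dots> \<le> real (R + 1) * (\<alpha> / real (card V))"
      using card_mono[OF _ W(3)] \<alpha>V by (intro mult_right_mono) auto
    finally have "exp x * measure (law (cascade u)) (decided p t W) \<le> c"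
      unfolding c_def by (rule mult_left_mono) simp
    moreover have "measure (law (cascade v)) (decided p t W)
      \<le> exp x * measure (law (sym_diff (cascade v) (differ v u t))) (decided p t W) + measure (law (cascade v)) {y. x < LLR (cascade v) (differ v u t) y}"
      by (rule prob_flip_ge) (use decided_sets[OF p1] in auto)
    ultimately show ?thesis
      by (simp add: prob_differ_flip[OF decided_event[OF p1], of u t W v])
  qed
  have "{y. snd p y \<le> enat t} = decided p t W0 \<union> (decided p t W1 \<union> decided p t W2)"
    unfolding decided_space[OF p1, symmetric] by (auto simp: decided_def W0_def W1_def W2_def)
  hence "measure (law (cascade v)) {y. snd p y \<le> enat t} \<le> measure (law (cascade v)) (decided p t W0)
     + (measure (law (cascade v)) (decided p t W1) + measure (law (cascade v)) (decided p t W2))"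
    using measure_Un_le[of "decided p t W0" "law (cascade v)" "decided p t W1 \<union> decided p t W2"]
      measure_Un_le[of "decided p t W1" "law (cascade v)" "decided p t W2"] decided_sets[OF p1] by fastforce
  moreover have "measure (law (cascade v)) (decided p t W0) \<le> \<alpha>"
  proof -
    have "measure (law (cascade v)) (decided p t W0) \<le> real (card W0) * (\<alpha> / real (card V))"
      by (rule prob_decided_far[OF p V v(1)]) (auto simp: W0_def)
    also have "\<dots> \<le> real (card V) * (\<alpha> / real (card V))"
      using card_mono[OF V, of W0] \<alpha>V by (intro mult_right_mono) (auto simp: W0_def)
    also have "\<dots> \<le> \<alpha>" using \<alpha> by simp
    finally show ?thesis .
  qed
  moreover have "measure (law (cascade v)) (decided p t W1) \<le> c
      + measure (law (cascade v)) {y. x < LLR (cascade v) (differ v (v - int R - 1) t) y}"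
    by (rule near[OF v(2), of W1 v]) (auto simp: W1_def)
  moreover have "measure (law (cascade v)) (decided p t W2) \<le> c
      + measure (law (cascade v)) {y. x < LLR (cascade v) (differ v (v + int R + 1) t) y}"
    by (rule near[OF v(3), of W2 "v - int R"]) (auto simp: W2_def)
  ultimately show ?thesis unfolding c_def[symmetric] by linarith
qed

end

section \<open>Lower bounds on the optimal delay\<close>

lemma closest_vertices_line:
  assumes "closest_vertices line_graph v0 n S" "2 * nat \<bar>w - v0\<bar> < n"
  shows "w \<in> S"
proof (rule ccontr)
  assume w: "w \<notin> S"
  have S: "finite S" "card S = n" using assms(1) by (auto simp: closest_vertices_def)
  let ?d = "\<bar>w - v0\<bar>"
  have "S \<subseteq> {v0 - ?d..v0 + ?d} - {w}"
  proof
    fix u assume u: "u \<in> S"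
    hence "nat \<bar>v0 - u\<bar> \<le> nat \<bar>v0 - w\<bar>"
      using assms(1) w by (auto simp: closest_vertices_def gdist_line_graph)
    thus "u \<in> {v0 - ?d..v0 + ?d} - {w}" using u w by auto
  qed
  hence "card S \<le> card ({v0 - ?d..v0 + ?d} - {w})" by (intro card_mono) auto
  also have "\<dots> = nat (2 * ?d)" by (subst card_Diff_singleton) auto
  finally have "n \<le> nat (2 * ?d)" using S by simp
  moreover have "nat (2 * ?d) = 2 * nat ?d" by (simp add: nat_mult_distrib)
  ultimately show False using assms(2) by linarith
qed

lemma light_cone_disjoint: "\<bar>v - u\<bar> > 2 * int t \<Longrightarrow> light_cone v t \<inter> light_cone u t = {}"
  by (auto simp: cascade_def horizon_def)

context mutual_ac_laws
begin

text \<open>By \<open>prob_LLR_cong\<close> the tail is the same for every source and both sides (\<open>near_tail_eq\<close>), so the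
  source \<open>0\<close> and its neighbour on the right represent all pairs at distance \<open>j\<close>.\<close>

definition near_tail :: "nat \<Rightarrow> nat \<Rightarrow> real \<Rightarrow> real" where
  "near_tail j t x = measure (law (cascade 0)) {y. x < LLR (cascade 0) (differ 0 (int j) t) y}"

text \<open>The tail of the log-likelihood ratio of the source against the absence of a source. It
  enters for distant competitors, of which there are too many to be treated one by one.\<close>

definition far_tail :: "nat \<Rightarrow> real \<Rightarrow> real" where
  "far_tail t x = measure (law (cascade 0)) {y. x < LLR (cascade 0) (light_cone 0 t) y}"

lemma near_tail_eq: "measure (law (cascade v)) {y. x < LLR (cascade v) (differ v u t) y} = near_tail (nat \<bar>u - v\<bar>) t x"
  using prob_LLR_cong[of "differ v u t" "differ 0 (int (nat \<bar>u - v\<bar>)) t" "cascade v" "cascade 0" "{x<..}"]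
  by (simp add: near_tail_def card_differ_Int card_differ_minus)

lemma far_tail_eq: "measure (law (cascade v)) {y. x < LLR (cascade v) (light_cone v t) y} = far_tail t x"
proof -
  have *: "light_cone u t \<inter> cascade u = light_cone u t" "light_cone u t - cascade u = {}" for u by auto
  show ?thesis
    using prob_LLR_cong[of "light_cone v t" "light_cone 0 t" "cascade v" "cascade 0" "{x<..}"]
    by (simp add: far_tail_def * card_light_cone)
qed

text \<open>The reference measure \<open>law {}\<close> has no source. Under it the likelihood ratios of the separated
  sources in \<open>I\<close> are independent with mean at most \<open>1\<close>. Truncated at \<open>exp h\<close> they have second
  moments at most \<open>exp h\<close>, so their sum deviates from its mean by \<open>sqrt (card I * exp h)\<close>, and an
  event that is unlikely without a source remains unlikely on average over \<open>I\<close>. The truncation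
  costs \<open>far_tail t h\<close>.\<close>

lemma mixture_bound:
  assumes p: "p \<in> Delta_class line_graph Q0 Q1 V R \<alpha>" and V: "finite V" and \<alpha>: "0 \<le> \<alpha>"
    and I: "I \<subseteq> V" "\<And>v u. v \<in> I \<Longrightarrow> u \<in> I \<Longrightarrow> v \<noteq> u \<Longrightarrow> \<bar>v - u\<bar> > 2 * int t"
    and W: "\<And>v w. v \<in> I \<Longrightarrow> w \<in> V - W \<Longrightarrow> \<bar>w - v\<bar> > int R"
    and half: "measure (law {}) (decided p t W) \<le> 1 / 2"
  shows "(\<Sum>v\<in>I. measure (law (cascade v)) {y. snd p y \<le> enat t})
     \<le> real (card I) * (\<alpha> + 1 / 2 + far_tail t h) + sqrt (real (card I) * exp h)"
proof -
  interpret N: prob_space "law ({} :: (nat \<times> int) set)" by (rule prob_space_law)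
  have p1: "seq_estimator V p" using p by (simp add: Delta_class_def)
  have fI: "finite I" by (rule finite_subset[OF I(1) V])
  let ?E = "decided p t W"
  let ?N = "law ({} :: (nat \<times> int) set)"
  define L where "L v y = - LLR {} (light_cone v t) y" for v y
  define X where "X v y = (if L v y \<le> h then exp (L v y) else 0)" for v y
  have E [measurable]: "?E \<in> sets (law A)" for A by (rule decided_sets[OF p1])
  have Lm: "L v \<in> borel_measurable (coord_algebra (light_cone v t))" for v
    unfolding L_def[abs_def] using measurable_LLR[OF order_refl] by measurable
  have Xm: "X v \<in> borel_measurable (coord_algebra (light_cone v t))" for v
    unfolding X_def[abs_def] using Lm by measurable
  have LM [measurable]: "L v \<in> borel_measurable (law A)" for v A
    by (rule measurable_coord_algebra_law[OF Lm])
  have XM [measurable]: "X v \<in> borel_measurable (law A)" for v A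
    by (rule measurable_coord_algebra_law[OF Xm])
  have X0: "0 \<le> X v y" and Xh: "X v y \<le> exp h" and Xe: "X v y \<le> exp (L v y)" for v y
    by (auto simp: X_def)
  have Xi: "integrable ?N (X v)" for v
    by (rule N.integrable_const_bound[of _ "exp h"]) (use X0 Xh in auto)
  have X1: "(\<integral>y. X v y \<partial>?N) \<le> 1" for v
  proof -
    have "ennreal (\<integral>y. X v y \<partial>?N) = (\<integral>\<^sup>+y. ennreal (X v y) \<partial>?N)"
      using Xi X0 by (intro nn_integral_eq_integral[symmetric]) auto
    also have "\<dots> \<le> (\<integral>\<^sup>+y. ennreal (exp (- LLR {} (light_cone v t) y)) \<partial>?N)"
      using Xe by (intro nn_integral_mono) (auto simp: L_def)
    also have "\<dots> = 1" by (rule nn_integral_exp_LLR) simp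
    finally show ?thesis by simp
  qed
  have X2: "(\<integral>y. (X v y)\<^sup>2 \<partial>?N) \<le> exp h" for v
  proof -
    have "(\<integral>y. (X v y)\<^sup>2 \<partial>?N) \<le> (\<integral>y. exp h * X v y \<partial>?N)"
    proof (rule integral_mono)
      show "(X v y)\<^sup>2 \<le> exp h * X v y" for y
        unfolding power2_eq_square using X0 Xh by (intro mult_right_mono)
      show "integrable ?N (\<lambda>y. (X v y)\<^sup>2)"
      proof (rule N.integrable_const_bound[of _ "exp h * exp h"])
        show "AE y in ?N. norm ((X v y)\<^sup>2) \<le> exp h * exp h"
          using X0 Xh by (intro AE_I2) (simp add: power2_eq_square mult_mono)
      qed measurable
    qed (use Xi in auto)
    also have "\<dots> \<le> exp h * 1" using Xi X1[of v] by simp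
    finally show ?thesis by simp
  qed
  (* For one source: outputs outside W are errors, and on W the law of the source is replaced by
     the truncated likelihood ratio X v with respect to the measure without a source. *)
  have each: "measure (law (cascade v)) {y. snd p y \<le> enat t}
     \<le> \<alpha> + far_tail t h + (\<integral>y. X v y * indicator ?E y \<partial>?N)" if v: "v \<in> I" for v
  proof -
    let ?C = "law (sym_diff {} (light_cone v t))"
    interpret C: prob_space ?C by (rule prob_space_law)
    have Cc: "sym_diff {} (light_cone v t) = light_cone v t" by simp
    have cc: "light_cone v t - light_cone v t = {}" "light_cone v t \<inter> cascade v = light_cone v t" "light_cone v t - cascade v = {}" by auto
    have agree: "measure (law (cascade v)) F = measure ?C F" if "F \<in> coord_events (horizon t)" for F
      by (rule prob_agree[OF that]) auto
    have "{y. snd p y \<le> enat t} = decided p t (V - W) \<union> decided p t W"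
      using decision_in[OF p1] by (auto simp: decided_def)
    hence "measure (law (cascade v)) {y. snd p y \<le> enat t}
       \<le> measure (law (cascade v)) (decided p t (V - W)) + measure (law (cascade v)) ?E"
      using measure_Un_le[of "decided p t (V - W)" "law (cascade v)" "decided p t W"] decided_sets[OF p1] by simp
    also have "measure (law (cascade v)) (decided p t (V - W)) \<le> \<alpha>"
    proof -
      have "measure (law (cascade v)) (decided p t (V - W)) \<le> real (card (V - W)) * (\<alpha> / real (card V))"
        by (rule prob_decided_far[OF p V]) (use v I W in auto)
      also have "\<dots> \<le> real (card V) * (\<alpha> / real (card V))"
        using card_mono[OF V, of "V - W"] \<alpha> by (intro mult_right_mono) auto
      also have "\<dots> \<le> \<alpha>" using \<alpha> by simp
      finally show ?thesis .
    qed
    also have "measure (law (cascade v)) ?E \<le> far_tail t h + (\<integral>y. X v y * indicator ?E y \<partial>?N)"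
    proof -
      let ?F = "{y. L v y \<le> h}"
      have F [measurable]: "?F \<in> sets (law A)" for A
        using measurable_sets[OF LM[of v A], of "{..h}"] by (simp add: vimage_def)
      have "measure (law (cascade v)) ?E = measure ?C ?E" by (rule agree[OF decided_event[OF p1]])
      also have "\<dots> \<le> measure ?C (?E - ?F) + measure ?C (?E \<inter> ?F)"
        using measure_Un_le[of "?E - ?F" ?C "?E \<inter> ?F"] E F by (simp add: Un_Diff_Int)
      also have "measure ?C (?E - ?F) \<le> measure ?C {y. h < LLR (light_cone v t) (light_cone v t) y}"
      proof (rule C.finite_measure_mono_AE)
        have "AE y in ?C. LLR (light_cone v t) (light_cone v t) y = - LLR {} (light_cone v t) y"
          using AE_LLR_flip[where K="light_cone v t" and A="{}" and B="light_cone v t"] unfolding Cc by simp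
        thus "AE y in ?C. y \<in> ?E - ?F \<longrightarrow> y \<in> {y. h < LLR (light_cone v t) (light_cone v t) y}"
          by eventually_elim (auto simp: L_def)
        show "{y. h < LLR (light_cone v t) (light_cone v t) y} \<in> sets ?C"
          using measurable_sets[OF measurable_LLR_law, of "{h<..}" "light_cone v t" "light_cone v t"] by (simp add: vimage_def)
      qed
      also have "measure ?C {y. h < LLR (light_cone v t) (light_cone v t) y} = far_tail t h"
        unfolding Cc far_tail_eq[of v h t, symmetric]
        using prob_LLR_cong[of "light_cone v t" "light_cone v t" "light_cone v t" "cascade v" "{h<..}"]
        by (simp add: cc)
      also have "measure ?C (?E \<inter> ?F) = (\<integral>y. X v y * indicator ?E y \<partial>?N)"
      proof -
        have "ennreal (measure ?C (?E \<inter> ?F)) = (\<integral>\<^sup>+y. ennreal (exp (- LLR {} (light_cone v t) y)) * indicator (?E \<inter> ?F) y \<partial>?N)"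
          unfolding C.emeasure_eq_measure[symmetric] by (rule emeasure_law_flip) auto
        also have "\<dots> = (\<integral>\<^sup>+y. ennreal (X v y * indicator ?E y) \<partial>?N)"
          by (rule nn_integral_cong) (auto split: split_indicator simp: X_def L_def)
        also have "\<dots> = ennreal (\<integral>y. X v y * indicator ?E y \<partial>?N)"
          using Xi X0 E by (intro nn_integral_eq_integral integrable_real_mult_indicator) auto
        finally show ?thesis
          using X0 by (subst (asm) ennreal_inj) (auto intro!: integral_nonneg_AE AE_I2)
      qed
      finally show ?thesis by simp
    qed
    finally show ?thesis by simp
  qed
  have "(\<Sum>v\<in>I. measure (law (cascade v)) {y. snd p y \<le> enat t})
     \<le> (\<Sum>v\<in>I. \<alpha> + far_tail t h + (\<integral>y. X v y * indicator ?E y \<partial>?N))"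
    by (rule sum_mono) (rule each)
  also have "\<dots> = real (card I) * (\<alpha> + far_tail t h) + (\<Sum>v\<in>I. \<integral>y. X v y * indicator ?E y \<partial>?N)"
    by (simp add: sum.distrib algebra_simps)
  also have "(\<Sum>v\<in>I. \<integral>y. X v y * indicator ?E y \<partial>?N) \<le> real (card I) * (1 / 2) + sqrt (real (card I) * exp h)"
  proof -
    let ?m = "\<lambda>v. \<integral>y. X v y \<partial>?N"
    have XEi: "integrable ?N (\<lambda>y. X v y * indicator ?E y)" for v
      using Xi E by (intro integrable_real_mult_indicator)
    have Ei: "integrable ?N (indicator ?E :: _ \<Rightarrow> real)"
      using E by (intro integrable_real_indicator) (simp_all add: N.emeasure_eq_measure)
    have "(\<Sum>v\<in>I. \<integral>y. X v y * indicator ?E y \<partial>?N) = (\<integral>y. (\<Sum>v\<in>I. X v y * indicator ?E y) \<partial>?N)"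
      using XEi by (subst Bochner_Integration.integral_sum) auto
    also have "\<dots> \<le> (\<integral>y. \<bar>\<Sum>v\<in>I. X v y - ?m v\<bar> + (\<Sum>v\<in>I. ?m v) * indicator ?E y \<partial>?N)"
    proof (rule integral_mono)
      show "integrable ?N (\<lambda>y. \<Sum>v\<in>I. X v y * indicator ?E y)" using XEi by auto
      show "integrable ?N (\<lambda>y. \<bar>\<Sum>v\<in>I. X v y - ?m v\<bar> + (\<Sum>v\<in>I. ?m v) * indicator ?E y)"
        using Xi Ei by auto
      show "(\<Sum>v\<in>I. X v y * indicator ?E y) \<le> \<bar>\<Sum>v\<in>I. X v y - ?m v\<bar> + (\<Sum>v\<in>I. ?m v) * indicator ?E y" for y
        by (auto split: split_indicator simp: sum_subtractf)
    qed
    also have "\<dots> = (\<integral>y. \<bar>\<Sum>v\<in>I. X v y - ?m v\<bar> \<partial>?N) + (\<Sum>v\<in>I. ?m v) * measure ?N ?E"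
      using Xi Ei by simp
    also have "(\<integral>y. \<bar>\<Sum>v\<in>I. X v y - ?m v\<bar> \<partial>?N) \<le> sqrt (\<Sum>v\<in>I. \<integral>y. (X v y)\<^sup>2 \<partial>?N)"
    proof (rule abs_deviation_le[OF fI Xm])
      show "disjoint_family_on (\<lambda>v. light_cone v t) I"
        unfolding disjoint_family_on_def using light_cone_disjoint I(2) by blast
      show "\<bar>X v y\<bar> \<le> exp h" for v y using X0 Xh by simp
    qed
    also have "sqrt (\<Sum>v\<in>I. \<integral>y. (X v y)\<^sup>2 \<partial>?N) \<le> sqrt (\<Sum>v\<in>I. exp h)"
      using X2 by (intro real_sqrt_le_mono sum_mono)
    also have "(\<Sum>v\<in>I. ?m v) * measure ?N ?E \<le> real (card I) * (1 / 2)"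
    proof (rule mult_mono)
      have "(\<Sum>v\<in>I. ?m v) \<le> (\<Sum>v\<in>I. 1)" by (rule sum_mono) (rule X1)
      thus "(\<Sum>v\<in>I. ?m v) \<le> real (card I)" by simp
    qed (use half in auto)
    finally show ?thesis by simp
  qed
  finally show ?thesis by (simp add: algebra_simps)
qed

text \<open>Markov's inequality for a time that exceeds \<open>t\<close> and hence is at least \<open>t + 1\<close>.\<close>

lemma worst_delay_ge:
  assumes p: "seq_estimator V p" and v: "v \<in> V"
  shows "ennreal (real (t + 1) * (1 - measure (law (cascade v)) {y. snd p y \<le> enat t}))
     \<le> worst_delay line_graph Q0 Q1 V p"
proof -
  interpret prob_space "law (cascade v)" by (rule prob_space_law)
  let ?S = "{y. snd p y \<le> enat t}"
  have S [measurable]: "?S \<in> sets (law (cascade v))" using stopped_event[OF p] coord_events_subset_law by blast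
  have S': "UNIV - ?S \<in> sets (law (cascade v))" using sets.compl_sets[OF S] by simp
  have "ennreal (real (t + 1) * (1 - measure (law (cascade v)) ?S)) = ennreal (real (t + 1)) * emeasure (law (cascade v)) (UNIV - ?S)"
    using prob_compl[OF S] by (simp add: emeasure_eq_measure ennreal_mult)
  also have "\<dots> = (\<integral>\<^sup>+y. ennreal (real (t + 1)) * indicator (UNIV - ?S) y \<partial>law (cascade v))"
    using S' by (simp add: nn_integral_cmult)
  also have "\<dots> \<le> (\<integral>\<^sup>+y. ennreal_of_enat (snd p y) \<partial>law (cascade v))"
  proof (rule nn_integral_mono)
    fix y
    show "ennreal (real (t + 1)) * indicator (UNIV - ?S) y \<le> ennreal_of_enat (snd p y)"
    proof (cases "snd p y")
      case (enat k)
      show ?thesis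
      proof (cases "k \<le> t")
        case False
        hence "(of_nat (t + 1) :: ennreal) \<le> of_nat k" by (intro of_nat_mono) simp
        thus ?thesis using enat by (auto split: split_indicator simp flip: ennreal_of_nat_eq_real_of_nat)
      qed (simp add: enat)
    qed simp
  qed
  also have "\<dots> \<le> worst_delay line_graph Q0 Q1 V p"
    using v by (auto simp: worst_delay_def source_law_eq split: prod.splits intro!: SUP_upper2)
  finally show ?thesis .
qed

text \<open>The lower bound by two-point comparison, at the central vertex, whose neighbours at distance
  \<open>R + 1\<close> are among the candidates.\<close>

lemma T_star_ge_near:
  assumes V: "closest_vertices line_graph v0 n V" and R: "2 * (R + 1) < n" and \<alpha>: "0 \<le> \<alpha>"
  shows "ennreal (real (t + 1) * (1 - (\<alpha> + 2 * (exp x * (real (R + 1) * (\<alpha> / real n))) + 2 * near_tail (R + 1) t x)))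
     \<le> T_star line_graph Q0 Q1 V R \<alpha>"
  unfolding T_star_def
proof (rule INF_greatest)
  fix p assume p: "p \<in> Delta_class line_graph Q0 Q1 V R \<alpha>"
  have fV: "finite V" "card V = n" using V by (auto simp: closest_vertices_def)
  have in_V: "v0 \<in> V" "v0 - int R - 1 \<in> V" "v0 + int R + 1 \<in> V"
    using R by (auto intro!: closest_vertices_line[OF V])
  have n1: "nat \<bar>v0 - int R - 1 - v0\<bar> = R + 1" "nat \<bar>v0 + int R + 1 - v0\<bar> = R + 1" by auto
  have "measure (law (cascade v0)) {y. snd p y \<le> enat t} \<le> \<alpha> + 2 * (exp x * (real (R + 1) * (\<alpha> / real n))) + 2 * near_tail (R + 1) t x"
    using prob_stopped_le[OF p fV(1) \<alpha> in_V, of t x] unfolding near_tail_eq n1 fV(2) by linarith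
  hence "ennreal (real (t + 1) * (1 - (\<alpha> + 2 * (exp x * (real (R + 1) * (\<alpha> / real n))) + 2 * near_tail (R + 1) t x)))
    \<le> ennreal (real (t + 1) * (1 - measure (law (cascade v0)) {y. snd p y \<le> enat t}))"
    by (intro ennreal_leI mult_left_mono) auto
  also have "\<dots> \<le> worst_delay line_graph Q0 Q1 V p"
    by (rule worst_delay_ge) (use p in_V in \<open>auto simp: Delta_class_def\<close>)
  finally show "ennreal (real (t + 1) * (1 - (\<alpha> + 2 * (exp x * (real (R + 1) * (\<alpha> / real n))) + 2 * near_tail (R + 1) t x)))
    \<le> worst_delay line_graph Q0 Q1 V p" .
qed

text \<open>The lower bound by mixtures. Either the right or the left half of the line is decided with
  probability at most \<open>1 / 2\<close> without a source; the mixture of \<open>M\<close> sources is taken on that side,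
  at distance more than \<open>R\<close> from the centre, so that outputs on the other side are errors.\<close>

lemma T_star_ge_far:
  assumes V: "closest_vertices line_graph v0 n V" and M: "0 < M" "2 * (R + 1 + M * (2 * t + 1)) < n" and \<alpha>: "0 \<le> \<alpha>"
  shows "ennreal (real (t + 1) * (1 - (\<alpha> + 1 / 2 + far_tail t h + sqrt (exp h / real M))))
     \<le> T_star line_graph Q0 Q1 V R \<alpha>"
  unfolding T_star_def
proof (rule INF_greatest)
  fix p assume p: "p \<in> Delta_class line_graph Q0 Q1 V R \<alpha>"
  interpret N: prob_space "law ({} :: (nat \<times> int) set)" by (rule prob_space_law)
  have p1: "seq_estimator V p" using p by (simp add: Delta_class_def)
  have fV: "finite V" using V by (auto simp: closest_vertices_def)
  define g where "g s i = v0 + s * (int R + 1 + int i * (2 * int t + 1))" for s :: int and i :: nat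
  have gdist: "\<bar>g s i - g s j\<bar> > 2 * int t" if "\<bar>s\<bar> = 1" "i \<noteq> j" for s i j
  proof -
    have "\<bar>g s i - g s j\<bar> = \<bar>s * ((int i - int j) * (2 * int t + 1))\<bar>"
      by (simp add: g_def algebra_simps)
    also have "\<dots> = \<bar>int i - int j\<bar> * (2 * int t + 1)" using that by (simp add: abs_mult)
    also have "\<dots> \<ge> 1 * (2 * int t + 1)" using that by (intro mult_right_mono) auto
    finally show ?thesis by simp
  qed
  have gV: "g s i \<in> V" if "\<bar>s\<bar> = 1" "i < M" for s i
  proof (rule closest_vertices_line[OF V])
    have "\<bar>g s i - v0\<bar> = int (R + 1 + i * (2 * t + 1))"
    proof -
      have "\<bar>g s i - v0\<bar> = \<bar>s\<bar> * \<bar>int R + 1 + int i * (2 * int t + 1)\<bar>"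
        by (simp add: g_def abs_mult)
      also have "\<bar>int R + 1 + int i * (2 * int t + 1)\<bar> = int R + 1 + int i * (2 * int t + 1)"
        by (rule abs_of_nonneg) simp
      finally show ?thesis using that by (simp add: algebra_simps)
    qed
    hence "nat \<bar>g s i - v0\<bar> = R + 1 + i * (2 * t + 1)" by (simp only: nat_int)
    moreover have "i * (2 * t + 1) \<le> M * (2 * t + 1)" using that by (intro mult_right_mono) auto
    moreover have "2 * x < n" if "x = R + 1 + a" "a \<le> b" "2 * (R + 1 + b) < n" for x a b :: nat
      using that by simp
    ultimately show "2 * nat \<bar>g s i - v0\<bar> < n" using M(2) by blast
  qed
  have main: "ennreal (real (t + 1) * (1 - (\<alpha> + 1 / 2 + far_tail t h + sqrt (exp h / real M)))) \<le> worst_delay line_graph Q0 Q1 V p"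
    if s: "\<bar>s\<bar> = 1" and W: "\<And>i w. w \<in> V - W \<Longrightarrow> \<bar>w - g s i\<bar> > int R"
      and half: "measure (law {}) (decided p t W) \<le> 1 / 2" for s W
  proof -
    let ?I = "g s ` {..<M}"
    have inj: "inj_on (g s) {..<M}"
      using gdist[OF s] by (intro inj_onI) (metis abs_zero diff_self not_less of_nat_0_le_iff zero_le_mult_iff zero_le_numeral)
    have cI: "card ?I = M" using inj by (simp add: card_image)
    define b where "b = \<alpha> + 1 / 2 + far_tail t h + sqrt (exp h / real M)"
    have "(\<Sum>v\<in>?I. measure (law (cascade v)) {y. snd p y \<le> enat t})
       \<le> real (card ?I) * (\<alpha> + 1 / 2 + far_tail t h) + sqrt (real (card ?I) * exp h)"
    proof (rule mixture_bound[OF p fV \<alpha> _ _ _ half])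
      show "?I \<subseteq> V" using gV[OF s] by auto
      show "\<bar>v - u\<bar> > 2 * int t" if vu: "v \<in> ?I" "u \<in> ?I" "v \<noteq> u" for v u
      proof -
        obtain i j where "v = g s i" "u = g s j" using vu by auto
        moreover from this have "i \<noteq> j" using vu by auto
        ultimately show ?thesis using gdist[OF s, of i j] by simp
      qed
      show "\<bar>w - v\<bar> > int R" if "v \<in> ?I" "w \<in> V - W" for v w
        using that W by auto
    qed
    also have "sqrt (real (card ?I) * exp h) = real M * sqrt (exp h / real M)"
    proof -
      have "real M * exp h = (real M)\<^sup>2 * (exp h / real M)" using M by (simp add: power2_eq_square)
      hence "sqrt (real M * exp h) = sqrt ((real M)\<^sup>2) * sqrt (exp h / real M)"
        by (simp only: real_sqrt_mult)
      thus ?thesis by (simp add: cI)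
    qed
    finally have sum: "(\<Sum>v\<in>?I. measure (law (cascade v)) {y. snd p y \<le> enat t}) \<le> real (card ?I) * b"
      by (simp add: cI b_def algebra_simps)
    have "\<exists>v\<in>?I. measure (law (cascade v)) {y. snd p y \<le> enat t} \<le> b"
    proof (rule ccontr)
      assume "\<not> ?thesis"
      hence "(\<Sum>v\<in>?I. b) < (\<Sum>v\<in>?I. measure (law (cascade v)) {y. snd p y \<le> enat t})"
        using M by (intro sum_strict_mono) (auto simp: not_le)
      thus False using sum by simp
    qed
    then obtain v where v: "v \<in> ?I" "measure (law (cascade v)) {y. snd p y \<le> enat t} \<le> b" by blast
    have "ennreal (real (t + 1) * (1 - b)) \<le> ennreal (real (t + 1) * (1 - measure (law (cascade v)) {y. snd p y \<le> enat t}))"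
      using v by (intro ennreal_leI mult_left_mono) auto
    also have "\<dots> \<le> worst_delay line_graph Q0 Q1 V p"
      by (rule worst_delay_ge[OF p1]) (use v gV[OF s] in auto)
    finally show ?thesis by (simp add: b_def)
  qed
  let ?A = "{w\<in>V. v0 \<le> w}" and ?B = "{w\<in>V. w < v0}"
  have "measure (law {}) (decided p t ?A) + measure (law {}) (decided p t ?B) \<le> 1"
  proof -
    have "decided p t ?A \<inter> decided p t ?B = {}" by (auto simp: decided_def)
    hence "measure (law {}) (decided p t ?A) + measure (law {}) (decided p t ?B)
       = measure (law {}) (decided p t ?A \<union> decided p t ?B)"
      using decided_sets[OF p1] by (intro N.finite_measure_Union[symmetric]) auto
    thus ?thesis by simp
  qed
  then consider "measure (law {}) (decided p t ?A) \<le> 1 / 2" | "measure (law {}) (decided p t ?B) \<le> 1 / 2"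
    by linarith
  thus "ennreal (real (t + 1) * (1 - (\<alpha> + 1 / 2 + far_tail t h + sqrt (exp h / real M)))) \<le> worst_delay line_graph Q0 Q1 V p"
  proof cases
    case 1
    show ?thesis
    proof (rule main[OF _ _ 1, of 1])
      fix i w assume w: "w \<in> V - ?A"
      have "int R < \<bar>w - (v0 + 1 * (int R + 1 + a))\<bar>" if "0 \<le> a" for a
        using w that by auto
      thus "\<bar>w - g 1 i\<bar> > int R" unfolding g_def by simp
    qed simp
  next
    case 2
    show ?thesis
    proof (rule main[OF _ _ 2, of "-1"])
      fix i w assume w: "w \<in> V - ?B"
      have "int R < \<bar>w - (v0 + (- 1) * (int R + 1 + a))\<bar>" if "0 \<le> a" for a
        using w that by auto
      thus "\<bar>w - g (-1) i\<bar> > int R" unfolding g_def by simp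
    qed simp
  qed
qed

end

section \<open>The MSPRT: error constraints and Hellinger tail\<close>

lemma INF_enat_le_iff: "(INF s\<in>S. enat s) \<le> enat t \<longleftrightarrow> (\<exists>s\<in>S. s \<le> t)"
proof -
  have "x \<le> enat t \<longleftrightarrow> x < enat (Suc t)" for x by (cases x) auto
  thus ?thesis by (simp add: INF_less_iff less_Suc_eq_le)
qed

context mutual_ac_laws
begin

lemma msprt_score_ge_iff:
  "ereal c \<le> msprt_score line_graph Q0 Q1 V R v t y
    \<longleftrightarrow> (\<forall>u\<in>V. \<bar>u - v\<bar> > int R \<longrightarrow> c \<le> LLR (cascade v) (differ v u t) y)"
proof -
  have "V - nbhd line_graph v R = {u\<in>V. \<bar>u - v\<bar> > int R}" by (auto simp: nbhd_line)
  thus ?thesis by (auto simp: msprt_score_def le_INF_iff Z_stat_eq)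
qed

lemma msprt_time_le_iff:
  "snd (msprt line_graph Q0 Q1 V R \<alpha>) y \<le> enat t \<longleftrightarrow>
     (\<exists>v\<in>V. \<exists>s\<le>t. ereal (ln (real (card V) / \<alpha>)) \<le> msprt_score line_graph Q0 Q1 V R v s y)"
proof -
  have "x \<le> enat t \<longleftrightarrow> x < enat (Suc t)" for x by (cases x) auto
  hence "(INF v\<in>V. f v) \<le> enat t \<longleftrightarrow> (\<exists>v\<in>V. f v \<le> enat t)" for f :: "int \<Rightarrow> enat"
    by (simp add: INF_less_iff)
  thus ?thesis by (auto simp: msprt_def msprt_vertex_time_def INF_enat_le_iff)
qed

lemma measurable_msprt_score:
  assumes "finite V"
  shows "(\<lambda>y. msprt_score line_graph Q0 Q1 V R v t y) \<in> borel_measurable (coord_algebra (horizon t))"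
  unfolding msprt_score_def Z_stat_eq
  by (intro borel_measurable_INF borel_measurable_ereal measurable_LLR)
     (use assms in \<open>auto simp: differ_def intro: countable_finite\<close>)

lemma msprt_decision_arg_max:
  assumes "finite V" "V \<noteq> {}"
  shows "is_arg_max (\<lambda>v. msprt_score line_graph Q0 Q1 V R v t y) (\<lambda>v. v \<in> V) (fst (msprt line_graph Q0 Q1 V R \<alpha>) t y)"
proof -
  let ?f = "\<lambda>v. msprt_score line_graph Q0 Q1 V R v t y"
  have "\<exists>v. is_arg_max ?f (\<lambda>v. v \<in> V) v"
  proof -
    have "Max (?f ` V) \<in> ?f ` V" using assms by (intro Max_in) auto
    then obtain v where v: "v \<in> V" "?f v = Max (?f ` V)" by auto
    have "is_arg_max ?f (\<lambda>v. v \<in> V) v"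
      using v assms by (auto simp: is_arg_max_def not_less)
    thus ?thesis by blast
  qed
  hence "is_arg_max ?f (\<lambda>v. v \<in> V) (SOME v. is_arg_max ?f (\<lambda>v. v \<in> V) v)" by (rule someI_ex)
  thus ?thesis by (simp add: msprt_def arg_max_def)
qed

text \<open>The decision is a choice among the maximisers of finitely many scores, so it is a function of
  the finite set of maximisers, and each value of this set is an event of the past.\<close>

lemma msprt_seq_estimator:
  assumes V: "finite V" "V \<noteq> {}"
  shows "seq_estimator V (msprt line_graph Q0 Q1 V R \<alpha>)"
proof -
  let ?p = "msprt line_graph Q0 Q1 V R \<alpha>"
  let ?f = "\<lambda>v t y. msprt_score line_graph Q0 Q1 V R v t y"
  have stop: "stopping_time obs_filtration (snd ?p)"
    unfolding stopping_time_def
  proof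
    fix t :: enat
    show "Measurable.pred (obs_filtration t) (\<lambda>y. snd ?p y \<le> t)"
    proof (cases t)
      case (enat t')
      interpret sigma_algebra UNIV "coord_events (horizon t')" by (rule sigma_algebra_coord_events)
      have "{y. snd ?p y \<le> enat t'} = (\<Union>v\<in>V. \<Union>s\<in>{..t'}. {y. ereal (ln (real (card V) / \<alpha>)) \<le> ?f v s y})"
        unfolding msprt_time_le_iff by auto
      also have "\<dots> \<in> coord_events (horizon t')"
      proof (intro finite_UN V finite_atMost)
        fix v s assume "s \<in> {..t'}"
        have "{y. ereal (ln (real (card V) / \<alpha>)) \<le> ?f v s y} \<in> coord_events (horizon s)"
          using measurable_sets[OF measurable_msprt_score[OF V(1), of R v s], of "{ereal (ln (real (card V) / \<alpha>))..}"]
          by (simp add: vimage_def sets_coord_algebra)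
        thus "{y. ereal (ln (real (card V) / \<alpha>)) \<le> ?f v s y} \<in> coord_events (horizon t')"
          using coord_events_horizon_mono[of s t'] \<open>s \<in> {..t'}\<close> by auto
      qed
      finally show ?thesis by (simp add: enat pred_def sets_obs_filtration)
    qed simp
  qed
  have dec: "fst ?p t \<in> measurable (obs_filtration (enat t)) (count_space V)" for t
  proof -
    interpret sigma_algebra UNIV "coord_events (horizon t)" by (rule sigma_algebra_coord_events)
    let ?m = "\<lambda>y. {v\<in>V. \<forall>u\<in>V. ?f u t y \<le> ?f v t y}"
    have am: "is_arg_max (\<lambda>v. ?f v t y) (\<lambda>v. v \<in> V) v \<longleftrightarrow> v \<in> ?m y" for v y
      by (auto simp: is_arg_max_def not_less)
    have D: "fst ?p t y = (SOME v. v \<in> ?m y)" for y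
      unfolding msprt_def arg_max_def fst_conv by (rule arg_cong[where f=Eps]) (rule ext, rule am)
    have mS: "{y. ?m y = S} \<in> coord_events (horizon t)" for S
    proof (cases "S \<subseteq> V")
      case True
      have le: "{y. ?f u t y \<le> ?f v t y} \<in> coord_events (horizon t)" for u v
      proof -
        have "{y \<in> space (coord_algebra (horizon t)). ?f u t y \<le> ?f v t y} \<in> sets (coord_algebra (horizon t))"
          using measurable_msprt_score[OF V(1)] by measurable
        thus ?thesis by (simp add: sets_coord_algebra)
      qed
      have in_m: "{y. v \<in> ?m y} \<in> coord_events (horizon t)" if "v \<in> V" for v
      proof -
        have "{y. v \<in> ?m y} = (\<Inter>u\<in>V. {y. ?f u t y \<le> ?f v t y})" using that by auto
        also have "\<dots> \<in> coord_events (horizon t)" using V le by (intro finite_INT) auto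
        finally show ?thesis .
      qed
      have "{y. ?m y = S} = (\<Inter>v\<in>V. {y. v \<in> ?m y \<longleftrightarrow> v \<in> S})"
      proof (intro set_eqI iffI)
        fix y assume "y \<in> (\<Inter>v\<in>V. {y. v \<in> ?m y \<longleftrightarrow> v \<in> S})"
        hence "v \<in> ?m y \<longleftrightarrow> v \<in> S" if "v \<in> V" for v using that by blast
        moreover have "?m y \<subseteq> V" by blast
        ultimately have "?m y = S" using True by blast
        thus "y \<in> {y. ?m y = S}" by simp
      qed blast
      also have "\<dots> \<in> coord_events (horizon t)"
      proof (intro finite_INT V)
        fix v assume v: "v \<in> V"
        show "{y. v \<in> ?m y \<longleftrightarrow> v \<in> S} \<in> coord_events (horizon t)"
        proof (cases "v \<in> S")
          case True
          hence "{y. v \<in> ?m y \<longleftrightarrow> v \<in> S} = {y. v \<in> ?m y}" by blast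
          thus ?thesis using in_m[OF v] by (simp only:)
        next
          case False
          hence "{y. v \<in> ?m y \<longleftrightarrow> v \<in> S} = UNIV - {y. v \<in> ?m y}" by blast
          thus ?thesis using compl_sets[OF in_m[OF v]] by (simp only:)
        qed
      qed
      finally show ?thesis .
    next
      case False
      hence "{y. ?m y = S} = {}" by auto
      thus ?thesis by (simp only: empty_sets)
    qed
    have "fst ?p t -` {a} \<in> coord_events (horizon t)" for a
    proof -
      have "fst ?p t -` {a} = (\<Union>S\<in>{S\<in>Pow V. (SOME v. v \<in> S) = a}. {y. ?m y = S})"
        by (auto simp: D)
      also have "\<dots> \<in> coord_events (horizon t)"
        using V mS by (intro finite_UN) auto
      finally show ?thesis .
    qed
    moreover have "fst ?p t y \<in> V" for y
      using msprt_decision_arg_max[OF V] by (auto simp: is_arg_max_def)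
    ultimately show ?thesis
      using V by (subst measurable_count_space_eq2) (auto simp: sets_obs_filtration)
  qed
  obtain D T where DT: "?p = (D, T)" by force
  show ?thesis using stop dec by (simp add: DT seq_estimator_def)
qed

text \<open>When the MSPRT stops and decides \<open>u\<close>, the score of \<open>u\<close> has passed \<open>ln (n / \<alpha>)\<close>, so the change of
  measure from \<open>u\<close> to a far source \<open>v\<close> gains a factor \<open>\<alpha> / n\<close> on each event of stopping at time \<open>t\<close>.\<close>

lemma msprt_in_Delta_class:
  assumes V: "finite V" "V \<noteq> {}" and \<alpha>: "0 < \<alpha>"
  shows "msprt line_graph Q0 Q1 V R \<alpha> \<in> Delta_class line_graph Q0 Q1 V R \<alpha>"
proof -
  let ?p = "msprt line_graph Q0 Q1 V R \<alpha>"
  let ?c = "ln (real (card V) / \<alpha>)"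
  have est: "seq_estimator V ?p" by (rule msprt_seq_estimator[OF V])
  have n: "0 < real (card V)" using V by (simp add: card_gt_0_iff)
  have bound: "measure (law (cascade v)) (output_event ?p u) \<le> \<alpha> / real (card V)"
    if u: "u \<in> V" and v: "v \<in> V" and far: "gdist line_graph u v > R" for u v
  proof -
    interpret U: prob_space "law (cascade u)" by (rule prob_space_law)
    interpret W: prob_space "law (cascade v)" by (rule prob_space_law)
    define A where "A t = {y. snd ?p y = enat t \<and> fst ?p t y \<in> {u}}" for t
    have Ae: "A t \<in> coord_events (horizon t)" for t
      unfolding A_def by (rule decided_at_event[OF est])
    have As: "A t \<in> sets (law B)" for t B using Ae coord_events_subset_law by blast
    have out: "output_event ?p u = (\<Union>t. A t)"
    proof -
      have "x \<noteq> \<infinity> \<longleftrightarrow> (\<exists>t. x = enat t)" for x by (cases x) auto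
      thus ?thesis by (auto simp: output_event_def A_def split: prod.splits)
    qed
    have dis: "disjoint_family A" by (auto simp: disjoint_family_on_def A_def)
    have score: "?c \<le> LLR (cascade u) (differ u v t) y" if y: "y \<in> A t" for t y
    proof -
      have T: "snd ?p y = enat t" and D: "fst ?p t y = u" using y by (auto simp: A_def)
      have "snd ?p y \<le> enat t" using T by simp
      then obtain w s where w: "w \<in> V" "s \<le> t" "ereal ?c \<le> msprt_score line_graph Q0 Q1 V R w s y"
        unfolding msprt_time_le_iff by blast
      have "s = t"
      proof (rule ccontr)
        assume "s \<noteq> t"
        have "snd ?p y \<le> enat s" unfolding msprt_time_le_iff using w by blast
        thus False using T w(2) \<open>s \<noteq> t\<close> by simp
      qed
      moreover have "msprt_score line_graph Q0 Q1 V R w t y \<le> msprt_score line_graph Q0 Q1 V R u t y"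
        using msprt_decision_arg_max[OF V, of R t y \<alpha>] w(1) by (auto simp: D is_arg_max_def not_less)
      ultimately have "ereal ?c \<le> msprt_score line_graph Q0 Q1 V R u t y" using w(3) by (metis order_trans)
      thus ?thesis using v far by (auto simp: msprt_score_ge_iff gdist_line_graph abs_minus_commute)
    qed
    have At: "emeasure (law (cascade v)) (A t) \<le> ennreal (\<alpha> / real (card V)) * emeasure (law (cascade u)) (A t)" for t
    proof -
      have "measure (law (cascade v)) (A t) = measure (law (sym_diff (cascade u) (differ u v t))) (A t)"
        by (rule prob_differ_flip[OF Ae])
      also have "\<dots> \<le> exp (- ?c) * measure (law (cascade u)) (A t)"
        by (rule prob_flip_le) (use As score in auto)
      also have "exp (- ?c) = \<alpha> / real (card V)"
        using n \<alpha> by (simp add: exp_minus)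
      finally show ?thesis
        using \<alpha> by (simp add: U.emeasure_eq_measure W.emeasure_eq_measure ennreal_mult[symmetric])
    qed
    have "emeasure (law (cascade v)) (output_event ?p u) = (\<Sum>t. emeasure (law (cascade v)) (A t))"
      unfolding out using As dis by (intro suminf_emeasure[symmetric]) auto
    also have "\<dots> \<le> (\<Sum>t. ennreal (\<alpha> / real (card V)) * emeasure (law (cascade u)) (A t))"
      by (intro suminf_le At) auto
    also have "\<dots> = ennreal (\<alpha> / real (card V)) * emeasure (law (cascade u)) (output_event ?p u)"
      unfolding out using As dis by (simp add: suminf_emeasure image_subset_iff)
    also have "\<dots> \<le> ennreal (\<alpha> / real (card V)) * 1"
      by (intro mult_left_mono U.emeasure_le_1) simp
    finally show ?thesis using \<alpha> by (simp add: W.emeasure_eq_measure)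
  qed
  show ?thesis using est bound by (auto simp: Delta_class_def source_law_eq)
qed

lemma T_star_le_msprt:
  assumes V: "finite V" "V \<noteq> {}" and \<alpha>: "0 < \<alpha>"
  shows "T_star line_graph Q0 Q1 V R \<alpha> \<le> worst_delay line_graph Q0 Q1 V (msprt line_graph Q0 Q1 V R \<alpha>)"
  unfolding T_star_def by (rule INF_lower) (rule msprt_in_Delta_class[OF assms])

lemma worst_delay_msprt:
  "worst_delay line_graph Q0 Q1 V (msprt line_graph Q0 Q1 V R \<alpha>)
    = (SUP v\<in>V. \<integral>\<^sup>+y. ennreal_of_enat (snd (msprt line_graph Q0 Q1 V R \<alpha>) y) \<partial>law (cascade v))"
  by (simp add: worst_delay_def source_law_eq split: prod.split)

lemma msprt_delay_suminf:
  assumes V: "finite V" "V \<noteq> {}"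
  shows "(\<integral>\<^sup>+y. ennreal_of_enat (snd (msprt line_graph Q0 Q1 V R \<alpha>) y) \<partial>law A)
    = (\<Sum>t. emeasure (law A) {y. enat t < snd (msprt line_graph Q0 Q1 V R \<alpha>) y})"
proof -
  let ?T = "snd (msprt line_graph Q0 Q1 V R \<alpha>)"
  have m: "{y. ?T y = enat t} \<in> sets (law A)" for t
    using stopped_at_event[OF msprt_seq_estimator[OF V]] coord_events_subset_law by blast
  have "?T \<in> measurable (law A) (count_space UNIV)"
  proof (subst measurable_count_space_eq_countable)
    show "?T \<in> space (law A) \<rightarrow> UNIV \<and> (\<forall>a\<in>UNIV. ?T -` {a} \<inter> space (law A) \<in> sets (law A))"
    proof (intro conjI ballI)
      fix a :: enat
      show "?T -` {a} \<inter> space (law A) \<in> sets (law A)"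
      proof (cases a)
        case (enat t)
        thus ?thesis using m[of t] by (simp add: vimage_def)
      next
        case infinity
        have "?T -` {a} = space (law A) - (\<Union>t. {y. ?T y = enat t})"
          using not_infinity_eq by (auto simp: infinity)
        also have "\<dots> \<in> sets (law A)" using m by (intro sets.compl_sets sets.countable_UN) auto
        finally show ?thesis by simp
      qed
    qed simp
  qed simp
  thus ?thesis by (subst nn_integral_enat_function) simp_all
qed

text \<open>It suffices to control the score of the true source: the MSPRT stops at the latest when it
  passes the threshold.\<close>

lemma msprt_exceeds:
  assumes v: "v \<in> V" and "enat t < snd (msprt line_graph Q0 Q1 V R \<alpha>) y"
  shows "\<exists>u\<in>V. \<bar>u - v\<bar> > int R \<and> LLR (cascade v) (differ v u t) y < ln (real (card V) / \<alpha>)"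
proof (rule ccontr)
  assume "\<not> ?thesis"
  hence "ereal (ln (real (card V) / \<alpha>)) \<le> msprt_score line_graph Q0 Q1 V R v t y"
    unfolding msprt_score_ge_iff by (auto simp: not_less)
  hence "snd (msprt line_graph Q0 Q1 V R \<alpha>) y \<le> enat t"
    unfolding msprt_time_le_iff using v by blast
  thus False using assms(2) by simp
qed

text \<open>A union bound over all competitors. It is crude for early times but makes the delay integrable;
  it takes over after a multiple of \<open>ln n\<close> steps.\<close>

lemma msprt_tail:
  assumes V: "finite V" and v: "v \<in> V" and \<alpha>: "0 < \<alpha>"
  shows "measure (law (cascade v)) {y. enat t < snd (msprt line_graph Q0 Q1 V R \<alpha>) y}
     \<le> real (card V) * (sqrt (real (card V) / \<alpha>) * affinity ^ t)"
proof -
  interpret prob_space "law (cascade v)" by (rule prob_space_law)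
  let ?c = "ln (real (card V) / \<alpha>)"
  define U where "U = {u\<in>V. \<bar>u - v\<bar> > int R}"
  have U: "finite U" "card U \<le> card V" using V by (auto simp: U_def intro: card_mono)
  have n: "0 < real (card V)" using V v by (auto simp: card_gt_0_iff)
  have ev: "{y. LLR (cascade v) (differ v u t) y < ?c} \<in> events" for u
    using LLR_less_event[OF order_refl] coord_events_subset_law by blast
  have r: "0 \<le> affinity" "affinity \<le> 1" using affinity_pos affinity_less_1 by auto
  have "measure (law (cascade v)) {y. enat t < snd (msprt line_graph Q0 Q1 V R \<alpha>) y}
     \<le> prob (\<Union>u\<in>U. {y. LLR (cascade v) (differ v u t) y < ?c})"
  proof (rule finite_measure_mono)
    show "{y. enat t < snd (msprt line_graph Q0 Q1 V R \<alpha>) y} \<subseteq> (\<Union>u\<in>U. {y. LLR (cascade v) (differ v u t) y < ?c})"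
    proof
      fix y assume "y \<in> {y. enat t < snd (msprt line_graph Q0 Q1 V R \<alpha>) y}"
      then obtain u where "u \<in> V" "\<bar>u - v\<bar> > int R" "LLR (cascade v) (differ v u t) y < ?c"
        using msprt_exceeds[OF v, of t R \<alpha> y] by auto
      thus "y \<in> (\<Union>u\<in>U. {y. LLR (cascade v) (differ v u t) y < ?c})" by (auto simp: U_def)
    qed
    show "(\<Union>u\<in>U. {y. LLR (cascade v) (differ v u t) y < ?c}) \<in> events" using ev U by auto
  qed
  also have "\<dots> \<le> (\<Sum>u\<in>U. prob {y. LLR (cascade v) (differ v u t) y < ?c})"
    using U ev by (intro finite_measure_subadditive_finite) auto
  also have "\<dots> \<le> (\<Sum>u\<in>U. sqrt (real (card V) / \<alpha>) * affinity ^ t)"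
  proof (rule sum_mono)
    fix u assume u: "u \<in> U"
    have "prob {y. LLR (cascade v) (differ v u t) y < ?c} \<le> exp (?c / 2) * affinity ^ card (differ v u t)"
      by (rule prob_LLR_less) simp
    also have "exp (?c / 2) = sqrt (real (card V) / \<alpha>)"
      using n \<alpha> by (simp add: ln_sqrt[symmetric])
    also have "affinity ^ card (differ v u t) \<le> affinity ^ t"
    proof (rule power_decreasing)
      have "int R < \<bar>u - v\<bar>" using u by (simp add: U_def)
      hence "1 \<le> nat \<bar>u - v\<bar>" by linarith
      hence "t \<le> f_line (nat \<bar>u - v\<bar>) t" using f_line_ge[of "nat \<bar>u - v\<bar>" t] by simp
      also have "\<dots> \<le> card (differ v u t)" unfolding card_differ_Int[symmetric] by (rule card_mono) auto
      finally show "t \<le> card (differ v u t)" .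
    qed (use r in auto)
    finally show "prob {y. LLR (cascade v) (differ v u t) y < ?c} \<le> sqrt (real (card V) / \<alpha>) * affinity ^ t"
      using n \<alpha> by (simp add: mult_left_mono)
  qed
  also have "\<dots> \<le> real (card V) * (sqrt (real (card V) / \<alpha>) * affinity ^ t)"
    using U n \<alpha> r by (simp add: mult_right_mono)
  finally show ?thesis .
qed

end

section \<open>Geometric tail of the MSPRT over windows of independent copies\<close>

text \<open>A copy of the light cone of \<open>v\<close> up to time \<open>t\<close> that starts at time \<open>b\<close>. It lies inside the much larger
  neighbourhoods of \<open>v\<close> at these times.\<close>

definition far_block :: "int \<Rightarrow> nat \<Rightarrow> nat \<Rightarrow> (nat \<times> int) set" where
  "far_block v b t = {(s, w). b \<le> s \<and> s \<le> b + t \<and> \<bar>w - v\<bar> \<le> int (s - b)}"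

text \<open>A copy of \<open>differ\<close> for a vertex at distance \<open>j\<close> on the side \<open>\<sigma>\<close> that starts at time \<open>b\<close>. At
  time \<open>s\<close> its points of \<open>cascade v\<close> are the outermost ones on the side opposite to \<open>\<sigma>\<close>, and the
  others are the first ones beyond the neighbourhood on the side \<open>\<sigma>\<close>. With this choice the same block
  separates \<open>v\<close> from all vertices \<open>u\<close> on the side \<open>\<sigma>\<close> with distance between \<open>j\<close> and \<open>2 b + 1\<close>
  (\<open>side_block_subset_differ\<close>).\<close>

definition side_block :: "int \<Rightarrow> int \<Rightarrow> nat \<Rightarrow> nat \<Rightarrow> nat \<Rightarrow> (nat \<times> int) set" where
  "side_block \<sigma> v j b t = {(s, w). b \<le> s \<and> s \<le> b + t \<and>
     (let z = \<sigma> * (w - v); l = int (min j (2 * (s - b) + 1))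
      in - int s \<le> z \<and> z < - int s + l \<or> int s < z \<and> z < int s + 1 + l)}"

lemma sum_shifted: "(\<Sum>s\<in>{b..b + t}. f (s - b)) = (\<Sum>s\<le>t. f s)" for b t :: nat
  by (rule sum.reindex_bij_witness[of _ "\<lambda>s. s + b" "\<lambda>s. s - b"]) auto

lemma card_far_block: "finite (far_block v b t)" "card (far_block v b t \<inter> cascade v) = (t + 1)\<^sup>2"
  "card (far_block v b t - cascade v) = 0"
proof -
  have eq: "far_block v b t = (SIGMA s:{b..b + t}. {v - int (s - b)..v + int (s - b)})"
    by (auto simp: far_block_def)
  show fin: "finite (far_block v b t)" unfolding eq by auto
  have sub: "far_block v b t \<inter> cascade v = far_block v b t" "far_block v b t - cascade v = {}"
    by (auto simp: far_block_def cascade_def)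
  have "card (far_block v b t) = (\<Sum>s\<in>{b..b + t}. 2 * (s - b) + 1)"
  proof -
    have "card {v - int d..v + int d} = 2 * d + 1" for d
      by (simp add: nat_add_distrib nat_mult_distrib)
    moreover have "card (SIGMA s:{b..b + t}. {v - int (s - b)..v + int (s - b)})
        = (\<Sum>s\<in>{b..b + t}. card {v - int (s - b)..v + int (s - b)})"
      by (rule card_SigmaI) auto
    ultimately show ?thesis unfolding eq by (simp only:)
  qed
  also have "\<dots> = (\<Sum>s\<le>t. 2 * s + 1)" by (rule sum_shifted)
  also have "\<dots> = (t + 1)\<^sup>2" by (induction t) (auto simp: power2_eq_square)
  finally show "card (far_block v b t \<inter> cascade v) = (t + 1)\<^sup>2" "card (far_block v b t - cascade v) = 0"
    by (simp_all add: sub)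
qed

lemma sign_interval:
  assumes "\<bar>\<sigma>\<bar> = (1::int)"
  shows "finite {w. a \<le> \<sigma> * (w - v) \<and> \<sigma> * (w - v) < a + int l}"
    "card {w. a \<le> \<sigma> * (w - v) \<and> \<sigma> * (w - v) < a + int l} = l"
proof -
  have "{w. a \<le> \<sigma> * (w - v) \<and> \<sigma> * (w - v) < a + int l} =
    (if \<sigma> = 1 then {v + a..<v + a + int l} else {v - a - int l<..v - a})"
    using assms by (auto simp: abs_eq_iff' abs_if split: if_splits)
  thus "finite {w. a \<le> \<sigma> * (w - v) \<and> \<sigma> * (w - v) < a + int l}"
    "card {w. a \<le> \<sigma> * (w - v) \<and> \<sigma> * (w - v) < a + int l} = l" by auto
qed

lemma abs_sign: "\<bar>\<sigma>\<bar> = 1 \<Longrightarrow> \<bar>x\<bar> = \<bar>\<sigma> * x\<bar>" for \<sigma> x :: int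
  by (simp add: abs_mult)

lemma card_side_block:
  assumes \<sigma>: "\<bar>\<sigma>\<bar> = 1"
  shows "finite (side_block \<sigma> v j b t)" "card (side_block \<sigma> v j b t \<inter> cascade v) = f_line j t"
    "card (side_block \<sigma> v j b t - cascade v) = f_line j t"
proof -
  let ?l = "\<lambda>s. min j (2 * (s - b) + 1)"
  let ?I = "\<lambda>a s. {w. a \<le> \<sigma> * (w - v) \<and> \<sigma> * (w - v) < a + int (?l s)}"
  have key: "(s, w) \<in> side_block \<sigma> v j b t \<inter> cascade v \<longleftrightarrow> s \<in> {b..b + t} \<and> w \<in> ?I (- int s) s"
    "(s, w) \<in> side_block \<sigma> v j b t - cascade v \<longleftrightarrow> s \<in> {b..b + t} \<and> w \<in> ?I (int s + 1) s" for s w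
  proof -
    define z where "z = \<sigma> * (w - v)"
    define l where "l = int (?l s)"
    have "\<bar>w - v\<bar> = \<bar>z\<bar>" unfolding z_def by (rule abs_sign[OF \<sigma>])
    hence cascade: "(s, w) \<in> cascade v \<longleftrightarrow> \<bar>z\<bar> \<le> int s" by (simp add: cascade_def)
    have l: "l \<le> 2 * int s + 1" unfolding l_def by auto
    have blk: "(s, w) \<in> side_block \<sigma> v j b t \<longleftrightarrow> b \<le> s \<and> s \<le> b + t \<and>
        (- int s \<le> z \<and> z < - int s + l \<or> int s < z \<and> z < int s + 1 + l)"
      by (simp add: side_block_def Let_def z_def l_def)
    show "(s, w) \<in> side_block \<sigma> v j b t \<inter> cascade v \<longleftrightarrow> s \<in> {b..b + t} \<and> w \<in> ?I (- int s) s"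
      "(s, w) \<in> side_block \<sigma> v j b t - cascade v \<longleftrightarrow> s \<in> {b..b + t} \<and> w \<in> ?I (int s + 1) s"
      unfolding Int_iff Diff_iff cascade blk mem_Collect_eq z_def[symmetric] l_def[symmetric] atLeastAtMost_iff
      using l by linarith+
  qed
  have 1: "side_block \<sigma> v j b t \<inter> cascade v = (SIGMA s:{b..b + t}. ?I (- int s) s)"
    using key(1) by (intro set_eqI) (simp only: mem_Sigma_iff split_paired_all)
  have 2: "side_block \<sigma> v j b t - cascade v = (SIGMA s:{b..b + t}. ?I (int s + 1) s)"
    using key(2) by (intro set_eqI) (simp only: mem_Sigma_iff split_paired_all)
  have fS: "finite (SIGMA s:{b..b + t}. ?I (a s) s)" for a :: "nat \<Rightarrow> int"
    by (rule finite_SigmaI) (simp, rule sign_interval(1)[OF \<sigma>])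
  have cS: "card (SIGMA s:{b..b + t}. ?I (a s) s) = (\<Sum>s\<in>{b..b+t}. ?l s)" for a :: "nat \<Rightarrow> int"
  proof -
    have "card (SIGMA s:{b..b + t}. ?I (a s) s) = (\<Sum>s\<in>{b..b+t}. card (?I (a s) s))"
      by (rule card_SigmaI) (simp, intro ballI sign_interval(1)[OF \<sigma>])
    thus ?thesis by (simp only: sign_interval(2)[OF \<sigma>])
  qed
  have f1: "finite (side_block \<sigma> v j b t \<inter> cascade v)" "card (side_block \<sigma> v j b t \<inter> cascade v) = (\<Sum>s\<in>{b..b+t}. ?l s)"
    unfolding 1 by (rule fS cS)+
  have f2: "finite (side_block \<sigma> v j b t - cascade v)" "card (side_block \<sigma> v j b t - cascade v) = (\<Sum>s\<in>{b..b+t}. ?l s)"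
    unfolding 2 by (rule fS cS)+
  have "(\<Sum>s\<in>{b..b+t}. ?l s) = f_line j t" unfolding f_line_def by (rule sum_shifted)
  thus "card (side_block \<sigma> v j b t \<inter> cascade v) = f_line j t" "card (side_block \<sigma> v j b t - cascade v) = f_line j t"
    using f1(2) f2(2) by simp_all
  show "finite (side_block \<sigma> v j b t)" using f1(1) f2(1) by (metis Int_Diff_Un finite_Un)
qed

text \<open>The block serves simultaneously all competitors that are so far away that their neighbourhoods
  do not meet the ones of \<open>v\<close> yet.\<close>

lemma far_block_subset_differ:
  assumes "b + t \<le> t'" "\<bar>u - v\<bar> > 2 * int (b + t)"
  shows "far_block v b t \<subseteq> differ v u t'"
  using assms by (auto simp: far_block_def differ_def cascade_def horizon_def)

lemma side_block_subset_differ: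
  assumes "\<bar>\<sigma>\<bar> = 1" "b + t \<le> t'" "int j \<le> \<sigma> * (u - v)" "\<sigma> * (u - v) \<le> 2 * int b + 1"
  shows "side_block \<sigma> v j b t \<subseteq> differ v u t'"
proof clarify
  fix s w assume sw: "(s, w) \<in> side_block \<sigma> v j b t"
  define z where "z = \<sigma> * (w - v)"
  define d where "d = \<sigma> * (u - v)"
  have l: "int (min j (2 * (s - b) + 1)) \<le> int j" "int (min j (2 * (s - b) + 1)) \<le> 2 * int s + 1" by auto
  have *: "b \<le> s" "s \<le> b + t" "- int s \<le> z \<and> z < - int s + int (min j (2 * (s - b) + 1)) \<or> int s < z \<and> z < int s + 1 + int (min j (2 * (s - b) + 1))"
    using sw by (auto simp: side_block_def z_def Let_def)
  have "\<bar>w - v\<bar> = \<bar>z\<bar>" "\<bar>w - u\<bar> = \<bar>z - d\<bar>"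
    using abs_sign[OF assms(1), of "w - v"] abs_sign[OF assms(1), of "w - u"]
    by (simp_all add: z_def d_def algebra_simps)
  moreover have "(\<bar>z\<bar> \<le> int s) \<noteq> (\<bar>z - d\<bar> \<le> int s)"
    using *(1,3) l assms(3,4) unfolding d_def[symmetric] by linarith
  ultimately show "(s, w) \<in> differ v u t'"
    using *(1,2) assms(2) by (auto simp: differ_def cascade_def horizon_def)
qed

context mutual_ac_laws
begin

text \<open>Events of disjoint sets of coordinates are independent; the second conjunct makes the induction
  work.\<close>

lemma prob_INT_blocks:
  assumes "finite I" "disjoint_family_on K I" "\<And>i. i \<in> I \<Longrightarrow> E i \<in> coord_events (K i)"
  shows "measure (law A) (\<Inter>i\<in>I. E i) = (\<Prod>i\<in>I. measure (law A) (E i))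
    \<and> (\<Inter>i\<in>I. E i) \<in> coord_events (\<Union>i\<in>I. K i)"
  using assms
proof (induction I)
  case empty
  interpret sigma_algebra UNIV "coord_events {}" by (rule sigma_algebra_coord_events)
  show ?case using top by simp
next
  case (insert i I)
  interpret sigma_algebra UNIV "coord_events (\<Union>i\<in>insert i I. K i)" by (rule sigma_algebra_coord_events)
  have IH: "measure (law A) (\<Inter>i\<in>I. E i) = (\<Prod>i\<in>I. measure (law A) (E i))"
    "(\<Inter>i\<in>I. E i) \<in> coord_events (\<Union>i\<in>I. K i)"
    using insert by (auto simp: disjoint_family_on_def)
  have "K i \<inter> (\<Union>i\<in>I. K i) = {}"
    using insert.prems(1) insert.hyps(2) by (auto simp: disjoint_family_on_def)
  hence "measure (law A) (E i \<inter> (\<Inter>i\<in>I. E i)) = measure (law A) (E i) * measure (law A) (\<Inter>i\<in>I. E i)"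
    using insert.prems(2) IH(2) by (intro prob_indep) auto
  moreover have "E i \<in> coord_events (\<Union>i\<in>insert i I. K i)"
    using insert.prems(2)[of i] coord_events_mono[of "K i" "\<Union>i\<in>insert i I. K i"] by blast
  moreover have "(\<Inter>i\<in>I. E i) \<in> coord_events (\<Union>i\<in>insert i I. K i)"
    using IH(2) coord_events_mono[of "\<Union>i\<in>I. K i" "\<Union>i\<in>insert i I. K i"] by blast
  ultimately show ?case using insert.hyps IH(1) Int[of "E i" "\<Inter>i\<in>I. E i"] by simp
qed

text \<open>The steps are cut into pieces of length \<open>t + 1\<close>, and piece number \<open>k\<close> carries one block. In each
  window of \<open>3 q\<close> consecutive pieces the first \<open>q\<close> blocks are aimed at far competitors, the next
  \<open>q\<close> at the ones on the right and the last \<open>q\<close> at the ones on the left. The far blocks come first: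
  competitors that are too near for them are within reach of the side blocks, which start later.\<close>

definition test_block :: "int \<Rightarrow> nat \<Rightarrow> nat \<Rightarrow> nat \<Rightarrow> nat \<Rightarrow> (nat \<times> int) set" where
  "test_block v j q t k =
     (if k mod (3 * q) < q then far_block v (k * (t + 1)) t
      else side_block (if k mod (3 * q) < 2 * q then 1 else - 1) v j (k * (t + 1)) t)"

lemma test_block_slab: "(s, w) \<in> test_block v j q t k \<Longrightarrow> s div (t + 1) = k"
proof -
  assume "(s, w) \<in> test_block v j q t k"
  hence "k * (t + 1) \<le> s" "s < k * (t + 1) + (t + 1)"
    by (auto simp: test_block_def far_block_def side_block_def split: if_splits)
  hence "s = k * (t + 1) + (s - k * (t + 1))" "s - k * (t + 1) < t + 1" by auto
  thus ?thesis by (metis div_mult_self3 div_less add.right_neutral add_cancel_left_right div_mult_self1 add.commute Suc_eq_plus1 nat.distinct(1))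
qed

lemma finite_test_block: "finite (test_block v j q t k)"
  using card_far_block(1) card_side_block(1) by (simp add: test_block_def)

lemma disjoint_test_block: "disjoint_family_on (test_block v j q t) I"
  unfolding disjoint_family_on_def
proof (intro ballI impI)
  fix m n :: nat assume "m \<noteq> n"
  have False if "p \<in> test_block v j q t m" "p \<in> test_block v j q t n" for p
    using that test_block_slab[of "fst p" "snd p" v j q t m] test_block_slab[of "fst p" "snd p" v j q t n] \<open>m \<noteq> n\<close>
    by simp
  thus "test_block v j q t m \<inter> test_block v j q t n = {}" by blast
qed

lemma prob_test_block:
  "measure (law (cascade v)) {y. h < LLR (cascade v) (test_block v j q t k) y} =
    (if k mod (3 * q) < q then far_tail t h else near_tail j t h)"
proof (cases "k mod (3 * q) < q")
  case True
  have sub: "light_cone 0 t \<inter> cascade 0 = light_cone 0 t" "light_cone 0 t - cascade 0 = {}" by auto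
  show ?thesis
    using prob_LLR_cong[of "test_block v j q t k" "light_cone 0 t" "cascade v" "cascade 0" "{h<..}"] True
    by (simp add: finite_test_block far_tail_def test_block_def card_far_block card_light_cone sub)
next
  case False
  show ?thesis
    using prob_LLR_cong[of "test_block v j q t k" "differ 0 (int j) t" "cascade v" "cascade 0" "{h<..}"] False
    by (simp add: finite_test_block near_tail_def test_block_def card_side_block card_differ_Int card_differ_minus)
qed

definition window_success :: "int \<Rightarrow> nat \<Rightarrow> nat \<Rightarrow> nat \<Rightarrow> real \<Rightarrow> nat \<Rightarrow> (nat \<times> int \<Rightarrow> real) set" where
  "window_success v j q t h i = (\<Inter>k\<in>{3 * q * i..<3 * q * (i + 1)}. {y. h < LLR (cascade v) (test_block v j q t k) y})"

lemma test_block_event: "{y. h < LLR (cascade v) (test_block v j q t k) y} \<in> coord_events (test_block v j q t k)"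
  using LLR_events[of "{h<..}" "test_block v j q t k" "test_block v j q t k"] by simp

lemma window_success_prob:
  assumes "far_tail t h \<ge> 1 / 4" "near_tail j t h \<ge> 1 / 4"
  shows "measure (law (cascade v)) (window_success v j q t h i) \<ge> (1 / 4) ^ (3 * q)"
    and "window_success v j q t h i \<in> coord_events (\<Union>k\<in>{3 * q * i..<3 * q * (i + 1)}. test_block v j q t k)"
proof -
  have *: "measure (law (cascade v)) (window_success v j q t h i) =
     (\<Prod>k\<in>{3 * q * i..<3 * q * (i + 1)}. measure (law (cascade v)) {y. h < LLR (cascade v) (test_block v j q t k) y})
    \<and> window_success v j q t h i \<in> coord_events (\<Union>k\<in>{3 * q * i..<3 * q * (i + 1)}. test_block v j q t k)"
    unfolding window_success_def
    by (rule prob_INT_blocks) (simp, rule disjoint_test_block, rule test_block_event)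
  have "(1 / 4) ^ (3 * q) = (\<Prod>k\<in>{3 * q * i..<3 * q * (i + 1)}. (1 / 4 :: real))" by simp
  also have "\<dots> \<le> (\<Prod>k\<in>{3 * q * i..<3 * q * (i + 1)}. measure (law (cascade v)) {y. h < LLR (cascade v) (test_block v j q t k) y})"
    by (rule prod_mono) (use assms in \<open>simp add: prob_test_block\<close>)
  finally show "measure (law (cascade v)) (window_success v j q t h i) \<ge> (1 / 4) ^ (3 * q)" using * by simp
  show "window_success v j q t h i \<in> coord_events (\<Union>k\<in>{3 * q * i..<3 * q * (i + 1)}. test_block v j q t k)" using * by blast
qed

lemma no_success_prob:
  assumes "far_tail t h \<ge> 1 / 4" "near_tail j t h \<ge> 1 / 4"
  shows "measure (law (cascade v)) (\<Inter>i\<in>{..<m}. UNIV - window_success v j q t h i) \<le> (1 - (1 / 4) ^ (3 * q)) ^ m"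
    and "(\<Inter>i\<in>{..<m}. UNIV - window_success v j q t h i) \<in> sets (law A)"
proof -
  interpret prob_space "law (cascade v)" by (rule prob_space_law)
  let ?K = "\<lambda>i. \<Union>k\<in>{3 * q * i..<3 * q * (i + 1)}. test_block v j q t k"
  have ev: "UNIV - window_success v j q t h i \<in> coord_events (?K i)" for i
  proof -
    interpret sigma_algebra UNIV "coord_events (?K i)" by (rule sigma_algebra_coord_events)
    show ?thesis using window_success_prob(2)[OF assms] by (rule compl_sets)
  qed
  have disj: "disjoint_family_on ?K {..<m}"
    unfolding disjoint_family_on_def
  proof (intro ballI impI)
    fix i i' :: nat assume "i \<noteq> i'"
    have False if mem: "(s, w) \<in> ?K i" "(s, w) \<in> ?K i'" for s w
    proof -
      obtain k k' where kk: "(s, w) \<in> test_block v j q t k" "k \<in> {3 * q * i..<3 * q * (i + 1)}"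
        "(s, w) \<in> test_block v j q t k'" "k' \<in> {3 * q * i'..<3 * q * (i' + 1)}"
        using mem by blast
      have k: "s div (t + 1) \<in> {3 * q * i..<3 * q * (i + 1)}" "s div (t + 1) \<in> {3 * q * i'..<3 * q * (i' + 1)}"
        using kk test_block_slab[OF kk(1)] test_block_slab[OF kk(3)] by simp_all
      have "s div (t + 1) div (3 * q) = i" "s div (t + 1) div (3 * q) = i'"
        using k by (auto intro!: div_nat_eqI simp: algebra_simps)
      thus False using \<open>i \<noteq> i'\<close> by simp
    qed
    thus "?K i \<inter> ?K i' = {}" by auto
  qed
  have P: "measure (law (cascade v)) (\<Inter>i\<in>{..<m}. UNIV - window_success v j q t h i) =
      (\<Prod>i\<in>{..<m}. measure (law (cascade v)) (UNIV - window_success v j q t h i))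
    \<and> (\<Inter>i\<in>{..<m}. UNIV - window_success v j q t h i) \<in> coord_events (\<Union>i\<in>{..<m}. ?K i)"
    by (rule prob_INT_blocks[OF _ disj ev]) simp
  have "measure (law (cascade v)) (UNIV - window_success v j q t h i) \<le> 1 - (1 / 4) ^ (3 * q)" for i
  proof -
    have "window_success v j q t h i \<in> events"
      using window_success_prob(2)[OF assms] coord_events_subset_law by blast
    thus ?thesis using prob_compl[of "window_success v j q t h i"] window_success_prob(1)[OF assms, of q v i] by simp
  qed
  hence "(\<Prod>i\<in>{..<m}. measure (law (cascade v)) (UNIV - window_success v j q t h i)) \<le> (\<Prod>i\<in>{..<m}. 1 - (1 / 4) ^ (3 * q))"
    by (intro prod_mono) auto
  thus "measure (law (cascade v)) (\<Inter>i\<in>{..<m}. UNIV - window_success v j q t h i) \<le> (1 - (1 / 4) ^ (3 * q)) ^ m"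
    using P by simp
  show "(\<Inter>i\<in>{..<m}. UNIV - window_success v j q t h i) \<in> sets (law A)"
    using P coord_events_subset_law by blast
qed

definition window_end :: "nat \<Rightarrow> nat \<Rightarrow> nat \<Rightarrow> nat" where
  "window_end q t i = 3 * q * (i + 1) * (t + 1) - 1"

text \<open>The pieces of window \<open>i\<close> whose blocks separate \<open>v\<close> from the competitor \<open>u\<close>.\<close>

definition helpful :: "int \<Rightarrow> nat \<Rightarrow> nat \<Rightarrow> nat \<Rightarrow> int \<Rightarrow> nat set" where
  "helpful v q t i u =
     (if \<bar>u - v\<bar> > 2 * int ((3 * q * i + q) * (t + 1)) then {3 * q * i..<3 * q * i + q}
      else if u > v then {3 * q * i + q..<3 * q * i + 2 * q}
      else {3 * q * i + 2 * q..<3 * q * i + 3 * q})"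

lemma helpful_subset: "helpful v q t i u \<subseteq> {3 * q * i..<3 * q * (i + 1)}"
  by (auto simp: helpful_def algebra_simps)

lemma card_helpful: "card (helpful v q t i u) = q"
  by (simp add: helpful_def)

lemma helpful_copies_subset_differ:
  assumes q: "q \<ge> 1" and u: "\<bar>u - v\<bar> \<ge> int j" and j: "j \<ge> 1"
  shows "(\<Union>k\<in>helpful v q t i u. test_block v j q t k) \<subseteq> differ v u (window_end q t i)"
proof (rule UN_least)
  fix k assume k: "k \<in> helpful v q t i u"
  have "k + 1 \<le> 3 * q * (i + 1)" using k helpful_subset[of v q t i u] by auto
  hence "(k + 1) * (t + 1) \<le> 3 * q * (i + 1) * (t + 1)" by (rule mult_le_mono1)
  hence end_le: "k * (t + 1) + t \<le> window_end q t i" by (simp add: window_end_def)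
  have kmod: "k mod (3 * q) = k - 3 * q * i"
  proof -
    have "3 * q * i \<le> k" "k < 3 * q * (i + 1)" using subsetD[OF helpful_subset k] by auto
    moreover have "3 * q * (i + 1) = 3 * q * i + 3 * q" by simp
    ultimately have "k = 3 * q * i + (k - 3 * q * i)" "k - 3 * q * i < 3 * q" by linarith+
    thus ?thesis by (metis mod_less mod_mult_self2 add.commute mult.commute)
  qed
  show "test_block v j q t k \<subseteq> differ v u (window_end q t i)"
  proof (cases "\<bar>u - v\<bar> > 2 * int ((3 * q * i + q) * (t + 1))")
    case True
    hence kr: "3 * q * i \<le> k" "k < 3 * q * i + q" using k by (auto simp: helpful_def)
    have "(k + 1) * (t + 1) \<le> (3 * q * i + q) * (t + 1)" using kr by (intro mult_le_mono1) auto
    hence "k * (t + 1) + t \<le> (3 * q * i + q) * (t + 1)" by simp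
    moreover have "2 * int A < X" if "A \<le> B" "2 * int B < X" for A B :: nat and X :: int
      using that by simp
    ultimately have "2 * int (k * (t + 1) + t) < \<bar>u - v\<bar>" using True by blast
    moreover have "test_block v j q t k = far_block v (k * (t + 1)) t"
    proof -
      have "k mod (3 * q) < q" using kr unfolding kmod by linarith
      thus ?thesis by (simp add: test_block_def)
    qed
    ultimately show ?thesis using far_block_subset_differ[OF end_le] by simp
  next
    case False
    define \<sigma> where "\<sigma> = (if u > v then 1 else - 1 :: int)"
    have kr: "3 * q * i + q \<le> k" using k False by (auto simp: helpful_def split: if_splits)
    have cp: "test_block v j q t k = side_block \<sigma> v j (k * (t + 1)) t"
    proof (cases "u > v")
      case True
      hence "k < 3 * q * i + 2 * q" using k False by (auto simp: helpful_def)
      hence "\<not> k mod (3 * q) < q" "k mod (3 * q) < 2 * q" using kr unfolding kmod by linarith+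
      thus ?thesis using True by (simp add: test_block_def \<sigma>_def)
    next
      case left: False
      hence "3 * q * i + 2 * q \<le> k" using k False by (auto simp: helpful_def)
      hence "\<not> k mod (3 * q) < q" "\<not> k mod (3 * q) < 2 * q" using kr unfolding kmod by linarith+
      thus ?thesis using left by (simp add: test_block_def \<sigma>_def)
    qed
    have "(3 * q * i + q) * (t + 1) \<le> k * (t + 1)" using kr by (rule mult_le_mono1)
    hence "\<bar>u - v\<bar> \<le> 2 * int (k * (t + 1)) + 1" using False by linarith
    moreover have "\<sigma> * (u - v) = \<bar>u - v\<bar>" by (simp add: \<sigma>_def)
    ultimately show ?thesis
      unfolding cp using u by (intro side_block_subset_differ end_le) (auto simp: \<sigma>_def)
  qed
qed

text \<open>If some window up to \<open>i\<close> is successful, the helpful blocks of every competitor contribute \<open>q * h\<close>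
  at its end, and unless the remaining coordinates contribute less than \<open>- x\<close> the score of \<open>v\<close>
  passes the threshold. Successes are independent, and the exceptional event is estimated by a
  union bound over competitors and windows.\<close>

lemma msprt_window_tail:
  assumes V: "finite V" and v: "v \<in> V" and q: "q \<ge> 1"
    and far: "far_tail t h \<ge> 1 / 4" and near: "near_tail (R + 1) t h \<ge> 1 / 4"
    and x: "ln (real (card V) / \<alpha>) \<le> real q * h - x"
  shows "measure (law (cascade v)) {y. enat (window_end q t i) < snd (msprt line_graph Q0 Q1 V R \<alpha>) y}
     \<le> (1 - (1 / 4) ^ (3 * q)) ^ (i + 1) + real (i + 1) * (real (card V) * exp (- x))"
proof -
  interpret prob_space "law (cascade v)" by (rule prob_space_law)
  let ?j = "R + 1"
  define K where "K m u = (\<Union>k\<in>helpful v q t m u. test_block v ?j q t k)" for m u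
  define rest where "rest m u = differ v u (window_end q t m) - K m u" for m u
  define bad where "bad m u = {y. LLR (cascade v) (rest m u) y < - x}" for m u
  define U where "U = {u\<in>V. \<bar>u - v\<bar> > int R}"
  let ?N = "\<Inter>m\<in>{..<i+1}. UNIV - window_success v ?j q t h m"
  let ?B = "\<Union>m\<in>{..<i+1}. \<Union>u\<in>U. bad m u"
  have U: "finite U" "card U \<le> card V" using V by (auto simp: U_def intro: card_mono)
  have badE: "bad m u \<in> events" for m u
    unfolding bad_def using LLR_less_event[OF order_refl] coord_events_subset_law by blast
  have badP: "prob (bad m u) \<le> exp (- x)" for m u
    unfolding bad_def by (rule prob_LLR_less_neg) (simp add: rest_def)
  have sub: "{y. enat (window_end q t i) < snd (msprt line_graph Q0 Q1 V R \<alpha>) y} \<subseteq> ?N \<union> ?B"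
  proof
    fix y assume "y \<in> {y. enat (window_end q t i) < snd (msprt line_graph Q0 Q1 V R \<alpha>) y}"
    hence T: "enat (window_end q t i) < snd (msprt line_graph Q0 Q1 V R \<alpha>) y" by simp
    show "y \<in> ?N \<union> ?B"
    proof (rule ccontr)
      assume "y \<notin> ?N \<union> ?B"
      hence "y \<notin> ?N" "y \<notin> ?B" by blast+
      from this(1) obtain m where m': "m \<in> {..<i+1}" "y \<in> window_success v ?j q t h m"
        unfolding INT_iff by blast
      hence nb: "\<And>u. u \<in> U \<Longrightarrow> y \<notin> bad m u" using \<open>y \<notin> ?B\<close> by blast
      have m: "m \<le> i" "y \<in> window_success v ?j q t h m" using m' by auto
      have "window_end q t m \<le> window_end q t i"
        unfolding window_end_def using m(1) by (intro diff_le_mono mult_le_mono) auto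
      hence "enat (window_end q t m) < snd (msprt line_graph Q0 Q1 V R \<alpha>) y"
        using T by (meson enat_ord_simps(1) le_less_trans)
      from msprt_exceeds[OF v this] obtain u where u: "u \<in> V" "\<bar>u - v\<bar> > int R"
        "LLR (cascade v) (differ v u (window_end q t m)) y < ln (real (card V) / \<alpha>)" by blast
      have sb: "K m u \<subseteq> differ v u (window_end q t m)"
        unfolding K_def by (rule helpful_copies_subset_differ[OF q]) (use u in auto)
      have "LLR (cascade v) (K m u) y = (\<Sum>k\<in>helpful v q t m u. LLR (cascade v) (test_block v ?j q t k) y)"
        unfolding LLR_def K_def
      proof (rule sum.UNION_disjoint)
        show "finite (helpful v q t m u)" by (simp add: helpful_def)
        show "\<forall>k\<in>helpful v q t m u. finite (test_block v ?j q t k)" by (simp add: finite_test_block)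
        show "\<forall>k\<in>helpful v q t m u. \<forall>l\<in>helpful v q t m u. k \<noteq> l \<longrightarrow> test_block v ?j q t k \<inter> test_block v ?j q t l = {}"
          using disjoint_test_block[of v ?j q t UNIV] by (auto simp: disjoint_family_on_def)
      qed
      also have "\<dots> \<ge> (\<Sum>k\<in>helpful v q t m u. h)"
      proof (rule sum_mono)
        fix k assume "k \<in> helpful v q t m u"
        hence "k \<in> {3 * q * m..<3 * q * (m + 1)}" using helpful_subset by blast
        thus "h \<le> LLR (cascade v) (test_block v ?j q t k) y"
          using m(2) by (auto simp: window_success_def less_imp_le)
      qed
      finally have "real q * h \<le> LLR (cascade v) (K m u) y" by (simp add: card_helpful)
      moreover have "- x \<le> LLR (cascade v) (rest m u) y"
        using nb[of u] u by (auto simp: bad_def U_def not_less)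
      moreover have "LLR (cascade v) (differ v u (window_end q t m)) y = LLR (cascade v) (K m u) y + LLR (cascade v) (rest m u) y"
        unfolding rest_def by (rule LLR_diff[OF finite_differ sb])
      ultimately show False using u(3) x by linarith
    qed
  qed
  have NE: "?N \<in> events" by (rule no_success_prob(2)[OF far near])
  have BE: "?B \<in> events" using badE U by (intro sets.finite_UN) auto
  have "prob {y. enat (window_end q t i) < snd (msprt line_graph Q0 Q1 V R \<alpha>) y} \<le> prob (?N \<union> ?B)"
    by (rule finite_measure_mono[OF sub]) (use NE BE in auto)
  also have "\<dots> \<le> prob ?N + prob ?B" by (rule measure_Un_le[OF NE BE])
  also have "prob ?N \<le> (1 - (1 / 4) ^ (3 * q)) ^ (i + 1)" by (rule no_success_prob(1)[OF far near])
  also have "prob ?B \<le> (\<Sum>m\<in>{..<i+1}. prob (\<Union>u\<in>U. bad m u))"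
    using badE U by (intro finite_measure_subadditive_finite) auto
  also have "\<dots> \<le> (\<Sum>m\<in>{..<i+1}. real (card V) * exp (- x))"
  proof (rule sum_mono)
    fix m
    have "prob (\<Union>u\<in>U. bad m u) \<le> (\<Sum>u\<in>U. prob (bad m u))"
      using badE U by (intro finite_measure_subadditive_finite) auto
    also have "\<dots> \<le> (\<Sum>u\<in>U. exp (- x))" by (rule sum_mono) (rule badP)
    also have "\<dots> \<le> real (card V) * exp (- x)" using U by (simp add: mult_right_mono)
    finally show "prob (\<Union>u\<in>U. bad m u) \<le> real (card V) * exp (- x)" .
  qed
  finally show ?thesis by simp
qed

end

section \<open>Expected delay of the MSPRT\<close>

text \<open>The comparison is inherited from inequalities with factor \<open>1 + \<epsilon>\<close>. They bound the
  quotient also where the denominator is \<open>0\<close> or \<open>\<infinity>\<close>, since \<open>0 / 0\<close> and \<open>x / \<infinity>\<close> are \<open>0\<close>.\<close>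

lemma lesssimI:
  assumes "\<And>\<epsilon>. 0 < \<epsilon> \<Longrightarrow> \<epsilon> < 1 \<Longrightarrow>
     \<forall>\<^sub>F \<alpha> in at_right 0. \<forall>\<^sub>F n in sequentially. g n \<alpha> \<le> ennreal (1 + \<epsilon>) * h n \<alpha>"
  shows "lesssim g h"
proof -
  have div: "a / b \<le> c" if "a \<le> c * b" for a b c :: ennreal
  proof (cases "b = 0 \<or> b = top")
    case True
    thus ?thesis using that by (auto simp: divide_ennreal_def)
  next
    case False
    hence "a / b \<le> c * b / b" using that by (intro divide_right_mono_ennreal)
    also have "\<dots> = c" using False by (simp add: ennreal_mult_divide_eq)
    finally show ?thesis .
  qed
  have step: "Limsup (at_right 0) (\<lambda>\<alpha>. limsup (\<lambda>n. g n \<alpha> / h n \<alpha>)) \<le> ennreal (1 + \<epsilon>)" if "0 < \<epsilon>" "\<epsilon> < 1" for \<epsilon>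
  proof (rule Limsup_bounded)
    show "\<forall>\<^sub>F \<alpha> in at_right 0. limsup (\<lambda>n. g n \<alpha> / h n \<alpha>) \<le> ennreal (1 + \<epsilon>)"
      using assms[OF that]
    proof eventually_elim
      fix \<alpha> assume "\<forall>\<^sub>F n in sequentially. g n \<alpha> \<le> ennreal (1 + \<epsilon>) * h n \<alpha>"
      hence "\<forall>\<^sub>F n in sequentially. g n \<alpha> / h n \<alpha> \<le> ennreal (1 + \<epsilon>)"
        by eventually_elim (rule div)
      thus "limsup (\<lambda>n. g n \<alpha> / h n \<alpha>) \<le> ennreal (1 + \<epsilon>)" by (rule Limsup_bounded)
    qed
  qed
  have "Limsup (at_right 0) (\<lambda>\<alpha>. limsup (\<lambda>n. g n \<alpha> / h n \<alpha>)) \<le> 1 + ennreal e" if "0 < e" for e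
  proof -
    have "Limsup (at_right 0) (\<lambda>\<alpha>. limsup (\<lambda>n. g n \<alpha> / h n \<alpha>)) \<le> ennreal (1 + min (e / 2) (1 / 2))"
      using that by (intro step) (auto simp: min_def)
    also have "\<dots> \<le> ennreal (1 + e)" using that by (intro ennreal_leI) auto
    also have "\<dots> = 1 + ennreal e" using that by (simp add: ennreal_plus)
    finally show ?thesis .
  qed
  note eps = this
  have "Limsup (at_right 0) (\<lambda>\<alpha>. limsup (\<lambda>n. g n \<alpha> / h n \<alpha>)) \<le> 1"
    by (rule ennreal_le_epsilon) (rule eps)
  thus ?thesis unfolding lesssim_def .
qed

context mutual_ac_laws
begin

lemma near_tail_antimono: "x \<le> y \<Longrightarrow> near_tail j t y \<le> near_tail j t x"
  unfolding near_tail_def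
proof -
  assume "x \<le> y"
  interpret prob_space "law (cascade 0)" by (rule prob_space_law)
  have "{z. x < LLR (cascade 0) (differ 0 (int j) t) z} \<in> events"
    using LLR_events[of "{x<..}" _ _ "cascade 0", OF _ order_refl] coord_events_subset_law by fastforce
  thus "prob {z. y < LLR (cascade 0) (differ 0 (int j) t) z} \<le> prob {z. x < LLR (cascade 0) (differ 0 (int j) t) z}"
    using \<open>x \<le> y\<close> by (intro finite_measure_mono) auto
qed

lemma far_tail_antimono: "x \<le> y \<Longrightarrow> far_tail t y \<le> far_tail t x"
  unfolding far_tail_def
proof -
  assume "x \<le> y"
  interpret prob_space "law (cascade 0)" by (rule prob_space_law)
  have "{z. x < LLR (cascade 0) (light_cone 0 t) z} \<in> events"
    using LLR_events[of "{x<..}" _ _ "cascade 0", OF _ order_refl] coord_events_subset_law by fastforce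
  thus "prob {z. y < LLR (cascade 0) (light_cone 0 t) z} \<le> prob {z. x < LLR (cascade 0) (light_cone 0 t) z}"
    using \<open>x \<le> y\<close> by (intro finite_measure_mono) auto
qed

lemma prob_LLR_greater:
  assumes "finite K"
  shows "1 - exp ((x + 1) / 2) * affinity ^ card K \<le> measure (law A) {y. x < LLR A K y}"
proof -
  interpret prob_space "law A" by (rule prob_space_law)
  have ev: "{y. x < LLR A K y} \<in> events"
    using LLR_events[of "{x<..}" K K A] coord_events_subset_law by fastforce
  have ev': "{y. LLR A K y < x + 1} \<in> events"
    using LLR_less_event[OF order_refl] coord_events_subset_law by blast
  have "1 - prob {y. x < LLR A K y} = prob (space (law A) - {y. x < LLR A K y})"
    using prob_compl[OF ev] by simp
  also have "\<dots> \<le> prob {y. LLR A K y < x + 1}"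
    using ev' by (intro finite_measure_mono) auto
  also have "\<dots> \<le> exp ((x + 1) / 2) * affinity ^ card K" by (rule prob_LLR_less[OF assms])
  finally show ?thesis by simp
qed

lemma far_tail_ge: "1 - exp ((x + 1) / 2) * affinity ^ t \<le> far_tail t x"
proof -
  have "1 - exp ((x + 1) / 2) * affinity ^ t \<le> 1 - exp ((x + 1) / 2) * affinity ^ ((t + 1)\<^sup>2)"
    using affinity_pos affinity_less_1
    by (intro diff_left_mono mult_left_mono power_decreasing) (auto simp: power2_eq_square)
  also have "\<dots> \<le> far_tail t x"
    unfolding far_tail_def using prob_LLR_greater[of "light_cone 0 t" x "cascade 0"] by (simp add: card_light_cone)
  finally show ?thesis .
qed

lemma near_tail_ge:
  assumes "1 \<le> j" shows "1 - exp ((x + 1) / 2) * affinity ^ t \<le> near_tail j t x"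
proof -
  have "t \<le> f_line (nat \<bar>int j - 0\<bar>) t" using f_line_ge[OF assms, of t] by simp
  also have "\<dots> \<le> card (differ 0 (int j) t)"
    unfolding card_differ_Int[symmetric] by (rule card_mono) auto
  finally have "1 - exp ((x + 1) / 2) * affinity ^ t \<le> 1 - exp ((x + 1) / 2) * affinity ^ card (differ 0 (int j) t)"
    using affinity_pos affinity_less_1 by (intro diff_left_mono mult_left_mono power_decreasing) auto
  also have "\<dots> \<le> near_tail j t x"
    unfolding near_tail_def by (rule prob_LLR_greater) simp
  finally show ?thesis .
qed

text \<open>For \<open>j > 2 t\<close> the two light cones are disjoint, and the cone of the competitor can only lower the
  log-likelihood ratio by a little. So the far requirement implies the near one at large distances.\<close>

lemma near_tail_ge_far_tail:
  assumes "2 * t < j"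
  shows "far_tail t (x + z) - exp (- z) \<le> near_tail j t x"
proof -
  interpret prob_space "law (cascade 0)" by (rule prob_space_law)
  let ?D = "differ 0 (int j) t" and ?C = "light_cone 0 t"
  have CD: "?C \<subseteq> ?D" using assms by (auto simp: differ_def cascade_def horizon_def)
  have ev: "{y. x + z < LLR (cascade 0) ?C y} \<in> events" "{y. x < LLR (cascade 0) ?D y} \<in> events"
    "{y. LLR (cascade 0) (?D - ?C) y < - z} \<in> events"
    using LLR_events[of "{x+z<..}" ?C ?C "cascade 0"] LLR_events[of "{x<..}" ?D ?D "cascade 0"]
      LLR_events[of "{..<-z}" "?D - ?C" "?D - ?C" "cascade 0"] coord_events_subset_law by fastforce+
  have "far_tail t (x + z) \<le> prob ({y. x < LLR (cascade 0) ?D y} \<union> {y. LLR (cascade 0) (?D - ?C) y < - z})"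
    unfolding far_tail_def
    using LLR_diff[OF finite_differ CD, of "cascade 0"] ev by (intro finite_measure_mono) fastforce+
  also have "\<dots> \<le> near_tail j t x + prob {y. LLR (cascade 0) (?D - ?C) y < - z}"
    unfolding near_tail_def using ev(2,3) by (rule measure_Un_le)
  also have "prob {y. LLR (cascade 0) (?D - ?C) y < - z} \<le> exp (- z)"
    by (rule prob_LLR_less_neg) simp
  finally show ?thesis by simp
qed

lemma far_tail_0_small: "e > 0 \<Longrightarrow> \<exists>H. \<forall>x\<ge>H. far_tail 0 x < e"
proof -
  assume e: "e > 0"
  interpret prob_space "law (cascade 0)" by (rule prob_space_law)
  let ?S = "\<lambda>m::nat. {y. real m < LLR (cascade 0) (light_cone 0 0) y}"
  have ev: "?S m \<in> events" for m
    using LLR_events[of "{real m<..}" _ _ "cascade 0", OF _ order_refl] coord_events_subset_law by fastforce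
  have "(\<lambda>m. prob (?S m)) \<longlonglongrightarrow> prob (\<Inter>m. ?S m)"
    using ev by (intro finite_Lim_measure_decseq) (auto simp: decseq_def)
  moreover have "(\<Inter>m. ?S m) = {}"
  proof -
    have "\<exists>m. y \<notin> ?S m" for y
      using real_arch_simple[of "LLR (cascade 0) (light_cone 0 0) y"] by (auto simp: not_less)
    thus ?thesis by blast
  qed
  ultimately have "(\<lambda>m. prob (?S m)) \<longlonglongrightarrow> 0" by simp
  hence "\<forall>\<^sub>F m in sequentially. prob (?S m) < e" using e by (auto simp: order_tendsto_iff)
  then obtain m where "prob (?S m) < e" by (auto simp: eventually_sequentially)
  hence "\<forall>x\<ge>real m. far_tail 0 x < e"
    using far_tail_antimono[of "real m" _ 0] by (fastforce simp: far_tail_def)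
  thus ?thesis by blast
qed

text \<open>The delay is the sum over \<open>s\<close> of the probabilities that it exceeds \<open>s\<close>: the first \<open>L\<close> windows
  are treated by \<open>msprt_window_tail\<close> and later times by \<open>msprt_tail\<close>.\<close>

lemma msprt_delay_le:
  assumes V: "finite V" and v: "v \<in> V" and q: "q \<ge> 1" and \<alpha>: "0 < \<alpha>"
    and far: "far_tail t h \<ge> 1 / 4" and near: "near_tail (R + 1) t h \<ge> 1 / 4"
    and x: "ln (real (card V) / \<alpha>) \<le> real q * h - x"
    and w: "w = 3 * q * (t + 1)" and c: "c = (1 / 4 :: real) ^ (3 * q)"
  shows "(\<integral>\<^sup>+y. ennreal_of_enat (snd (msprt line_graph Q0 Q1 V R \<alpha>) y) \<partial>law (cascade v))
    \<le> ennreal (real w / c + real (w * L) * (real L * (real (card V) * exp (- x)))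
        + real (card V) * (sqrt (real (card V) / \<alpha>) * affinity ^ (w * L)) / (1 - affinity))"
proof -
  interpret prob_space "law (cascade v)" by (rule prob_space_law)
  let ?T = "snd (msprt line_graph Q0 Q1 V R \<alpha>)"
  define \<delta> where "\<delta> = real L * (real (card V) * exp (- x))"
  define B where "B = real (card V) * sqrt (real (card V) / \<alpha>)"
  have V0: "V \<noteq> {}" using v by auto
  have c01: "0 < c" "c \<le> 1" unfolding c by (auto intro: power_le_one)
  have w0: "0 < w" using q by (simp add: w)
  have B0: "0 \<le> B" using \<alpha> by (simp add: B_def)
  have \<delta>0: "0 \<le> \<delta>" by (simp add: \<delta>_def)
  have r: "0 \<le> affinity" "affinity < 1" using affinity_pos affinity_less_1 by auto
  define a where "a s = (if s < w * L then (1 - c) ^ (s div w) + \<delta> else B * affinity ^ s)" for s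
  have a0: "0 \<le> a s" for s using c01 \<delta>0 B0 r by (simp add: a_def)
  have Pa: "prob {y. enat s < ?T y} \<le> a s" for s
  proof (cases "s < w * L")
    case True
    show ?thesis
    proof (cases "s div w")
      case 0
      have "prob {y. enat s < ?T y} \<le> 1" by (rule prob_le_1)
      moreover have "1 \<le> a s" using True 0 \<delta>0 by (simp add: a_def)
      ultimately show ?thesis by linarith
    next
      case (Suc i)
      have "Suc i * w \<le> s" using Suc by (metis div_times_less_eq_dividend)
      hence we: "window_end q t i \<le> s" by (simp add: window_end_def w algebra_simps)
      have iL: "i + 1 \<le> L" using True Suc w0
        by (metis Suc_eq_plus1 less_imp_le_nat less_mult_imp_div_less mult.commute)
      have "{y. enat s < ?T y} \<subseteq> {y. enat (window_end q t i) < ?T y}"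
        using we by (auto elim: order.strict_trans1[rotated])
      moreover have "{y. enat (window_end q t i) < ?T y} \<in> events"
      proof -
        have "{y. ?T y \<le> enat (window_end q t i)} \<in> events"
          using stopped_event[OF msprt_seq_estimator[OF V V0]] coord_events_subset_law by blast
        from sets.compl_sets[OF this] show ?thesis by (simp add: Collect_neg_eq[symmetric] Compl_eq_Diff_UNIV[symmetric] not_le)
      qed
      ultimately have "prob {y. enat s < ?T y} \<le> prob {y. enat (window_end q t i) < ?T y}"
        by (rule finite_measure_mono)
      also have "\<dots> \<le> (1 - c) ^ (i + 1) + real (i + 1) * (real (card V) * exp (- x))"
        unfolding c by (rule msprt_window_tail[OF V v q far near x])
      also have "real (i + 1) * (real (card V) * exp (- x)) \<le> \<delta>"
        unfolding \<delta>_def using iL by (intro mult_right_mono) auto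
      finally show ?thesis using True Suc by (simp add: a_def)
    qed
  next
    case False
    thus ?thesis using msprt_tail[OF V v \<alpha>, of s R] by (simp add: a_def B_def mult.assoc)
  qed
  have sum_a: "(\<Sum>s<N. a s) \<le> real w / c + real (w * L) * \<delta> + B * affinity ^ (w * L) / (1 - affinity)" for N
  proof -
    have "(\<Sum>s<N. a s) \<le> (\<Sum>s<w * L + N. a s)"
      by (rule sum_mono2) (use a0 in auto)
    moreover have "(\<Sum>s<w * L + N. a s) = (\<Sum>s<w * L. a s) + (\<Sum>s<N. a (w * L + s))"
      by (induction N) simp_all
    moreover have "(\<Sum>s<w * L. a s) \<le> real w / c + real (w * L) * \<delta>"
    proof -
      have blk: "(\<Sum>s\<in>{i * w..<i * w + w}. a s) = real w * ((1 - c) ^ i + \<delta>)" if i: "i < L" for i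
      proof -
        have "(\<Sum>s\<in>{i * w..<i * w + w}. a s) = (\<Sum>s\<in>{i * w..<i * w + w}. (1 - c) ^ i + \<delta>)"
        proof (rule sum.cong[OF refl])
          fix s assume s: "s \<in> {i * w..<i * w + w}"
          have "s div w = i" using s by (intro div_nat_eqI) (auto simp: mult.commute)
          moreover have "s < w * L"
          proof -
            have "(i + 1) * w \<le> L * w" using i by (intro mult_le_mono1) simp
            thus ?thesis using s by (simp add: mult.commute)
          qed
          ultimately show "a s = (1 - c) ^ i + \<delta>" by (simp add: a_def)
        qed
        thus ?thesis by simp
      qed
      have "(\<Sum>s<w * L. a s) = (\<Sum>i<L. \<Sum>s\<in>{i * w..<i * w + w}. a s)"
        using sum.nat_group[of a w L] by (simp add: mult.commute)
      also have "\<dots> = (\<Sum>i<L. real w * ((1 - c) ^ i + \<delta>))" by (rule sum.cong) (auto simp: blk)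
      also have "\<dots> = real w * (\<Sum>i<L. (1 - c) ^ i) + real (w * L) * \<delta>"
        by (simp add: sum_distrib_left[symmetric] sum.distrib algebra_simps)
      also have "(\<Sum>i<L. (1 - c) ^ i) = (1 - (1 - c) ^ L) / c"
        using c01 by (subst sum_gp_strict) auto
      also have "\<dots> \<le> 1 / c" using c01 by (intro divide_right_mono) auto
      finally show ?thesis by (simp add: mult_left_mono)
    qed
    moreover have "(\<Sum>s<N. a (w * L + s)) \<le> B * affinity ^ (w * L) / (1 - affinity)"
    proof -
      have "(\<Sum>s<N. a (w * L + s)) = B * affinity ^ (w * L) * (\<Sum>s<N. affinity ^ s)"
        by (simp add: a_def power_add sum_distrib_left mult.assoc)
      also have "(\<Sum>s<N. affinity ^ s) = (1 - affinity ^ N) / (1 - affinity)"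
        using r by (subst sum_gp_strict) auto
      also have "\<dots> \<le> 1 / (1 - affinity)" using r by (intro divide_right_mono) auto
      finally show ?thesis using B0 r by (simp add: mult_left_mono)
    qed
    ultimately show ?thesis by linarith
  qed
  have "(\<integral>\<^sup>+y. ennreal_of_enat (?T y) \<partial>law (cascade v)) = (\<Sum>s. emeasure (law (cascade v)) {y. enat s < ?T y})"
    by (rule msprt_delay_suminf[OF V V0])
  also have "\<dots> \<le> ennreal (real w / c + real (w * L) * \<delta> + B * affinity ^ (w * L) / (1 - affinity))"
  proof (rule suminf_le_const[OF summableI])
    fix N
    have "(\<Sum>s<N. emeasure (law (cascade v)) {y. enat s < ?T y}) \<le> (\<Sum>s<N. ennreal (a s))"
      using Pa by (intro sum_mono) (simp add: emeasure_eq_measure ennreal_leI)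
    also have "\<dots> = ennreal (\<Sum>s<N. a s)" using a0 by (intro sum_ennreal) auto
    also have "\<dots> \<le> ennreal (real w / c + real (w * L) * \<delta> + B * affinity ^ (w * L) / (1 - affinity))"
      by (rule ennreal_leI) (rule sum_a)
    finally show "(\<Sum>s<N. emeasure (law (cascade v)) {y. enat s < ?T y})
       \<le> ennreal (real w / c + real (w * L) * \<delta> + B * affinity ^ (w * L) / (1 - affinity))" .
  qed
  finally show ?thesis by (simp add: \<delta>_def B_def mult.assoc)
qed

end

section \<open>Transfer to asymptotic comparisons\<close>

lemma eventually_small_ratio:
  assumes "(\<lambda>n. real (R n) / real n) \<longlonglongrightarrow> 0" "0 < e"
  shows "\<forall>\<^sub>F n in sequentially. real (R n) \<le> e * real n"
proof -
  have "\<forall>\<^sub>F n in sequentially. real (R n) / real n < e"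
    using assms by (auto simp: order_tendsto_iff)
  thus ?thesis using eventually_gt_at_top[of 0]
    by eventually_elim (simp add: field_simps)
qed

context mutual_ac_laws
begin

text \<open>If the mean of the log-likelihood ratio against distance \<open>R + 1\<close>, enlarged by a factor \<open>1 + \<eta>\<close>, is
  below \<open>(1 - \<eta>) ln n\<close> at time \<open>t\<close>, then by the weak law an estimator cannot stop by time \<open>t\<close>. The
  radius condition makes the number \<open>R + 1\<close> of outputs on one side negligible against
  \<open>exp (\<eta> * ln n)\<close>.\<close>

lemma T_star_lower:
  fixes t R :: "nat \<Rightarrow> nat"
  assumes int: "integrable Q1 (log_lr Q0 Q1)" "integrable Q0 (log_lr Q1 Q0)"
    and D: "D = (\<integral>x. log_lr Q0 Q1 x \<partial>Q1) + (\<integral>x. log_lr Q1 Q0 x \<partial>Q0)" "0 < D"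
    and \<eta>: "0 < \<eta>" and \<alpha>: "0 \<le> \<alpha>" "\<alpha> \<le> \<eta>" "\<alpha> \<le> 1"
    and S: "source_setup line_graph v0 V R"
    and small: "(\<lambda>n. real (R n) / real n) \<longlonglongrightarrow> 0"
    and t: "filterlim t at_top sequentially"
    and budget: "\<forall>\<^sub>F n in sequentially. real (f_line (R n + 1) (t n)) * (D * (1 + \<eta>)) \<le> (1 - \<eta>) * ln (real n)"
    and radius: "\<forall>\<^sub>F n in sequentially. real (R n) \<le> exp (\<eta> / 2 * ln (real n))"
  shows "\<forall>\<^sub>F n in sequentially. ennreal (real (t n + 1) * (1 - 5 * \<eta>)) \<le> T_star line_graph Q0 Q1 (V n) (R n) \<alpha>"
proof -
  obtain N where N: "\<And>k A (K :: (nat \<times> int) set). N \<le> k \<Longrightarrow> finite K \<Longrightarrow> card (K \<inter> A) = k \<Longrightarrow> card (K - A) = k \<Longrightarrow>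
     measure (law A) {y. real k * (D + D * \<eta>) < LLR A K y} \<le> \<eta>"
  proof -
    have "0 < D * \<eta>" using D(2) \<eta> by simp
    from LLR_weak_law[where 'i="nat \<times> int", OF int D(1) this \<eta>]
    show thesis using that by blast
  qed
  have e1: "\<forall>\<^sub>F n in sequentially. 2 * exp (- (\<eta> / 2 * ln (real n))) \<le> \<eta>"
  proof -
    have "filterlim (\<lambda>n. \<eta> / 2 * ln (real n)) at_top sequentially"
      using \<eta> by (intro filterlim_tendsto_pos_mult_at_top[OF tendsto_const]
        filterlim_compose[OF ln_at_top filterlim_real_sequentially]) auto
    hence "(\<lambda>n. 2 * exp (- (\<eta> / 2 * ln (real n)))) \<longlonglongrightarrow> 2 * 0"
      by (intro tendsto_mult tendsto_const filterlim_compose[OF exp_at_bot] filterlim_compose[OF filterlim_uminus_at_bot_at_top])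
    hence "\<forall>\<^sub>F n in sequentially. 2 * exp (- (\<eta> / 2 * ln (real n))) < \<eta>"
      using \<eta> by (auto simp: order_tendsto_iff)
    thus ?thesis by eventually_elim simp
  qed
  have e2: "\<forall>\<^sub>F n in sequentially. real (R n) \<le> 1 / 8 * real n"
    by (rule eventually_small_ratio[OF small]) simp
  show ?thesis
    using e2 budget radius e1 eventually_gt_at_top[of 16]
      filterlim_at_top[THEN iffD1, OF t, rule_format, of N]
  proof eventually_elim
    case (elim n)
    let ?x = "(1 - \<eta>) * ln (real n)"
    have V: "closest_vertices line_graph v0 n (V n)" and R0: "0 < R n"
      using S by (auto simp: source_setup_def)
    have "real (2 * (R n + 1)) < real n" using elim(1,5) by simp
    hence R: "2 * (R n + 1) < n" by (simp only: of_nat_less_iff)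
    have f: "N \<le> f_line (R n + 1) (t n)" using f_line_ge[of "R n + 1" "t n"] elim(6) by simp
    have "near_tail (R n + 1) (t n) ?x \<le> near_tail (R n + 1) (t n) (real (f_line (R n + 1) (t n)) * (D + D * \<eta>))"
      using elim(2) by (intro near_tail_antimono) (simp add: algebra_simps)
    also have "\<dots> \<le> \<eta>"
    proof -
      have "card (differ 0 (int j) k \<inter> cascade 0) = f_line j k" "card (differ 0 (int j) k - cascade 0) = f_line j k" for j k
        by (simp_all add: card_differ_Int card_differ_minus)
      from N[OF f finite_differ this] show ?thesis unfolding near_tail_def .
    qed
    finally have nt: "near_tail (R n + 1) (t n) ?x \<le> \<eta>" .
    have "exp ?x * (real (R n + 1) * (\<alpha> / real n)) \<le> \<eta>"
    proof -
      have "exp ?x = exp (ln (real n) + - (\<eta> * ln (real n)))" by (simp add: algebra_simps)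
      also have "\<dots> = real n * exp (- (\<eta> * ln (real n)))" using elim(5) by (simp only: exp_add) simp
      finally have "exp ?x / real n = exp (- (\<eta> * ln (real n)))" using elim(5) by simp
      moreover have "real (R n + 1) * \<alpha> \<le> 2 * exp (\<eta> / 2 * ln (real n))"
      proof -
        have "real (R n + 1) * \<alpha> \<le> real (R n + 1) * 1" using \<alpha> by (intro mult_left_mono) auto
        also have "\<dots> \<le> 2 * exp (\<eta> / 2 * ln (real n))" using elim(3) R0 by simp
        finally show ?thesis .
      qed
      ultimately have "(exp ?x / real n) * (real (R n + 1) * \<alpha>) \<le> exp (- (\<eta> * ln (real n))) * (2 * exp (\<eta> / 2 * ln (real n)))"
        using \<alpha> by (simp only: mult_left_mono exp_ge_zero)
      also have "\<dots> = 2 * exp (- (\<eta> / 2 * ln (real n)))"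
        by (simp add: exp_add[symmetric] algebra_simps)
      finally show ?thesis using elim(4) by (simp add: field_simps)
    qed
    hence "1 - 5 * \<eta> \<le> 1 - (\<alpha> + 2 * (exp ?x * (real (R n + 1) * (\<alpha> / real n))) + 2 * near_tail (R n + 1) (t n) ?x)"
      using nt \<alpha> by linarith
    hence "ennreal (real (t n + 1) * (1 - 5 * \<eta>)) \<le> ennreal (real (t n + 1) *
       (1 - (\<alpha> + 2 * (exp ?x * (real (R n + 1) * (\<alpha> / real n))) + 2 * near_tail (R n + 1) (t n) ?x)))"
      by (intro ennreal_leI mult_left_mono) auto
    also have "\<dots> \<le> T_star line_graph Q0 Q1 (V n) (R n) \<alpha>"
      by (rule T_star_ge_near[OF V R \<alpha>(1)])
    finally show ?case .
  qed
qed

text \<open>The function \<open>A \<eta>\<close> bounds the times that \<open>T_star_lower\<close> allows, and \<open>b\<close> exceeds it at most by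
  the factor \<open>(1 + \<eta>) / (1 - \<eta>)\<close>, which tends to \<open>1\<close> as \<open>\<eta>\<close> tends to \<open>0\<close>.\<close>

lemma T_star_lower_lesssim:
  fixes R :: "nat \<Rightarrow> nat" and A :: "real \<Rightarrow> nat \<Rightarrow> real" and b :: "nat \<Rightarrow> real"
  assumes int: "integrable Q1 (log_lr Q0 Q1)" "integrable Q0 (log_lr Q1 Q0)"
    and D: "D = (\<integral>x. log_lr Q0 Q1 x \<partial>Q1) + (\<integral>x. log_lr Q1 Q0 x \<partial>Q0)" "0 < D"
    and S: "source_setup line_graph v0 V R"
    and small: "(\<lambda>n. real (R n) / real n) \<longlonglongrightarrow> 0"
    and A: "\<And>\<eta>. 0 < \<eta> \<Longrightarrow> \<eta> < 1 / 10 \<Longrightarrow> filterlim (A \<eta>) at_top sequentially"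
    and budget: "\<And>\<eta> n k. 0 < \<eta> \<Longrightarrow> \<eta> < 1 / 10 \<Longrightarrow> 1 < n \<Longrightarrow> real (k + 1) \<le> A \<eta> n
       \<Longrightarrow> real (f_line (R n + 1) k) * (D * (1 + \<eta>)) \<le> (1 - \<eta>) * ln (real n)"
    and radius: "\<And>\<eta>. 0 < \<eta> \<Longrightarrow> \<eta> < 1 / 10 \<Longrightarrow> \<forall>\<^sub>F n in sequentially. real (R n) \<le> exp (\<eta> / 2 * ln (real n))"
    and b: "\<And>\<eta> n. 0 < \<eta> \<Longrightarrow> \<eta> < 1 / 10 \<Longrightarrow> 1 < n \<Longrightarrow> b n * (1 - \<eta>) \<le> A \<eta> n * (1 + \<eta>)"
  shows "lesssim (\<lambda>n \<alpha>. ennreal (b n)) (\<lambda>n \<alpha>. T_star line_graph Q0 Q1 (V n) (R n) \<alpha>)"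
proof (rule lesssimI)
  fix \<epsilon> :: real assume \<epsilon>: "0 < \<epsilon>" "\<epsilon> < 1"
  (* Small enough for 1 + \<eta> \<le> (1 + \<epsilon>) (1 - 5 \<eta>) (1 - \<eta>)^2, see const below. *)
  define \<eta> where "\<eta> = \<epsilon> / 20"
  have \<eta>: "0 < \<eta>" "\<eta> < 1 / 10" using \<epsilon> by (auto simp: \<eta>_def)
  (* t n + 1, and not t n, is the lower bound for the delay. *)
  define t where "t n = nat \<lfloor>A \<eta> n\<rfloor> - 1" for n
  have big: "\<forall>\<^sub>F n in sequentially. A \<eta> n \<ge> c" for c
    using A[OF \<eta>] by (simp add: filterlim_at_top)
  have t: "filterlim t at_top sequentially"
    unfolding filterlim_at_top
  proof
    fix Z :: nat
    show "\<forall>\<^sub>F n in sequentially. Z \<le> t n"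
      using big[of "real Z + 2"] by eventually_elim (simp add: t_def, linarith)
  qed
  have b1: "\<forall>\<^sub>F n in sequentially. real (f_line (R n + 1) (t n)) * (D * (1 + \<eta>)) \<le> (1 - \<eta>) * ln (real n)"
    using big[of 1] eventually_gt_at_top[of 1]
  proof eventually_elim
    case (elim n)
    have "real (t n + 1) \<le> A \<eta> n" using elim(1) unfolding t_def by linarith
    thus ?case using budget[OF \<eta> elim(2)] by blast
  qed
  have "\<forall>\<^sub>F \<alpha> in at_right 0. 0 < \<alpha> \<and> \<alpha> < \<eta>"
    using \<eta> by (intro eventually_conj eventually_at_right_less eventually_at_right_field[THEN iffD2]) auto
  thus "\<forall>\<^sub>F \<alpha> in at_right 0. \<forall>\<^sub>F n in sequentially. ennreal (b n) \<le> ennreal (1 + \<epsilon>) * T_star line_graph Q0 Q1 (V n) (R n) \<alpha>"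
  proof eventually_elim
    fix \<alpha> assume \<alpha>: "0 < \<alpha> \<and> \<alpha> < \<eta>"
    have "\<forall>\<^sub>F n in sequentially. ennreal (real (t n + 1) * (1 - 5 * \<eta>)) \<le> T_star line_graph Q0 Q1 (V n) (R n) \<alpha>"
      by (rule T_star_lower[OF int D \<eta>(1) _ _ _ S small t b1 radius[OF \<eta>]]) (use \<alpha> \<eta> in auto)
    thus "\<forall>\<^sub>F n in sequentially. ennreal (b n) \<le> ennreal (1 + \<epsilon>) * T_star line_graph Q0 Q1 (V n) (R n) \<alpha>"
      using big[of "1 / \<eta>"] eventually_gt_at_top[of 1]
    proof eventually_elim
      case (elim n)
      have A1: "A \<eta> n \<ge> 1" using elim(2) \<eta> by (smt (verit) divide_less_eq_1_pos le_divide_eq_1_pos)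
      have "A \<eta> n * \<eta> \<ge> 1" using elim(2) \<eta> by (simp add: field_simps)
      hence "A \<eta> n * (1 - \<eta>) \<le> A \<eta> n - 1" by (simp add: algebra_simps)
      also have "\<dots> \<le> real (t n + 1)" using A1 unfolding t_def by linarith
      finally have tA: "A \<eta> n * (1 - \<eta>) \<le> real (t n + 1)" .
      have const: "1 + \<eta> \<le> (1 + \<epsilon>) * ((1 - 5 * \<eta>) * (1 - \<eta>)\<^sup>2)"
      proof -
        have "1 - 7 * \<eta> \<le> (1 - 5 * \<eta>) * (1 - \<eta>)\<^sup>2"
        proof -
          have "(1 - 5 * \<eta>) * (1 - \<eta>)\<^sup>2 - (1 - 7 * \<eta>) = \<eta>\<^sup>2 * (11 - 5 * \<eta>)"
            by (simp add: power2_eq_square algebra_simps)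
          moreover have "0 \<le> \<eta>\<^sup>2 * (11 - 5 * \<eta>)" using \<eta> by simp
          ultimately show ?thesis by linarith
        qed
        hence "(1 + 20 * \<eta>) * (1 - 7 * \<eta>) \<le> (1 + \<epsilon>) * ((1 - 5 * \<eta>) * (1 - \<eta>)\<^sup>2)"
          using \<epsilon> by (simp add: \<eta>_def mult_left_mono)
        moreover have "(1 + 20 * \<eta>) * (1 - 7 * \<eta>) = 1 + \<eta> + \<eta> * (12 - 140 * \<eta>)"
          by (simp add: algebra_simps)
        moreover have "0 \<le> \<eta> * (12 - 140 * \<eta>)" using \<epsilon> by (simp add: \<eta>_def)
        ultimately show ?thesis by linarith
      qed
      have "b n * (1 - \<eta>) \<le> A \<eta> n * (1 + \<eta>)" by (rule b[OF \<eta> elim(3)])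
      also have "\<dots> \<le> A \<eta> n * ((1 + \<epsilon>) * ((1 - 5 * \<eta>) * (1 - \<eta>)\<^sup>2))"
        using const A1 by (intro mult_left_mono) auto
      also have "\<dots> = (1 + \<epsilon>) * ((A \<eta> n * (1 - \<eta>)) * (1 - 5 * \<eta>)) * (1 - \<eta>)"
        by (simp add: power2_eq_square algebra_simps)
      also have "\<dots> \<le> (1 + \<epsilon>) * (real (t n + 1) * (1 - 5 * \<eta>)) * (1 - \<eta>)"
        using tA \<eta> \<epsilon> by (intro mult_right_mono mult_left_mono) auto
      finally have "b n \<le> (1 + \<epsilon>) * (real (t n + 1) * (1 - 5 * \<eta>))"
        using \<eta> by (simp add: mult_le_cancel_right)
      hence "ennreal (b n) \<le> ennreal (1 + \<epsilon>) * ennreal (real (t n + 1) * (1 - 5 * \<eta>))"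
        using \<epsilon> \<eta> by (subst ennreal_mult[symmetric]) (auto intro!: ennreal_leI)
      also have "\<dots> \<le> ennreal (1 + \<epsilon>) * T_star line_graph Q0 Q1 (V n) (R n) \<alpha>"
        by (rule mult_left_mono[OF elim(1)]) simp
      finally show ?case .
    qed
  qed
qed

text \<open>Since \<open>f_line\<close> increases with the distance, the smallest admissible distance \<open>R + 1\<close> is the worst.\<close>

lemma F_nbhd_line_le:
  assumes "z \<le> real (f_line (R + 1) t)" "gdist line_graph u v > R"
  shows "F_nbhd line_graph v u z \<le> t"
proof -
  have "R + 1 \<le> nat \<bar>u - v\<bar>" using assms(2) by (simp add: gdist_line_graph)
  hence "real (f_line (R + 1) t) \<le> real (f_line (nat \<bar>u - v\<bar>) t)"
    using f_line_mono[of "R + 1" "nat \<bar>u - v\<bar>" t t] by simp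
  thus ?thesis unfolding F_nbhd_def using assms(1)
    by (intro Least_le) (simp add: f_nbhd_line)
qed

lemma T_star_upper_lesssim:
  fixes R :: "nat \<Rightarrow> nat" and b :: "nat \<Rightarrow> real"
  assumes C: "msprt_constant line_graph Q0 Q1 C"
    and S: "source_setup line_graph v0 V R"
    and b: "\<And>\<epsilon>. 0 < \<epsilon> \<Longrightarrow> \<epsilon> < 1 \<Longrightarrow> \<forall>\<^sub>F n in sequentially. \<exists>t. ln (real n) / C \<le> real (f_line (R n + 1) t) \<and> real t \<le> (1 + \<epsilon>) * b n"
  shows "lesssim (\<lambda>n \<alpha>. T_star line_graph Q0 Q1 (V n) (R n) \<alpha>) (\<lambda>n \<alpha>. ennreal (b n))"
proof (rule lesssimI)
  fix \<epsilon> :: real assume \<epsilon>: "0 < \<epsilon>" "\<epsilon> < 1"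
  have "\<forall>\<^sub>F \<alpha> in at_right (0::real). 0 < \<alpha> \<and> \<alpha> < 1"
    by (intro eventually_conj eventually_at_right_less eventually_at_right_field[THEN iffD2]) (auto intro: exI[of _ 1])
  thus "\<forall>\<^sub>F \<alpha> in at_right 0. \<forall>\<^sub>F n in sequentially. T_star line_graph Q0 Q1 (V n) (R n) \<alpha> \<le> ennreal (1 + \<epsilon>) * ennreal (b n)"
  proof eventually_elim
    fix \<alpha> :: real assume \<alpha>: "0 < \<alpha> \<and> \<alpha> < 1"
    obtain err where err: "err \<longlonglongrightarrow> (0::real)" and le: "\<forall>\<^sub>F n in sequentially. \<forall>v\<in>V n.
       (\<integral>\<^sup>+ y. ennreal_of_enat (snd (msprt line_graph Q0 Q1 (V n) (R n) \<alpha>) y) \<partial>source_law line_graph Q0 Q1 v)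
       \<le> (SUP u\<in>{u\<in>V n. gdist line_graph u v > R n}. of_nat (F_nbhd line_graph v u (ln (real n) / C))) * ennreal (1 + err n)"
      using C S \<alpha> unfolding msprt_constant_def by blast
    have bb: "\<forall>\<^sub>F n in sequentially. \<exists>t. ln (real n) / C \<le> real (f_line (R n + 1) t) \<and> real t \<le> (1 + \<epsilon> / 3) * b n"
      by (rule b) (use \<epsilon> in auto)
    have "\<forall>\<^sub>F n in sequentially. err n < \<epsilon> / 3" using \<epsilon> by (intro order_tendstoD(2)[OF err]) simp
    thus "\<forall>\<^sub>F n in sequentially. T_star line_graph Q0 Q1 (V n) (R n) \<alpha> \<le> ennreal (1 + \<epsilon>) * ennreal (b n)"
      using le bb eventually_gt_at_top[of 0]
    proof eventually_elim
      case (elim n)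
      then obtain t where t: "ln (real n) / C \<le> real (f_line (R n + 1) t)" "real t \<le> (1 + \<epsilon> / 3) * b n"
        using \<epsilon> by auto
      have V: "finite (V n)" "card (V n) = n" using S by (auto simp: source_setup_def closest_vertices_def)
      hence V0: "V n \<noteq> {}" using elim(4) by auto
      have "0 \<le> (1 + \<epsilon> / 3) * b n" by (rule order_trans[OF of_nat_0_le_iff t(2)])
      hence b0: "0 \<le> b n" using \<epsilon> by (simp add: zero_le_mult_iff)
      have "T_star line_graph Q0 Q1 (V n) (R n) \<alpha> \<le> worst_delay line_graph Q0 Q1 (V n) (msprt line_graph Q0 Q1 (V n) (R n) \<alpha>)"
        by (rule T_star_le_msprt[OF V(1) V0]) (use \<alpha> in simp)
      also have "\<dots> \<le> ennreal (1 + \<epsilon>) * ennreal (b n)"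
        unfolding worst_delay_msprt
      proof (rule SUP_least)
        fix v assume v: "v \<in> V n"
        have "(\<integral>\<^sup>+y. ennreal_of_enat (snd (msprt line_graph Q0 Q1 (V n) (R n) \<alpha>) y) \<partial>law (cascade v))
          \<le> (SUP u\<in>{u\<in>V n. gdist line_graph u v > R n}. of_nat (F_nbhd line_graph v u (ln (real n) / C))) * ennreal (1 + err n)"
          using elim(2) v by (simp add: source_law_eq)
        also have "\<dots> \<le> ennreal (real t) * ennreal (1 + \<epsilon> / 3)"
        proof (rule mult_mono)
          show "(SUP u\<in>{u\<in>V n. gdist line_graph u v > R n}. of_nat (F_nbhd line_graph v u (ln (real n) / C))) \<le> ennreal (real t)"
          proof (rule SUP_least)
            fix u assume "u \<in> {u\<in>V n. gdist line_graph u v > R n}"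
            hence "F_nbhd line_graph v u (ln (real n) / C) \<le> t" by (intro F_nbhd_line_le[OF t(1)]) simp
            thus "of_nat (F_nbhd line_graph v u (ln (real n) / C)) \<le> ennreal (real t)"
              by (simp add: ennreal_of_nat_eq_real_of_nat ennreal_leI)
          qed
        qed (use elim(1) in \<open>auto intro: ennreal_leI\<close>)
        also have "\<dots> = ennreal (real t * (1 + \<epsilon> / 3))" using \<epsilon> by (simp add: ennreal_mult)
        also have "\<dots> \<le> ennreal ((1 + \<epsilon>) * b n)"
        proof (rule ennreal_leI)
          have "real t * (1 + \<epsilon> / 3) \<le> ((1 + \<epsilon> / 3) * b n) * (1 + \<epsilon> / 3)"
            using t(2) \<epsilon> by (intro mult_right_mono) auto
          also have "\<dots> = (1 + \<epsilon> / 3)\<^sup>2 * b n" by (simp add: power2_eq_square)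
          also have "\<dots> \<le> (1 + \<epsilon>) * b n"
          proof (rule mult_right_mono[OF _ b0])
            have "(1 + \<epsilon>) - (1 + \<epsilon> / 3)\<^sup>2 = \<epsilon> / 3 * (1 - \<epsilon> / 3)"
              by (simp add: power2_eq_square field_simps)
            moreover have "0 \<le> \<epsilon> / 3 * (1 - \<epsilon> / 3)" using \<epsilon> by simp
            ultimately show "(1 + \<epsilon> / 3)\<^sup>2 \<le> 1 + \<epsilon>" by linarith
          qed
          finally show "real t * (1 + \<epsilon> / 3) \<le> (1 + \<epsilon>) * b n" .
        qed
        also have "\<dots> = ennreal (1 + \<epsilon>) * ennreal (b n)" using \<epsilon> b0 by (simp add: ennreal_mult)
        finally show "(\<integral>\<^sup>+y. ennreal_of_enat (snd (msprt line_graph Q0 Q1 (V n) (R n) \<alpha>) y) \<partial>law (cascade v))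
          \<le> ennreal (1 + \<epsilon>) * ennreal (b n)" .
      qed
      finally show ?case .
    qed
  qed
qed

end

section \<open>Optimality of the MSPRT up to a constant factor\<close>

lemma f_line_lower: "real j * (real (t + 1) - real j) \<le> real (f_line j t)"
proof (cases "j \<le> t")
  case True
  have "(\<Sum>s\<in>{j..t}. j) \<le> (\<Sum>s\<in>{j..t}. min j (2 * s + 1))" by (rule sum_mono) auto
  also have "\<dots> \<le> f_line j t" unfolding f_line_def by (rule sum_mono2) auto
  finally have "j * (t + 1 - j) \<le> f_line j t" by (simp add: mult.commute)
  hence "real (j * (t + 1 - j)) \<le> real (f_line j t)" by (simp only: of_nat_le_iff)
  moreover have "real (t + 1 - j) = real (t + 1) - real j" using True by (intro of_nat_diff) simp
  ultimately show ?thesis by (simp only: of_nat_mult)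
next
  case False
  hence "real j * (real (t + 1) - real j) \<le> 0" by (intro mult_nonneg_nonpos) auto
  thus ?thesis by (rule order_trans) simp
qed

lemma ln_real_at_top: "filterlim (\<lambda>n. ln (real n)) at_top sequentially"
  by (rule filterlim_compose[OF ln_at_top filterlim_real_sequentially])

lemma eventually_ln_ge: "\<forall>\<^sub>F n in sequentially. c \<le> ln (real n)"
  using ln_real_at_top by (simp add: filterlim_at_top)

context mutual_ac_laws
begin

text \<open>The comparison for each fixed large \<open>n\<close>. In the constant, \<open>1 / c\<close> bounds the expected number of
  windows until the first success, \<open>1\<close> stands for the exceptional event of \<open>msprt_window_tail\<close>, and
  \<open>1 / (1 - affinity)\<close> for the Hellinger tail.\<close>

lemma msprt_delay_le_T_star:
  fixes n :: nat
  defines "\<kappa> \<equiv> 1 / (- ln affinity)" and "c \<equiv> (1 / 4 :: real) ^ 120" and "lam \<equiv> ln (real n)"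
  assumes V: "closest_vertices line_graph v0 n V" and R0: "16 * real R \<le> real n"
    and \<alpha>: "0 < \<alpha>" "\<alpha> \<le> 1 / 20" "1 / \<alpha> \<le> real n"
    and H: "\<And>x. H \<le> x \<Longrightarrow> far_tail 0 x < 1 / 3"
    and lam: "14400 \<le> lam" "64 * (2 * \<kappa> + 1) \<le> lam" "4 * H \<le> lam"
  shows "worst_delay line_graph Q0 Q1 V (msprt line_graph Q0 Q1 V R \<alpha>)
    \<le> ennreal (2400 * (1 / c + 1 + 1 / (1 - affinity))) * T_star line_graph Q0 Q1 V R \<alpha>"
proof -
  have r: "0 < affinity" "affinity < 1" by (rule affinity_pos) (rule affinity_less_1)
  have \<kappa>: "0 < \<kappa>" using r by (simp add: \<kappa>_def)
  define z where "z = exp (lam / 4)"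
  have n0: "0 < n" using lam(1) by (cases n) (auto simp: lam_def)
  have en: "exp lam = real n" using n0 by (simp add: lam_def)
  have zn: "real n = z ^ 4" unfolding z_def en[symmetric] by (simp add: exp_of_nat_mult[symmetric])
  have z: "3600 \<le> z" using exp_ge_add_one_self[of "lam / 4"] lam(1) unfolding z_def by linarith
  have zl: "2 * \<kappa> * lam + 3 \<le> z"
  proof -
    have "z = exp (lam / 8) ^ 2" unfolding z_def by (simp add: exp_of_nat_mult[symmetric])
    also have "\<dots> \<ge> (lam / 8) ^ 2"
      using exp_ge_add_one_self[of "lam / 8"] lam(1) by (intro power_mono) linarith+
    finally have "lam * lam / 64 \<le> z" by (simp add: power2_eq_square)
    moreover have "64 * (2 * \<kappa> + 1) * lam \<le> lam * lam" using lam by (intro mult_right_mono) auto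
    hence "(2 * \<kappa> + 1) * lam \<le> lam * lam / 64" by (simp add: algebra_simps)
    ultimately show ?thesis using lam(1) by (simp add: algebra_simps)
  qed
  (* After t1 steps the Hellinger bound alone makes both requirements hold; so t0 exists, is at
     most t1, and is tiny compared with n = z ^ 4. *)
  define t1 where "t1 = nat \<lceil>\<kappa> * lam\<rceil>"
  have nat_ceil: "x \<le> real (nat \<lceil>x\<rceil>)" "real (nat \<lceil>x\<rceil>) \<le> x + 1" if "0 \<le> x" for x :: real
    using that by linarith+
  have t1: "\<kappa> * lam \<le> real t1" "real t1 \<le> \<kappa> * lam + 1"
    unfolding t1_def by (rule nat_ceil, use \<kappa> lam(1) in simp)+
  have rt1: "affinity ^ t1 \<le> exp (- lam)"
  proof -
    have "affinity ^ t1 = exp (real t1 * ln affinity)" using r by (simp add: exp_of_nat_mult)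
    also have "\<dots> \<le> exp ((\<kappa> * lam) * ln affinity)"
      using t1(1) r by (intro exp_le_cancel_iff[THEN iffD2] mult_right_mono_neg) auto
    also have "(\<kappa> * lam) * ln affinity = - lam" using r by (simp add: \<kappa>_def)
    finally show ?thesis .
  qed
  define good where "good t \<longleftrightarrow> 1 / 3 \<le> far_tail t (lam / 4) \<and> 1 / 4 \<le> near_tail (R + 1) t (lam / 8)" for t
  have half: "exp ((x + 1) / 2) * affinity ^ t1 \<le> 1 / 2" if "x \<le> lam / 4" for x
  proof -
    have "exp ((x + 1) / 2) * affinity ^ t1 \<le> exp ((x + 1) / 2) * exp (- lam)"
      using rt1 by (intro mult_left_mono) auto
    also have "\<dots> = exp ((x + 1) / 2 - lam)" by (simp add: mult_exp_exp)
    also have "\<dots> \<le> exp (- 1)"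
    proof -
      have "x + 1 \<le> 2 * (lam - 1)" using that lam(1) by simp
      hence "(x + 1) / 2 - lam \<le> - 1" by (simp add: field_simps)
      thus ?thesis by (simp only: exp_le_cancel_iff)
    qed
    also have "\<dots> \<le> 1 / 2" using exp_ge_add_one_self[of "1::real"] by (simp add: exp_minus field_simps)
    finally show ?thesis .
  qed
  have "good t1"
    using far_tail_ge[of "lam / 4" t1] near_tail_ge[of "R + 1" "lam / 8" t1] half[of "lam / 4"] half[of "lam / 8"] lam(1)
    unfolding good_def by auto
  define t0 where "t0 = (LEAST t. good t)"
  have g0: "good t0" unfolding t0_def by (rule LeastI) (rule \<open>good t1\<close>)
  have t01: "t0 \<le> t1" unfolding t0_def by (rule Least_le) (rule \<open>good t1\<close>)
  have "\<not> good 0" using H[of "lam / 4"] lam(3) by (simp add: good_def)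
  hence t0: "0 < t0" using g0 by (cases t0) auto
  define t where "t = t0 - 1"
  have tt: "t + 1 = t0" using t0 by (simp add: t_def)
  have ng: "\<not> good t" using not_less_Least[of t good] t0 by (simp add: t0_def[symmetric] t_def)
  have tz: "2 * real t + 1 \<le> z" "2 * real t1 \<le> z"
  proof -
    have "real t \<le> real t1" using t01 by (simp add: t_def)
    thus "2 * real t + 1 \<le> z" "2 * real t1 \<le> z" using t1(2) zl by linarith+
  qed
  have z4: "z ^ 4 = z * z * (z * z)" by (simp add: power4_eq_xxxx)
  have e8: "exp (- (lam / 8)) \<le> 1 / 60"
  proof -
    have "60 \<le> exp (lam / 8)" using exp_ge_add_one_self[of "lam / 8"] lam(1) by linarith
    thus ?thesis by (simp add: exp_minus field_simps)
  qed
  have zn1: "z \<le> real n"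
  proof -
    have "z * 1 \<le> z * (z * (z * z))" using z by (intro mult_left_mono) (auto intro!: mult_ge1_I)
    thus ?thesis by (simp add: zn z4 mult.assoc)
  qed
  have n2: "2 * (R + 1) < n"
  proof -
    have "real (2 * (R + 1)) < real n" using R0 zn1 z by simp
    thus ?thesis by (simp only: of_nat_less_iff)
  qed
  have lower: "ennreal (real t0 * (1 / 10)) \<le> T_star line_graph Q0 Q1 V R \<alpha>"
  proof (cases "far_tail t (lam / 4) < 1 / 3")
    case True
    (* With about sqrt n sources and truncation at n powr (1 / 4) the deviation of the mixture is
       at most n powr (- 1 / 8) times the number of sources. *)
    define M where "M = nat \<lceil>sqrt (real n)\<rceil>"
    have sn: "sqrt (real n) = z * z"
      unfolding zn z4 using z by (intro real_sqrt_unique) (auto simp: power2_eq_square)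
    have M: "z * z \<le> real M" "real M \<le> z * z + 1"
      unfolding M_def sn by (rule nat_ceil, simp)+
    have M0: "0 < M" using M(1) z by (cases M) (auto simp: mult_le_0_iff)
    have big: "2 * (R + 1 + M * (2 * t + 1)) < n"
    proof -
      have "real M * (2 * real t + 1) \<le> (z * z + 1) * z"
        using M tz(1) z by (intro mult_mono) auto
      also have "\<dots> \<le> (2 * (z * z)) * z" using z mult_ge1_I[of z z] by (intro mult_right_mono) auto
      also have "\<dots> \<le> z ^ 4 / 16"
      proof -
        have "32 * (z * z * z) \<le> z * (z * z * z)" using z by (intro mult_right_mono) auto
        thus ?thesis by (simp add: z4 mult_ac)
      qed
      finally have "real M * (2 * real t + 1) \<le> real n / 16" by (simp add: zn)
      moreover have "real (2 * (R + 1 + M * (2 * t + 1))) = 2 * (real R + 1 + real M * (2 * real t + 1))" by (simp add: algebra_simps)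
      moreover have "2 * (real R + 1 + P) < real n" if "P \<le> real n / 16" for P
      proof -
        have "16 * P \<le> real n" using that by simp
        moreover have "3600 \<le> real n" using zn1 z by linarith
        ultimately have "2 * (real R + 1 + P) * 8 < real n * 8"
          using R0 unfolding distrib_left distrib_right by linarith
        thus ?thesis by simp
      qed
      ultimately have "real (2 * (R + 1 + M * (2 * t + 1))) < real n" by presburger
      thus ?thesis by (simp only: of_nat_less_iff)
    qed
    have sq: "sqrt (exp (lam / 4) / real M) \<le> 1 / 60"
    proof -
      have "exp (lam / 4) / real M \<le> z / (z * z)"
        unfolding z_def[symmetric] using M(1) M0 z by (intro divide_left_mono mult_pos_pos) auto
      also have "\<dots> = inverse z" using z by (simp add: divide_inverse)
      also have "\<dots> = exp (- (lam / 4))" by (simp only: z_def exp_minus)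
      also have "\<dots> = (exp (- (lam / 8)))\<^sup>2" by (simp add: power2_eq_square mult_exp_exp)
      finally have "sqrt (exp (lam / 4) / real M) \<le> exp (- (lam / 8))"
        by (intro real_le_lsqrt) auto
      thus ?thesis using e8 by linarith
    qed
    have "real t0 * (1 / 10) \<le> real (t + 1) * (1 - (\<alpha> + 1 / 2 + far_tail t (lam / 4) + sqrt (exp (lam / 4) / real M)))"
      unfolding tt using True sq \<alpha> by (intro mult_left_mono) auto
    thus ?thesis
      using T_star_ge_far[OF V M0 big, of \<alpha> "lam / 4"] \<alpha>(1) by (meson ennreal_leI less_imp_le order_trans)
  next
    case False
    hence nt: "near_tail (R + 1) t (lam / 8) < 1 / 4" using ng by (simp add: good_def)
    (* A failure of the near requirement alone is possible only for small R, and then the R + 1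
       outputs on one side do not spoil the two-point bound. *)
    have R2t: "R + 1 \<le> 2 * t"
    proof (rule ccontr)
      assume "\<not> R + 1 \<le> 2 * t"
      hence "far_tail t (lam / 8 + lam / 8) - exp (- (lam / 8)) \<le> near_tail (R + 1) t (lam / 8)"
        by (intro near_tail_ge_far_tail) simp
      thus False using False nt e8 by (simp add: field_simps)
    qed
    hence Rz: "real (R + 1) \<le> z" using tz(1) by linarith
    have "exp (lam / 8) * (real (R + 1) * (\<alpha> / real n)) \<le> z * (z * (1 / real n))"
    proof (intro mult_mono)
      show "exp (lam / 8) \<le> z" using lam(1) by (simp add: z_def)
    qed (use Rz \<alpha> z n0 in \<open>auto simp: divide_right_mono\<close>)
    also have "\<dots> = 1 / (z * z)" using z by (simp add: zn z4)
    also have "\<dots> \<le> 1 / (60 * 60)" using z by (intro divide_left_mono mult_mono) auto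
    finally have "exp (lam / 8) * (real (R + 1) * (\<alpha> / real n)) \<le> 1 / 3600" by simp
    hence "real t0 * (1 / 10) \<le> real (t + 1) * (1 - (\<alpha> + 2 * (exp (lam / 8) * (real (R + 1) * (\<alpha> / real n))) + 2 * near_tail (R + 1) t (lam / 8)))"
      unfolding tt using nt \<alpha> by (intro mult_left_mono) auto
    thus ?thesis
      using T_star_ge_near[OF V n2, of \<alpha> t "lam / 8"] \<alpha>(1) by (meson ennreal_leI less_imp_le order_trans)
  qed
  define w where "w = 120 * (t0 + 1)"
  have c0: "0 < c" by (simp add: c_def)
  have fV: "finite V" "card V = n" using V by (auto simp: closest_vertices_def)
  have upper: "(\<integral>\<^sup>+y. ennreal_of_enat (snd (msprt line_graph Q0 Q1 V R \<alpha>) y) \<partial>law (cascade v))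
     \<le> ennreal (real w * (1 / c + 1 + 1 / (1 - affinity)))" if v: "v \<in> V" for v
  proof -
    have "(\<integral>\<^sup>+y. ennreal_of_enat (snd (msprt line_graph Q0 Q1 V R \<alpha>) y) \<partial>law (cascade v))
      \<le> ennreal (real w / c + real (w * t1) * (real t1 * (real (card V) * exp (- (3 * lam))))
        + real (card V) * (sqrt (real (card V) / \<alpha>) * affinity ^ (w * t1)) / (1 - affinity))"
    (* 40 copies of lam / 8 cover the threshold ln (n / \<alpha>), which is at most 2 lam, and the
       loss of 3 lam on the other coordinates. *)
    proof (rule msprt_delay_le[OF fV(1) v, of 40])
      show "1 / 4 \<le> far_tail t0 (lam / 8)"
        using g0 far_tail_antimono[of "lam / 8" "lam / 4" t0] lam(1) by (auto simp: good_def)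
      show "1 / 4 \<le> near_tail (R + 1) t0 (lam / 8)" using g0 by (simp add: good_def)
      have "ln (real n / \<alpha>) = lam + ln (1 / \<alpha>)" using n0 \<alpha>(1) by (simp add: lam_def ln_div)
      also have "ln (1 / \<alpha>) \<le> lam" unfolding lam_def using \<alpha> n0 by (intro ln_mono) auto
      finally show "ln (real (card V) / \<alpha>) \<le> real 40 * (lam / 8) - 3 * lam" by (simp add: fV(2))
    qed (use \<alpha> in \<open>auto simp: w_def c_def\<close>)
    also have "\<dots> \<le> ennreal (real w * (1 / c + 1 + 1 / (1 - affinity)))"
    proof (rule ennreal_leI)
      have e3: "exp (- (3 * lam)) = 1 / (real n * real n * real n)"
        by (simp add: exp_minus en[symmetric] exp_add[symmetric] field_simps)
      have "real t1 * (real t1 * (real (card V) * exp (- (3 * lam)))) = (real t1 / real n) * (real t1 / real n)"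
        unfolding fV(2) e3 using n0 by (simp add: field_simps)
      also have "\<dots> \<le> 1 * 1"
        using tz(2) zn1 n0 by (intro mult_mono) auto
      finally have m1: "real (w * t1) * (real t1 * (real (card V) * exp (- (3 * lam)))) \<le> real w"
        using mult_left_mono[of _ 1 "real w"] by (simp add: mult.assoc)
      have "sqrt (real n / \<alpha>) \<le> real n"
      proof (rule real_le_lsqrt)
        have "real n * (1 / \<alpha>) \<le> real n * real n" using \<alpha>(3) by (intro mult_left_mono) auto
        thus "real n / \<alpha> \<le> (real n)\<^sup>2" by (simp add: power2_eq_square)
      qed auto
      moreover have "affinity ^ (w * t1) \<le> 1 / (real n * real n)"
      proof -
        have "affinity ^ (w * t1) \<le> affinity ^ (t1 + t1)"
        proof (rule power_decreasing)
          have "2 * t1 \<le> w * t1" by (intro mult_le_mono1) (simp add: w_def)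
          thus "t1 + t1 \<le> w * t1" by (simp only: mult_2)
        qed (use r in auto)
        also have "\<dots> = affinity ^ t1 * affinity ^ t1" by (rule power_add)
        also have "\<dots> \<le> exp (- lam) * exp (- lam)" using rt1 r by (intro mult_mono) auto
        also have "\<dots> = 1 / (real n * real n)" by (simp add: exp_minus en field_simps)
        finally show ?thesis .
      qed
      ultimately have "sqrt (real n / \<alpha>) * affinity ^ (w * t1) \<le> real n * (1 / (real n * real n))"
        using r \<alpha> by (intro mult_mono) auto
      hence "real n * (sqrt (real n / \<alpha>) * affinity ^ (w * t1)) \<le> 1"
        using n0 mult_left_mono[of "sqrt (real n / \<alpha>) * affinity ^ (w * t1)" "real n * (1 / (real n * real n))" "real n"] by simp
      hence "real (card V) * (sqrt (real (card V) / \<alpha>) * affinity ^ (w * t1)) / (1 - affinity) \<le> 1 / (1 - affinity)"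
        unfolding fV(2) using r by (intro divide_right_mono) auto
      also have "\<dots> \<le> real w * (1 / (1 - affinity))"
        using r mult_right_mono[of 1 "real w" "1 / (1 - affinity)"] by (simp add: w_def)
      finally show "real w / c + real (w * t1) * (real t1 * (real (card V) * exp (- (3 * lam))))
        + real (card V) * (sqrt (real (card V) / \<alpha>) * affinity ^ (w * t1)) / (1 - affinity)
        \<le> real w * (1 / c + 1 + 1 / (1 - affinity))"
        using m1 by (simp add: algebra_simps)
    qed
    finally show ?thesis .
  qed
  have "worst_delay line_graph Q0 Q1 V (msprt line_graph Q0 Q1 V R \<alpha>) \<le> ennreal (real w * (1 / c + 1 + 1 / (1 - affinity)))"
    unfolding worst_delay_msprt by (rule SUP_least) (rule upper)
  also have "\<dots> \<le> ennreal ((2400 * (1 / c + 1 + 1 / (1 - affinity))) * (real t0 * (1 / 10)))"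
  proof (rule ennreal_leI)
    have "real w \<le> 240 * real t0" using t0 by (simp add: w_def)
    hence "real w * (1 / c + 1 + 1 / (1 - affinity)) \<le> 240 * real t0 * (1 / c + 1 + 1 / (1 - affinity))"
      using c0 r by (intro mult_right_mono) auto
    thus "real w * (1 / c + 1 + 1 / (1 - affinity)) \<le> (2400 * (1 / c + 1 + 1 / (1 - affinity))) * (real t0 * (1 / 10))"
      by (simp add: algebra_simps)
  qed
  also have "\<dots> = ennreal (2400 * (1 / c + 1 + 1 / (1 - affinity))) * ennreal (real t0 * (1 / 10))"
    using c0 r by (intro ennreal_mult) auto
  also have "\<dots> \<le> ennreal (2400 * (1 / c + 1 + 1 / (1 - affinity))) * T_star line_graph Q0 Q1 V R \<alpha>"
    by (rule mult_left_mono[OF lower]) simp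
  finally show ?thesis .
qed

lemma msprt_optimal_up_to_constant:
  "\<exists>K>0. \<forall>v0 V R. source_setup line_graph v0 V R \<longrightarrow> (\<lambda>n. real (R n) / real n) \<longlonglongrightarrow> 0 \<longrightarrow>
     lesssim (\<lambda>n \<alpha>. worst_delay line_graph Q0 Q1 (V n) (msprt line_graph Q0 Q1 (V n) (R n) \<alpha>))
       (\<lambda>n \<alpha>. ennreal K * T_star line_graph Q0 Q1 (V n) (R n) \<alpha>)"
proof -
  obtain H where H: "\<And>x. H \<le> x \<Longrightarrow> far_tail 0 x < 1 / 3"
    using far_tail_0_small[of "1 / 3"] by auto
  define K where "K = 2400 * (1 / (1 / 4) ^ 120 + 1 + 1 / (1 - affinity))"
  have K: "0 < K" unfolding K_def using affinity_less_1 by (intro mult_pos_pos add_pos_pos) auto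
  have "lesssim (\<lambda>n \<alpha>. worst_delay line_graph Q0 Q1 (V n) (msprt line_graph Q0 Q1 (V n) (R n) \<alpha>))
       (\<lambda>n \<alpha>. ennreal K * T_star line_graph Q0 Q1 (V n) (R n) \<alpha>)"
    if S: "source_setup line_graph v0 V R" and small: "(\<lambda>n. real (R n) / real n) \<longlonglongrightarrow> 0" for v0 V R
  proof (rule lesssimI)
    fix \<epsilon> :: real assume \<epsilon>: "0 < \<epsilon>" "\<epsilon> < 1"
    have R: "\<forall>\<^sub>F n in sequentially. real (R n) \<le> 1 / 16 * real n"
      by (rule eventually_small_ratio[OF small]) simp
    have "\<forall>\<^sub>F \<alpha> in at_right (0::real). 0 < \<alpha> \<and> \<alpha> < 1 / 20"
      by (intro eventually_conj eventually_at_right_less eventually_at_right_field[THEN iffD2]) (auto intro: exI[of _ "1 / 20"])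
    thus "\<forall>\<^sub>F \<alpha> in at_right 0. \<forall>\<^sub>F n in sequentially. worst_delay line_graph Q0 Q1 (V n) (msprt line_graph Q0 Q1 (V n) (R n) \<alpha>)
       \<le> ennreal (1 + \<epsilon>) * (ennreal K * T_star line_graph Q0 Q1 (V n) (R n) \<alpha>)"
    proof eventually_elim
      fix \<alpha> :: real assume \<alpha>: "0 < \<alpha> \<and> \<alpha> < 1 / 20"
      have "\<forall>\<^sub>F n in sequentially. 1 / \<alpha> \<le> real n"
        using filterlim_real_sequentially by (simp add: filterlim_at_top)
      thus "\<forall>\<^sub>F n in sequentially. worst_delay line_graph Q0 Q1 (V n) (msprt line_graph Q0 Q1 (V n) (R n) \<alpha>)
         \<le> ennreal (1 + \<epsilon>) * (ennreal K * T_star line_graph Q0 Q1 (V n) (R n) \<alpha>)"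
        using R eventually_ln_ge[of 14400] eventually_ln_ge[of "64 * (2 * (1 / (- ln affinity)) + 1)"] eventually_ln_ge[of "4 * H"]
      proof eventually_elim
        case (elim n)
        have V: "closest_vertices line_graph v0 n (V n)" using S by (simp add: source_setup_def)
        have "worst_delay line_graph Q0 Q1 (V n) (msprt line_graph Q0 Q1 (V n) (R n) \<alpha>)
          \<le> ennreal K * T_star line_graph Q0 Q1 (V n) (R n) \<alpha>"
          unfolding K_def by (rule msprt_delay_le_T_star[OF V _ _ _ _ H]) (use elim \<alpha> in auto)
        also have "\<dots> \<le> ennreal (1 + \<epsilon>) * (ennreal K * T_star line_graph Q0 Q1 (V n) (R n) \<alpha>)"
        proof -
          have "1 \<le> ennreal (1 + \<epsilon>)" using ennreal_leI[of 1 "1 + \<epsilon>"] \<epsilon> by simp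
          hence "1 * (ennreal K * T_star line_graph Q0 Q1 (V n) (R n) \<alpha>)
            \<le> ennreal (1 + \<epsilon>) * (ennreal K * T_star line_graph Q0 Q1 (V n) (R n) \<alpha>)"
            by (rule mult_right_mono) simp
          thus ?thesis by (simp only: mult_1_left)
        qed
        finally show ?case .
      qed
    qed
  qed
  thus ?thesis using K by blast
qed

end

section \<open>Small and large radii\<close>

lemma ratio_tendsto_0_le:
  fixes f g :: "nat \<Rightarrow> real"
  assumes "(\<lambda>n. f n / g n) \<longlonglongrightarrow> 0" "0 < e" "\<forall>\<^sub>F n in sequentially. 0 < g n"
  shows "\<forall>\<^sub>F n in sequentially. f n \<le> e * g n"
  using order_tendstoD(2)[OF assms(1,2)] assms(3)
  by eventually_elim (simp add: pos_divide_less_eq less_imp_le)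

context mutual_ac_laws
begin

text \<open>For \<open>R << sqrt (ln n)\<close> the relevant times are large compared with \<open>R\<close>, and
  \<open>f_line (R + 1) t\<close> is bounded by \<open>(R + 1) (t + 1)\<close>. The factor \<open>2\<close> comes from \<open>R + 1 \<le> 2 R\<close>. If the
  divergence is infinite the left-hand side is \<open>0\<close>.\<close>

lemma T_star_lower_small_radius:
  assumes S: "source_setup line_graph v0 V R" and small: "(\<lambda>n. real (R n) / real n) \<longlonglongrightarrow> 0"
    and R: "(\<lambda>n. real (R n) / sqrt (ln (real n))) \<longlonglongrightarrow> 0"
    and pos: "0 < sym_KL Q0 Q1"
  shows "lesssim (\<lambda>n \<alpha>. ennreal (ln (real n)) / (2 * of_nat (R n) * sym_KL Q0 Q1))
     (\<lambda>n \<alpha>. T_star line_graph Q0 Q1 (V n) (R n) \<alpha>)"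
proof (cases "integrable Q1 (log_lr Q0 Q1) \<and> integrable Q0 (log_lr Q1 Q0)")
  case False
  have R0: "0 < R n" for n using S by (simp add: source_setup_def)
  have zero: "ennreal (ln (real n)) / (2 * of_nat (R n) * sym_KL Q0 Q1) = 0" for n
    using False R0[of n] by (auto simp: sym_KL_def ennreal_mult_top)
  show ?thesis unfolding zero by (intro lesssimI) simp
next
  case True
  define D where "D = (\<integral>x. log_lr Q0 Q1 x \<partial>Q1) + (\<integral>x. log_lr Q1 Q0 x \<partial>Q0)"
  have sym: "sym_KL Q0 Q1 = ennreal D" using True by (simp add: sym_KL_def KL_divergence_def D_def)
  have D: "0 < D" using pos by (simp add: sym)
  have R0: "1 \<le> R n" for n using S by (simp add: source_setup_def Suc_leI)
  have sq: "\<forall>\<^sub>F n in sequentially. 0 < sqrt (ln (real n))"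
    using eventually_ln_ge[of 1] by eventually_elim simp
  have Rs: "\<forall>\<^sub>F n in sequentially. real (R n) \<le> e * sqrt (ln (real n))" if "0 < e" for e
    by (rule ratio_tendsto_0_le[OF R that sq])
  have "lesssim (\<lambda>n \<alpha>. ennreal (ln (real n) / (2 * real (R n) * D))) (\<lambda>n \<alpha>. T_star line_graph Q0 Q1 (V n) (R n) \<alpha>)"
  proof (rule T_star_lower_lesssim[where A="\<lambda>\<eta> n. (1 - \<eta>) * ln (real n) / (real (R n + 1) * (D * (1 + \<eta>)))"])
    show "integrable Q1 (log_lr Q0 Q1)" "integrable Q0 (log_lr Q1 Q0)" using True by auto
    show "D = (\<integral>x. log_lr Q0 Q1 x \<partial>Q1) + (\<integral>x. log_lr Q1 Q0 x \<partial>Q0)" by (rule D_def)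
    show "0 < D" by (rule D)
    show "source_setup line_graph v0 V R" by (rule S)
    show "(\<lambda>n. real (R n) / real n) \<longlonglongrightarrow> 0" by (rule small)
  next
    fix \<eta> :: real assume \<eta>: "0 < \<eta>" "\<eta> < 1 / 10"
    let ?c = "(1 - \<eta>) / (2 * D * (1 + \<eta>))"
    have c: "0 < ?c" using \<eta> D by simp
    have "filterlim (\<lambda>n. ?c * sqrt (ln (real n))) at_top sequentially"
      using c by (intro filterlim_tendsto_pos_mult_at_top[OF tendsto_const _ filterlim_compose[OF sqrt_at_top ln_real_at_top]])
    moreover have "\<forall>\<^sub>F n in sequentially. ?c * sqrt (ln (real n)) \<le> (1 - \<eta>) * ln (real n) / (real (R n + 1) * (D * (1 + \<eta>)))"
      using Rs[OF zero_less_one] eventually_ln_ge[of 1]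
    proof eventually_elim
      case (elim n)
      have l: "sqrt (ln (real n)) * sqrt (ln (real n)) = ln (real n)" using elim(2) by simp
      have s0: "0 < sqrt (ln (real n))" using elim(2) by simp
      have "real (R n + 1) \<le> 2 * sqrt (ln (real n))" using elim(1) R0[of n] by simp
      hence "(1 - \<eta>) * ln (real n) / (2 * sqrt (ln (real n)) * (D * (1 + \<eta>)))
         \<le> (1 - \<eta>) * ln (real n) / (real (R n + 1) * (D * (1 + \<eta>)))"
        using \<eta> D elim(2) by (intro divide_left_mono mult_right_mono mult_pos_pos) auto
      moreover have "(1 - \<eta>) * ln (real n) / (2 * sqrt (ln (real n)) * (D * (1 + \<eta>))) = ?c * sqrt (ln (real n))"
      proof -
        have "(1 - \<eta>) * (s * s) / (2 * s * (D * (1 + \<eta>))) = ?c * s" if "0 < s" for s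
          using that by (simp add: mult.assoc mult.left_commute)
        from this[OF s0] show ?thesis unfolding l .
      qed
      ultimately show ?case by simp
    qed
    ultimately show "filterlim (\<lambda>n. (1 - \<eta>) * ln (real n) / (real (R n + 1) * (D * (1 + \<eta>)))) at_top sequentially"
      by (rule filterlim_at_top_mono)
  next
    fix \<eta> :: real and n k :: nat
    assume \<eta>: "0 < \<eta>" "\<eta> < 1 / 10" and n: "1 < n"
      and k: "real (k + 1) \<le> (1 - \<eta>) * ln (real n) / (real (R n + 1) * (D * (1 + \<eta>)))"
    have pos: "0 < D * (1 + \<eta>)" using D \<eta> by simp
    have "real (f_line (R n + 1) k) \<le> real ((R n + 1) * (k + 1))"
      using f_line_le(1) by (simp only: of_nat_le_iff)
    hence "real (f_line (R n + 1) k) * (D * (1 + \<eta>)) \<le> real ((R n + 1) * (k + 1)) * (D * (1 + \<eta>))"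
      using pos by (intro mult_right_mono) auto
    also have "\<dots> = real (k + 1) * (real (R n + 1) * (D * (1 + \<eta>)))" by (simp only: of_nat_mult mult_ac)
    also have "\<dots> \<le> (1 - \<eta>) * ln (real n)"
      using k pos by (subst (asm) pos_le_divide_eq) auto
    finally show "real (f_line (R n + 1) k) * (D * (1 + \<eta>)) \<le> (1 - \<eta>) * ln (real n)" .
  next
    fix \<eta> :: real assume \<eta>: "0 < \<eta>" "\<eta> < 1 / 10"
    show "\<forall>\<^sub>F n in sequentially. real (R n) \<le> exp (\<eta> / 2 * ln (real n))"
      using Rs[OF zero_less_one] eventually_ln_ge[of "(2 / \<eta>)\<^sup>2"] eventually_ln_ge[of 1]
    proof eventually_elim
      case (elim n)
      have "2 / \<eta> \<le> sqrt (ln (real n))" using elim(2) by (rule real_le_rsqrt)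
      hence "1 \<le> \<eta> / 2 * sqrt (ln (real n))" using \<eta> by (simp add: field_simps)
      hence "sqrt (ln (real n)) * 1 \<le> sqrt (ln (real n)) * (\<eta> / 2 * sqrt (ln (real n)))"
        using elim(3) by (intro mult_left_mono) auto
      also have "\<dots> = \<eta> / 2 * (sqrt (ln (real n)) * sqrt (ln (real n)))" by simp
      also have "\<dots> = \<eta> / 2 * ln (real n)" using elim(3) by simp
      finally show ?case using elim(1) exp_ge_add_one_self[of "\<eta> / 2 * ln (real n)"] by linarith
    qed
  next
    fix \<eta> :: real and n :: nat
    assume \<eta>: "0 < \<eta>" "\<eta> < 1 / 10" and n: "1 < n"
    have "ln (real n) / (2 * real (R n) * D) \<le> ln (real n) / (real (R n + 1) * D)"
      using n D R0[of n] by (intro divide_left_mono mult_right_mono mult_pos_pos) auto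
    hence "ln (real n) / (2 * real (R n) * D) * (1 - \<eta>) \<le> ln (real n) / (real (R n + 1) * D) * (1 - \<eta>)"
      using \<eta> by (intro mult_right_mono) auto
    also have "\<dots> = (1 - \<eta>) * ln (real n) / (real (R n + 1) * (D * (1 + \<eta>))) * (1 + \<eta>)"
      using D \<eta> by (simp add: divide_simps) 
    finally show "ln (real n) / (2 * real (R n) * D) * (1 - \<eta>) \<le> (1 - \<eta>) * ln (real n) / (real (R n + 1) * (D * (1 + \<eta>))) * (1 + \<eta>)" .
  qed
  moreover have "ennreal (ln (real n)) / (2 * of_nat (R n) * sym_KL Q0 Q1) = ennreal (ln (real n) / (2 * real (R n) * D))" for n
  proof -
    have l: "0 \<le> ln (real n)" by (cases n) auto
    have "2 * of_nat (R n) * sym_KL Q0 Q1 = ennreal (2 * real (R n) * D)"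
      using D by (simp add: sym ennreal_mult ennreal_of_nat_eq_real_of_nat)
    thus ?thesis using l D R0[of n] by (simp add: divide_ennreal)
  qed
  ultimately show ?thesis by simp
qed

text \<open>By \<open>f_line_lower\<close>, waiting \<open>R\<close> steps longer than \<open>ln n / (R C)\<close> is enough, and \<open>R\<close> is
  negligible because \<open>R\<^sup>2 << ln n\<close>.\<close>

lemma T_star_upper_small_radius:
  assumes S: "source_setup line_graph v0 V R"
    and R: "(\<lambda>n. real (R n) / sqrt (ln (real n))) \<longlonglongrightarrow> 0"
    and C: "msprt_constant line_graph Q0 Q1 C"
  shows "lesssim (\<lambda>n \<alpha>. T_star line_graph Q0 Q1 (V n) (R n) \<alpha>) (\<lambda>n \<alpha>. ennreal (ln (real n) / (real (R n) * C)))"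
proof (rule T_star_upper_lesssim[OF C S])
  fix \<epsilon> :: real assume \<epsilon>: "0 < \<epsilon>" "\<epsilon> < 1"
  have C0: "0 < C" using C by (simp add: msprt_constant_def)
  have R0: "1 \<le> R n" for n using S by (simp add: source_setup_def Suc_leI)
  have sq: "\<forall>\<^sub>F n in sequentially. 0 < sqrt (ln (real n))"
    using eventually_ln_ge[of 1] by eventually_elim simp
  have "\<forall>\<^sub>F n in sequentially. real (R n) \<le> sqrt (\<epsilon> / (2 * C)) * sqrt (ln (real n))"
    using \<epsilon> C0 by (intro ratio_tendsto_0_le[OF R _ sq]) simp
  thus "\<forall>\<^sub>F n in sequentially. \<exists>t. ln (real n) / C \<le> real (f_line (R n + 1) t) \<and> real t \<le> (1 + \<epsilon>) * (ln (real n) / (real (R n) * C))"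
    using eventually_ln_ge[of 1]
  proof eventually_elim
    case (elim n)
    define x where "x = ln (real n) / (real (R n) * C)"
    have x0: "0 \<le> x" using elim(2) C0 R0[of n] by (simp add: x_def)
    define t where "t = nat \<lceil>x\<rceil> + R n"
    have t: "x + real (R n) \<le> real t" "real t \<le> x + 1 + real (R n)"
      using x0 unfolding t_def by linarith+
    have "ln (real n) / C = real (R n) * x" using R0[of n] by (simp add: x_def)
    also have "\<dots> \<le> real (R n + 1) * (real (t + 1) - real (R n + 1))"
      using t(1) x0 by (intro mult_mono) auto
    also have "\<dots> \<le> real (f_line (R n + 1) t)" by (rule f_line_lower)
    finally have 1: "ln (real n) / C \<le> real (f_line (R n + 1) t)" .
    have "(real (R n))\<^sup>2 \<le> (sqrt (\<epsilon> / (2 * C)) * sqrt (ln (real n)))\<^sup>2"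
      using elim(1) by (intro power_mono) auto
    also have "\<dots> = \<epsilon> / (2 * C) * ln (real n)" using \<epsilon> C0 elim(2) by (simp add: power_mult_distrib)
    finally have "2 * (real (R n))\<^sup>2 \<le> \<epsilon> * ln (real n) / C" by (simp add: field_simps)
    moreover have "real (R n) * (1 + real (R n)) \<le> 2 * (real (R n))\<^sup>2"
      using R0[of n] by (simp add: power2_eq_square algebra_simps)
    ultimately have "real (R n) * (1 + real (R n)) \<le> real (R n) * (\<epsilon> * x)"
      using R0[of n] by (simp add: x_def field_simps)
    hence "1 + real (R n) \<le> \<epsilon> * x" using R0[of n] by simp
    hence "real t \<le> (1 + \<epsilon>) * x" using t(2) by (simp add: algebra_simps)
    thus ?case using 1 unfolding x_def by blast
  qed
qed

text \<open>The neighbourhoods have \<open>(t + 1)\<^sup>2\<close> points up to time \<open>t\<close>, which bounds \<open>f_line\<close> for all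
  distances.\<close>

lemma T_star_lower_large_radius:
  assumes S: "source_setup line_graph v0 V R" and small: "(\<lambda>n. real (R n) / real n) \<longlonglongrightarrow> 0"
    and R: "(\<lambda>n. ln (real (R n)) / ln (real n)) \<longlonglongrightarrow> 0"
    and pos: "0 < sym_KL Q0 Q1"
  shows "lesssim (\<lambda>n \<alpha>. ennreal (sqrt (enn2real (ennreal (ln (real n)) / sym_KL Q0 Q1))))
     (\<lambda>n \<alpha>. T_star line_graph Q0 Q1 (V n) (R n) \<alpha>)"
proof (cases "integrable Q1 (log_lr Q0 Q1) \<and> integrable Q0 (log_lr Q1 Q0)")
  case False
  have zero: "ennreal (sqrt (enn2real (ennreal (ln (real n)) / sym_KL Q0 Q1))) = 0" for n
    using False by (auto simp: sym_KL_def)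
  show ?thesis unfolding zero by (intro lesssimI) simp
next
  case True
  define D where "D = (\<integral>x. log_lr Q0 Q1 x \<partial>Q1) + (\<integral>x. log_lr Q1 Q0 x \<partial>Q0)"
  have sym: "sym_KL Q0 Q1 = ennreal D" using True by (simp add: sym_KL_def KL_divergence_def D_def)
  have D: "0 < D" using pos by (simp add: sym)
  have R0: "1 \<le> R n" for n using S by (simp add: source_setup_def Suc_leI)
  have lp: "\<forall>\<^sub>F n in sequentially. 0 < ln (real n)"
    using eventually_ln_ge[of 1] by eventually_elim simp
  have "lesssim (\<lambda>n \<alpha>. ennreal (sqrt (ln (real n) / D))) (\<lambda>n \<alpha>. T_star line_graph Q0 Q1 (V n) (R n) \<alpha>)"
  proof (rule T_star_lower_lesssim[where A="\<lambda>\<eta> n. sqrt ((1 - \<eta>) * ln (real n) / (D * (1 + \<eta>)))"])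
    show "integrable Q1 (log_lr Q0 Q1)" "integrable Q0 (log_lr Q1 Q0)" using True by auto
    show "D = (\<integral>x. log_lr Q0 Q1 x \<partial>Q1) + (\<integral>x. log_lr Q1 Q0 x \<partial>Q0)" by (rule D_def)
    show "0 < D" by (rule D)
    show "source_setup line_graph v0 V R" by (rule S)
    show "(\<lambda>n. real (R n) / real n) \<longlonglongrightarrow> 0" by (rule small)
  next
    fix \<eta> :: real assume \<eta>: "0 < \<eta>" "\<eta> < 1 / 10"
    let ?c = "(1 - \<eta>) / (D * (1 + \<eta>))"
    have c: "0 < ?c" using \<eta> D by simp
    have "filterlim (\<lambda>n. sqrt (?c * ln (real n))) at_top sequentially"
      using c by (intro filterlim_compose[OF sqrt_at_top] filterlim_tendsto_pos_mult_at_top[OF tendsto_const _ ln_real_at_top])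
    thus "filterlim (\<lambda>n. sqrt ((1 - \<eta>) * ln (real n) / (D * (1 + \<eta>)))) at_top sequentially" by simp
  next
    fix \<eta> :: real and n k :: nat
    assume \<eta>: "0 < \<eta>" "\<eta> < 1 / 10" and n: "1 < n"
      and k: "real (k + 1) \<le> sqrt ((1 - \<eta>) * ln (real n) / (D * (1 + \<eta>)))"
    have pos: "0 < D * (1 + \<eta>)" using D \<eta> by simp
    have a0: "0 \<le> (1 - \<eta>) * ln (real n) / (D * (1 + \<eta>))" using \<eta> D n by simp
    have "real (f_line (R n + 1) k) \<le> real ((k + 1)\<^sup>2)"
      using f_line_le(2) by (simp only: of_nat_le_iff)
    also have "\<dots> = (real (k + 1))\<^sup>2" by (rule of_nat_power)
    also have "\<dots> \<le> (sqrt ((1 - \<eta>) * ln (real n) / (D * (1 + \<eta>))))\<^sup>2"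
      using k by (intro power_mono) auto
    also have "\<dots> = (1 - \<eta>) * ln (real n) / (D * (1 + \<eta>))" using a0 by (rule real_sqrt_pow2)
    finally show "real (f_line (R n + 1) k) * (D * (1 + \<eta>)) \<le> (1 - \<eta>) * ln (real n)"
      using pos by (simp only: pos_le_divide_eq)
  next
    fix \<eta> :: real assume \<eta>: "0 < \<eta>" "\<eta> < 1 / 10"
    have "\<forall>\<^sub>F n in sequentially. ln (real (R n)) \<le> \<eta> / 2 * ln (real n)"
      using \<eta> by (intro ratio_tendsto_0_le[OF R _ lp]) simp
    thus "\<forall>\<^sub>F n in sequentially. real (R n) \<le> exp (\<eta> / 2 * ln (real n))"
    proof eventually_elim
      case (elim n)
      hence "exp (ln (real (R n))) \<le> exp (\<eta> / 2 * ln (real n))" by (simp only: exp_le_cancel_iff)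
      thus ?case using R0[of n] by simp
    qed
  next
    fix \<eta> :: real and n :: nat
    assume \<eta>: "0 < \<eta>" "\<eta> < 1 / 10" and n: "1 < n"
    let ?q = "(1 - \<eta>) / (1 + \<eta>)"
    have q: "0 \<le> ?q" "?q \<le> 1" using \<eta> by auto
    have "?q * ?q \<le> ?q" using mult_left_mono[OF q(2) q(1)] by simp
    hence qs: "?q \<le> sqrt ?q" by (intro real_le_rsqrt) (simp add: power2_eq_square)
    have "sqrt ((1 - \<eta>) * ln (real n) / (D * (1 + \<eta>))) = sqrt (ln (real n) / D) * sqrt ?q"
      by (simp only: real_sqrt_mult[symmetric]) (simp add: mult.commute)
    also have "\<dots> \<ge> sqrt (ln (real n) / D) * ?q" using qs n D by (intro mult_left_mono) auto
    finally have "sqrt (ln (real n) / D) * ?q * (1 + \<eta>) \<le> sqrt ((1 - \<eta>) * ln (real n) / (D * (1 + \<eta>))) * (1 + \<eta>)"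
      using \<eta> by (intro mult_right_mono) auto
    thus "sqrt (ln (real n) / D) * (1 - \<eta>) \<le> sqrt ((1 - \<eta>) * ln (real n) / (D * (1 + \<eta>))) * (1 + \<eta>)"
      using \<eta> by simp
  qed
  moreover have "enn2real (ennreal (ln (real n)) / sym_KL Q0 Q1) = ln (real n) / D" for n
  proof -
    have l: "0 \<le> ln (real n)" by (cases n) auto
    thus ?thesis using D by (simp add: sym divide_ennreal)
  qed
  ultimately show ?thesis by simp
qed

text \<open>For \<open>R >> sqrt (ln n)\<close> competitors at distance more than \<open>R\<close> are disjoint from the source during
  the relevant times, where \<open>f_line (R + 1) t = (t + 1)\<^sup>2\<close>.\<close>

lemma T_star_upper_large_radius:
  assumes S: "source_setup line_graph v0 V R"
    and R: "(\<lambda>n. sqrt (ln (real n)) / real (R n)) \<longlonglongrightarrow> 0"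
    and C: "msprt_constant line_graph Q0 Q1 C"
  shows "lesssim (\<lambda>n \<alpha>. T_star line_graph Q0 Q1 (V n) (R n) \<alpha>) (\<lambda>n \<alpha>. ennreal (sqrt (ln (real n) / C)))"
proof (rule T_star_upper_lesssim[OF C S])
  fix \<epsilon> :: real assume \<epsilon>: "0 < \<epsilon>" "\<epsilon> < 1"
  have C0: "0 < C" using C by (simp add: msprt_constant_def)
  have R0: "1 \<le> R n" for n using S by (simp add: source_setup_def Suc_leI)
  have Rp: "\<forall>\<^sub>F n in sequentially. 0 < real (R n)" using R0 by (simp add: Suc_le_eq)
  have "\<forall>\<^sub>F n in sequentially. sqrt (ln (real n)) \<le> sqrt C / 4 * real (R n)"
    using C0 by (intro ratio_tendsto_0_le[OF R _ Rp]) simp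
  thus "\<forall>\<^sub>F n in sequentially. \<exists>t. ln (real n) / C \<le> real (f_line (R n + 1) t) \<and> real t \<le> (1 + \<epsilon>) * sqrt (ln (real n) / C)"
    using eventually_ln_ge[of "C * (1 / \<epsilon>)\<^sup>2"]
  proof eventually_elim
    case (elim n)
    define x where "x = sqrt (ln (real n) / C)"
    have "(1 / \<epsilon>)\<^sup>2 \<le> ln (real n) / C" using elim(2) C0 by (simp add: field_simps)
    hence x: "1 / \<epsilon> \<le> x" unfolding x_def by (rule real_le_rsqrt)
    have x1: "1 \<le> \<epsilon> * x" using x \<epsilon> by (simp add: field_simps)
    have "1 \<le> 1 / \<epsilon>" using \<epsilon> by simp
    hence x2: "1 \<le> x" using x by linarith
    have xR: "4 * x \<le> real (R n)"
      using elim(1) C0 by (simp add: x_def real_sqrt_divide field_simps)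
    define t where "t = nat \<lceil>x\<rceil>"
    have t: "x \<le> real t" "real t \<le> x + 1" using x2 unfolding t_def by linarith+
    have "2 * t + 1 \<le> R n + 1"
    proof -
      have "real (2 * t + 1) \<le> real (R n + 1)" using t(2) x2 xR by simp
      thus ?thesis by (simp only: of_nat_le_iff)
    qed
    hence f: "f_line (R n + 1) t = (t + 1)\<^sup>2" by (rule f_line_big)
    have "0 \<le> ln (real n) / C" using C0 elim(2) by (smt (verit) \<open>(1 / \<epsilon>)\<^sup>2 \<le> ln (real n) / C\<close> zero_le_power2)
    hence "ln (real n) / C = x\<^sup>2" by (simp add: x_def)
    also have "\<dots> \<le> (real (t + 1))\<^sup>2" using t(1) x2 by (intro power_mono) auto
    also have "\<dots> = real (f_line (R n + 1) t)" unfolding f by (rule of_nat_power[symmetric])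
    finally have "ln (real n) / C \<le> real (f_line (R n + 1) t)" .
    moreover have "real t \<le> (1 + \<epsilon>) * x" using t(2) x1 by (simp add: algebra_simps)
    ultimately show ?case unfolding x_def by blast
  qed
qed

end

theorem corollary2:
  fixes Q0 Q1 :: "real measure"
  assumes "prob_space Q0" and "prob_space Q1"
    and "sets Q0 = sets borel" and "sets Q1 = sets borel"
    and "absolutely_continuous Q0 Q1" and "absolutely_continuous Q1 Q0"
    and "Q0 \<noteq> Q1"
  shows "(\<exists>K::real. 0 < K \<and>
            (\<forall>v0 V R. source_setup line_graph v0 V R \<longrightarrow>
               (\<lambda>n. real (R n) / real n) \<longlonglongrightarrow> 0 \<longrightarrow>
               lesssim
                 (\<lambda>n \<alpha>. worst_delay line_graph Q0 Q1 (V n) (msprt line_graph Q0 Q1 (V n) (R n) \<alpha>))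
                 (\<lambda>n \<alpha>. ennreal K * T_star line_graph Q0 Q1 (V n) (R n) \<alpha>)))
       \<and> (\<forall>C. msprt_constant line_graph Q0 Q1 C \<longrightarrow>
            (\<forall>v0 V R. source_setup line_graph v0 V R \<longrightarrow>
               (\<lambda>n. real (R n) / real n) \<longlonglongrightarrow> 0 \<longrightarrow>
               ((\<lambda>n. real (R n) / sqrt (ln (real n))) \<longlonglongrightarrow> 0 \<longrightarrow>
                  lesssim
                    (\<lambda>n \<alpha>. ennreal (ln (real n)) / (2 * of_nat (R n) * sym_KL Q0 Q1))
                    (\<lambda>n \<alpha>. T_star line_graph Q0 Q1 (V n) (R n) \<alpha>) \<and>
                  lesssim
                    (\<lambda>n \<alpha>. T_star line_graph Q0 Q1 (V n) (R n) \<alpha>)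
                    (\<lambda>n \<alpha>. ennreal (ln (real n) / (real (R n) * C)))) \<and>
               ((\<lambda>n. sqrt (ln (real n)) / real (R n)) \<longlonglongrightarrow> 0 \<longrightarrow>
                (\<lambda>n. ln (real (R n)) / ln (real n)) \<longlonglongrightarrow> 0 \<longrightarrow>
                  lesssim
                    (\<lambda>n \<alpha>. ennreal (sqrt (enn2real (ennreal (ln (real n)) / sym_KL Q0 Q1))))
                    (\<lambda>n \<alpha>. T_star line_graph Q0 Q1 (V n) (R n) \<alpha>) \<and>
                  lesssim
                    (\<lambda>n \<alpha>. T_star line_graph Q0 Q1 (V n) (R n) \<alpha>)
                    (\<lambda>n \<alpha>. ennreal (sqrt (ln (real n) / C))))))"
proof -
  interpret mutual_ac_laws Q0 Q1 by (rule mutual_ac_laws.intro) (rule assms)+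
  have pos: "0 < sym_KL Q0 Q1" if "msprt_constant line_graph Q0 Q1 C" for C
    using that unfolding msprt_constant_def by (meson le_less_trans zero_le)
  show ?thesis
    using msprt_optimal_up_to_constant T_star_lower_small_radius T_star_upper_small_radius
      T_star_lower_large_radius T_star_upper_large_radius pos
    by (intro conjI allI impI) blast+
qed

end
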